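(* Let $d\geq 1$ be an integer, $\alpha =2$, and let $\beta$ be a real number with $-d<\beta < \min\{2, -d+4\}$. Then $$ E_{2,\beta} = \begin{cases} - \dfrac{d (2-\beta)}{2\beta(4-\beta)} \, R_{2,\beta}^2 & \text{if } \beta\neq 0,\\[2ex] \dfrac14\left( \dfrac12 + \ln\dfrac d2 + \dfrac{\Gamma'(2)}{\Gamma(2)} - \dfrac{\Gamma'(\frac d2)}{\Gamma(\frac d2)} \right) & \text{if } \beta = 0. \end{cases} $$ The infimum defining $E_{2,\beta}$ is attained at $\mu\in P(\mathbb{R}^d)$ if and only if, for some $a\in\mathbb{R}^d$, $$ d\mu(x) = C_\beta^{-1} \ R_{2,\beta}^{\beta-2} \ (R_{2,\beta}^2 - |x-a|^2)^{\frac{2-\beta-d}2} \ \mathbf{1}_{B_{R_{2,\beta}}(a)}(x)\,dx \qquad\text{with}\qquad C_\beta := \pi^{\frac d2}\, \frac{\Gamma(\frac{4-\beta-d}{2})}{\Gamma(\frac{4-\beta}{2})} . $$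
   Context: $P(\mathbb{R}^d)$ denotes the set of Borel probability measures on $\mathbb{R}^d$. For $-d<\beta<\alpha<\infty$ and $\mu\in P(\mathbb{R}^d)$, $$ \mathcal E_{\alpha,\beta}[\mu] := \frac12 \iint_{\mathbb{R}^d\times\mathbb{R}^d} \left( \alpha^{-1}|x-y|^\alpha - \beta^{-1}|x-y|^\beta \right) d\mu(x)\,d\mu(y), $$ where $\gamma^{-1}|x-y|^\gamma$ for $\gamma=0$ is interpreted as $\ln|x-y|$. For $\alpha>0$ and $\beta\le 0$ the integrand is understood to be $+\infty$ when $x=y$; for $\alpha>0$ the integrand is bounded below, so $\mathcal E_{\alpha,\beta}[\mu]\in(-\infty,+\infty]$. The minimal energy is $$E_{\alpha,\beta} := \inf\{ \mathcal E_{\alpha,\beta}[\mu] : \mu\in P(\mathbb{R}^d)\},$$ and the infimum is attained at $\mu$ if $\mathcal E_{\alpha,\beta}[\mu]=E_{\alpha,\beta}$. For $-d<\beta<\min\{2,-d+4\}$, $$ R_{2,\beta} := \left( \frac{\Gamma(\frac{4-\beta}2)\,\Gamma(\frac{\beta+d}{2})}{\Gamma(1+\frac d2)} \right)^{\frac{1}{2-\beta}}. $$ $B_R(a)$ is the open ball of radius $R$ centered at $a$, $\mathbf 1_A$ is the indicator function of $A$, $dx$ is Lebesgue measure, and $\Gamma$ is the gamma function. *)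

theory Defs
  imports "HOL-Probability.Probability"
begin

definition borel_prob_measures :: "'a::topological_space measure set" where
  "borel_prob_measures = {\<mu>. prob_space \<mu> \<and> sets \<mu> = sets borel}"

definition pow_potential :: "real \<Rightarrow> real \<Rightarrow> real" where
  "pow_potential \<gamma> r = (if \<gamma> = 0 then ln r else r powr \<gamma> / \<gamma>)"

text \<open>Since \<open>0 powr \<beta> = 0\<close> and \<open>ln 0 = 0\<close> in HOL, the value \<open>\<infinity>\<close> at \<open>r = 0\<close> for
  \<open>\<beta> \<le> 0\<close> has to be prescribed.  It is the limit of the other branch as \<open>r\<close> decreases
  to \<open>0\<close> whenever \<open>\<beta> < \<alpha>\<close>.\<close>

definition interaction :: "real \<Rightarrow> real \<Rightarrow> real \<Rightarrow> ereal" where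
  "interaction \<alpha> \<beta> r =
     (if r = 0 \<and> \<beta> \<le> 0 then \<infinity> else ereal (pow_potential \<alpha> r - pow_potential \<beta> r))"

text \<open>Integral of an extended-real function as positive part minus negative part
  (\<open>e2ennreal\<close> sends negative values to \<open>0\<close>).  It is only meaningful if one of the
  two parts has finite integral; for a function that is bounded below and a probability
  measure, the negative part is always finite.\<close>

definition ereal_integral :: "'a measure \<Rightarrow> ('a \<Rightarrow> ereal) \<Rightarrow> ereal" where
  "ereal_integral M f =
     enn2ereal (\<integral>\<^sup>+ x. e2ennreal (f x) \<partial>M) - enn2ereal (\<integral>\<^sup>+ x. e2ennreal (- f x) \<partial>M)"

definition energy :: "real \<Rightarrow> real \<Rightarrow> 'a::euclidean_space measure \<Rightarrow> ereal" where
  "energy \<alpha> \<beta> \<mu> =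
     ereal (1 / 2) * ereal_integral (\<mu> \<Otimes>\<^sub>M \<mu>) (\<lambda>(x, y). interaction \<alpha> \<beta> (norm (x - y)))"

definition minimal_energy :: "'a::euclidean_space itself \<Rightarrow> real \<Rightarrow> real \<Rightarrow> ereal" where
  "minimal_energy _ \<alpha> \<beta> = (INF \<mu> \<in> (borel_prob_measures :: 'a measure set). energy \<alpha> \<beta> \<mu>)"

definition energy_minimizer :: "real \<Rightarrow> real \<Rightarrow> 'a::euclidean_space measure \<Rightarrow> bool" where
  "energy_minimizer \<alpha> \<beta> \<mu> \<longleftrightarrow>
     \<mu> \<in> borel_prob_measures \<and> energy \<alpha> \<beta> \<mu> = minimal_energy TYPE('a) \<alpha> \<beta>"

definition radius2 :: "nat \<Rightarrow> real \<Rightarrow> real" where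
  "radius2 d \<beta> =
     (Gamma ((4 - \<beta>) / 2) * Gamma ((\<beta> + real d) / 2) / Gamma (1 + real d / 2))
       powr (1 / (2 - \<beta>))"

definition norm_const :: "nat \<Rightarrow> real \<Rightarrow> real" where
  "norm_const d \<beta> =
     pi powr (real d / 2) * (Gamma ((4 - \<beta> - real d) / 2) / Gamma ((4 - \<beta>) / 2))"

end

theory Submission
  imports Defs "HOL-Real_Asymp.Real_Asymp"
begin

text \<open>
  Write \<open>k r\<close> for \<open>r powr \<beta> / \<beta>\<close> (\<open>ln r\<close> if \<open>\<beta> = 0\<close>) and \<open>J(\<mu>,\<nu>)\<close> for the double integral
  of \<open>k (|x - y|)\<close>.  Twice the energy of \<open>\<nu>\<close> is the double integral of \<open>|x - y|\<^sup>2 / 2 - k (|x - y|)\<close>,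
  and if \<open>\<nu>\<close> has mean \<open>b\<close>, the quadratic part of it is \<open>v = \<integral>|x - b|\<^sup>2 d\<nu>\<close>.  The theorem rests on two
  facts.

  \<^item> Conditional negative definiteness (\<open>pow_potential_negative_definite\<close>):
    \<open>J(\<nu>,\<nu>) + J(\<mu>,\<mu>) \<le> 2 J(\<nu>,\<mu>)\<close> for probability measures, with equality only if \<open>\<nu> = \<mu>\<close>.  For
    \<open>\<beta> < 2\<close> the function \<open>k 1 - k r\<close> is a mixture of \<open>exp (- t r\<^sup>2) - exp (- t)\<close> over \<open>t > 0\<close> with a
    positive weight, and every Gaussian kernel is a convolution square.

  \<^item> The potential of the candidate (\<open>minimizer_potential\<close>): the asserted minimizer \<open>\<mu>\<close> centred at
    \<open>b\<close> satisfies \<open>\<integral>k (|x - y|) d\<mu>(y) = C + |x - b|\<^sup>2 / 2\<close> for \<open>x\<close> in its closed ball, and \<open>\<le>\<close> holds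
    for all other \<open>x\<close>.

  Together they give
  \<open>2 E(\<nu>) = v - J(\<nu>,\<nu>) \<ge> v + J(\<mu>,\<mu>) - 2 J(\<nu>,\<mu>) \<ge> J(\<mu>,\<mu>) - 2 C = 2 E(\<mu>)\<close>,
  and equality in the first inequality forces \<open>\<nu> = \<mu>\<close>; this is \<open>energy_lower_bound\<close>.  The number
  \<open>J(\<mu>,\<mu>) - 2 C\<close> is the second moment of \<open>\<mu>\<close> divided by \<open>2\<close>, minus \<open>C\<close>.

  The potential is computed without special functions beyond \<open>\<Gamma>\<close>.  After scaling, it is the integral
  of \<open>|x - y|\<^sup>\<beta> (1 - |y|\<^sup>2)\<^sup>g\<close> over the unit ball in dimension \<open>d\<close>, with \<open>g = (2 - \<beta> - d) / 2\<close>.  This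
  choice of \<open>g\<close> makes the inversion \<open>z \<mapsto> c z / |z|\<^sup>2\<close> centred at \<open>x\<close>, with \<open>c = |x|\<^sup>2 - 1\<close> the power of
  the point \<open>x\<close> with respect to the unit sphere, turn the integrand into a multiple of
  \<open>|x - y| powr (- d - 2) * \<bar>|y|\<^sup>2 - 1\<bar> powr g\<close>.

  \<^item> For \<open>|x| < 1\<close> the inversion exchanges the inside and the outside of the sphere.  Spherical means of
    \<open>|x - y| powr (- d - 2)\<close> over spheres of radius larger than \<open>|x|\<close> are rational functions of the
    radius, so that only Beta integrals remain (\<open>nn_integral_inside_profile\<close>).

  \<^item> For \<open>|x| > 1\<close> the inversion maps the ball to itself.  Applied to the radial derivative of the
    potential, and followed by an inversion in the sphere of radius \<open>|x|\<close> about the origin, it expresses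
    this derivative as an explicit one-dimensional integral.  For \<open>d \<ge> 2\<close> its integrand is dominated
    pointwise by one whose integral is the derivative of the quadratic function
    (\<open>outside_kernel_bound\<close>).  For \<open>d = 1\<close> the pointwise bound fails, and the concavity or
    monotonicity of \<open>r powr (\<beta> - 1)\<close>, available since \<open>\<beta> < 2\<close>, takes its place.

  The case \<open>\<beta> = 0\<close> on the closed ball is the derivative of the power case at \<open>\<beta> = 0\<close>, which is where
  the digamma function enters.
\<close>

section \<open>Arithmetic of extended nonnegative reals\<close>

lemma ennreal_2_cancel: "2 * a = 2 * b \<Longrightarrow> a = (b :: ennreal)"
  by (subst (asm) ennreal_mult_cancel_left) auto

lemma ennreal_mult_eqI: "a \<ge> 0 \<Longrightarrow> b \<ge> 0 \<Longrightarrow> a * b = c \<Longrightarrow> ennreal a * ennreal b = ennreal c"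
  by (simp add: ennreal_mult[symmetric])

lemma ennreal_mult_add_mult:
  "a \<ge> 0 \<Longrightarrow> b \<ge> 0 \<Longrightarrow> c \<ge> 0 \<Longrightarrow> d \<ge> 0 \<Longrightarrow>
    ennreal a * ennreal b + ennreal c * ennreal d = ennreal (a * b + c * d)"
  by (simp add: ennreal_mult)

lemma ennreal_mult3_eqI:
  "a \<ge> 0 \<Longrightarrow> b \<ge> 0 \<Longrightarrow> c \<ge> 0 \<Longrightarrow> a * (b * c) = e \<Longrightarrow> ennreal a * (ennreal b * ennreal c) = ennreal e"
  by (simp add: ennreal_mult[symmetric])

lemma ennreal_mult4:
  "a \<ge> 0 \<Longrightarrow> b \<ge> 0 \<Longrightarrow> c \<ge> 0 \<Longrightarrow> d \<ge> 0 \<Longrightarrow>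
    ennreal a * (ennreal b * (ennreal c * ennreal d)) = ennreal (a * (b * (c * d)))"
  by (simp add: ennreal_mult)

lemma ennreal_add_mult:
  "a \<ge> 0 \<Longrightarrow> b \<ge> 0 \<Longrightarrow> c \<ge> 0 \<Longrightarrow> ennreal (a + c * b) = ennreal a + ennreal c * ennreal b"
  by (simp add: ennreal_mult)

section \<open>Changes of variables\<close>

lemma nn_integral_cong_nonzero:
  fixes f g :: "'a::euclidean_space \<Rightarrow> ennreal"
  assumes "\<And>x. x \<noteq> 0 \<Longrightarrow> f x = g x"
  shows "(\<integral>\<^sup>+x. f x \<partial>lborel) = (\<integral>\<^sup>+x. g x \<partial>lborel)"
  by (rule nn_integral_cong_AE, rule AE_mp[OF AE_lborel_singleton[of 0]], rule AE_I2) (use assms in blast)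

text \<open>
  For a nonnegative integrand, the change of variables for absolute integrals is an equivalence of
  integrability with a given value.  Hence if one of the two integrals is finite, so is the other one
  and they agree; otherwise both are infinite.
\<close>

lemma nn_integral_change_of_variables_real:
  fixes g g' h :: "real \<Rightarrow> real"
  assumes S: "S \<in> sets borel" and gS: "g ` S \<in> sets borel" and inj: "inj_on g S"
    and der: "\<And>x. x \<in> S \<Longrightarrow> (g has_field_derivative g' x) (at x)"
    and [measurable]: "g \<in> borel_measurable borel" "g' \<in> borel_measurable borel" "h \<in> borel_measurable borel"
    and nonneg: "\<And>x. h x \<ge> 0"
  shows "(\<integral>\<^sup>+x\<in>g ` S. ennreal (h x) \<partial>lborel) = (\<integral>\<^sup>+x\<in>S. ennreal (\<bar>g' x\<bar> * h (g x)) \<partial>lborel)"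
    (is "?L = ?R")
proof -
  note S[measurable] gS[measurable]
  have iff: "(h has_integral b) (g ` S) \<longleftrightarrow> ((\<lambda>x. \<bar>g' x\<bar> * h (g x)) has_integral b) S" for b
  proof -
    have "(\<lambda>x. \<bar>g' x\<bar> * h (g x)) absolutely_integrable_on S \<and> integral S (\<lambda>x. \<bar>g' x\<bar> * h (g x)) = b
        \<longleftrightarrow> h absolutely_integrable_on (g ` S) \<and> integral (g ` S) h = b"
      using S by (intro has_absolute_integral_change_of_variables_1' inj)
        (auto intro: der DERIV_subset)
    then show ?thesis
      by (subst (asm) (1 2) absolutely_integrable_on_iff_nonneg)
        (auto simp: nonneg has_integral_iff)
  qed
  \<comment> \<open>From a finite Lebesgue integral over a set to a gauge integral over it.\<close>
  have restrict: "(f has_integral r) A"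
    if "(\<integral>\<^sup>+x\<in>A. ennreal (f x) \<partial>lborel) = ennreal r" "r \<ge> 0" "A \<in> sets borel"
       "f \<in> borel_measurable borel" "\<And>x. f x \<ge> 0"
    for f :: "real \<Rightarrow> real" and r A
  proof -
    note that(3,4)[measurable]
    have "((\<lambda>x. f x * indicator A x) has_integral r) UNIV"
    proof (rule nn_integral_has_integral)
      have "(\<integral>\<^sup>+x. ennreal (f x * indicator A x) \<partial>lborel) = (\<integral>\<^sup>+x\<in>A. ennreal (f x) \<partial>lborel)"
        by (intro nn_integral_cong) (auto simp: indicator_def)
      then show "(\<integral>\<^sup>+x. ennreal (f x * indicator A x) \<partial>lborel) = ennreal r"
        using that by simp
    qed (use that in auto)
    then have "((\<lambda>x. if x \<in> A then f x else 0) has_integral r) UNIV"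
      by (rule has_integral_eq[rotated]) (auto simp: indicator_def)
    then show ?thesis
      by (simp add: has_integral_restrict_UNIV)
  qed
  show ?thesis
  proof (cases "?L = \<infinity> \<and> ?R = \<infinity>")
    case False
    then consider "?L \<noteq> \<infinity>" | "?R \<noteq> \<infinity>" by auto
    then show ?thesis
    proof cases
      case 1
      then obtain r where r: "?L = ennreal r" "r \<ge> 0" by (cases ?L) auto
      have "(h has_integral r) (g ` S)"
        using r by (intro restrict) (auto simp: nonneg)
      then have "((\<lambda>x. \<bar>g' x\<bar> * h (g x)) has_integral r) S" by (simp add: iff)
      then show ?thesis
        using nn_integral_has_integral_lebesgue'[of S "\<lambda>x. \<bar>g' x\<bar> * h (g x)" r] r nonneg by simp
    next
      case 2
      then obtain r where r: "?R = ennreal r" "r \<ge> 0" by (cases ?R) auto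
      have "((\<lambda>x. \<bar>g' x\<bar> * h (g x)) has_integral r) S"
        using r by (intro restrict) (auto simp: nonneg)
      then have "(h has_integral r) (g ` S)" by (simp add: iff)
      then show ?thesis
        using nn_integral_has_integral_lebesgue'[of "g ` S" h r] r nonneg by simp
    qed
  qed auto
qed

text \<open>
  Values \<open>\<infinity>\<close> of the integrand are reached by truncating it at \<open>n\<close> and letting \<open>n\<close> grow.
\<close>

lemma nn_integral_change_of_variables:
  fixes g g' :: "real \<Rightarrow> real" and f :: "real \<Rightarrow> ennreal"
  assumes S: "S \<in> sets borel" and gS: "g ` S \<in> sets borel" and inj: "inj_on g S"
    and der: "\<And>x. x \<in> S \<Longrightarrow> (g has_field_derivative g' x) (at x)"
    and [measurable]: "g \<in> borel_measurable borel" "g' \<in> borel_measurable borel" "f \<in> borel_measurable borel"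
  shows "(\<integral>\<^sup>+x\<in>g ` S. f x \<partial>lborel) = (\<integral>\<^sup>+x\<in>S. ennreal \<bar>g' x\<bar> * f (g x) \<partial>lborel)"
proof -
  note S[measurable] gS[measurable]
  define F where "F n x = min (f x) (of_nat n)" for n x
  have [measurable]: "F n \<in> borel_measurable borel" for n unfolding F_def by measurable
  have inc: "incseq F" by (auto simp: incseq_def F_def le_fun_def min_def intro: order_trans)
  have sup: "(SUP n. F n x) = f x" for x
  proof -
    have "(SUP n. F n x) = inf (f x) (SUP n. of_nat n)"
      unfolding F_def inf_min[symmetric] by (subst inf_SUP) (rule refl)
    also have "(SUP n. of_nat n :: ennreal) = top" by (rule ennreal_SUP_of_nat_eq_top)
    finally show ?thesis by simp
  qed
  have fin: "F n x \<noteq> top" for n x by (auto simp: F_def min_def top_unique)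
  have eq: "(\<integral>\<^sup>+x\<in>g ` S. F n x \<partial>lborel) = (\<integral>\<^sup>+x\<in>S. ennreal \<bar>g' x\<bar> * F n (g x) \<partial>lborel)" for n
  proof -
    have "F n x = ennreal (enn2real (F n x))" for x
      using fin[of n x] by (simp add: less_top)
    then show ?thesis
      using nn_integral_change_of_variables_real[OF S gS inj der, of "\<lambda>x. enn2real (F n x)"]
      by (simp add: ennreal_mult')
  qed
  have "(\<integral>\<^sup>+x\<in>g ` S. f x \<partial>lborel) = (\<integral>\<^sup>+x. (SUP n. F n x * indicator (g ` S) x) \<partial>lborel)"
    by (intro nn_integral_cong) (simp add: sup[symmetric] SUP_mult_right_ennreal)
  also have "\<dots> = (SUP n. \<integral>\<^sup>+x\<in>g ` S. F n x \<partial>lborel)"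
    by (intro nn_integral_monotone_convergence_SUP)
      (use inc in \<open>auto simp: incseq_def le_fun_def intro!: mult_right_mono\<close>)
  also have "\<dots> = (SUP n. \<integral>\<^sup>+x\<in>S. ennreal \<bar>g' x\<bar> * F n (g x) \<partial>lborel)"
    by (simp add: eq)
  also have "\<dots> = (\<integral>\<^sup>+x. (SUP n. ennreal \<bar>g' x\<bar> * F n (g x) * indicator S x) \<partial>lborel)"
    by (intro nn_integral_monotone_convergence_SUP[symmetric])
      (use inc in \<open>auto simp: incseq_def le_fun_def intro!: mult_right_mono mult_left_mono\<close>)
  also have "\<dots> = (\<integral>\<^sup>+x\<in>S. ennreal \<bar>g' x\<bar> * f (g x) \<partial>lborel)"
    by (intro nn_integral_cong)
      (simp add: sup[symmetric] SUP_mult_right_ennreal SUP_mult_left_ennreal)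
  finally show ?thesis .
qed

lemma nn_integral_real_even:
  fixes f :: "real \<Rightarrow> ennreal"
  assumes [measurable]: "f \<in> borel_measurable borel"
  shows "(\<integral>\<^sup>+x. f x \<partial>lborel) = (\<integral>\<^sup>+x\<in>{0<..}. (f x + f (- x)) \<partial>lborel)"
proof -
  have "(\<integral>\<^sup>+x. f x \<partial>lborel) = (\<integral>\<^sup>+x. f x * indicator {0<..} x + f x * indicator {..<0} x \<partial>lborel)"
    by (rule nn_integral_cong_nonzero)
      (auto simp: indicator_def)
  also have "\<dots> = (\<integral>\<^sup>+x\<in>{0<..}. f x \<partial>lborel) + (\<integral>\<^sup>+x\<in>{..<0}. f x \<partial>lborel)"
    by (rule nn_integral_add) auto
  also have "(\<integral>\<^sup>+x\<in>{..<0}. f x \<partial>lborel) = (\<integral>\<^sup>+x. f (-x) * indicator {..<0} (- x) \<partial>lborel)"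
    by (subst nn_integral_real_affine[where c="-1" and t=0]) auto
  also have "\<dots> = (\<integral>\<^sup>+x\<in>{0<..}. f (- x) \<partial>lborel)"
    by (intro nn_integral_cong) (auto simp: indicator_def)
  finally show ?thesis
    by (simp add: nn_integral_add[symmetric] distrib_right)
qed

lemma nn_integral_inversion_real:
  fixes f :: "real \<Rightarrow> ennreal" and c :: real
  assumes [measurable]: "f \<in> borel_measurable borel" and c: "c \<noteq> 0"
  shows "(\<integral>\<^sup>+t. f t \<partial>lborel) = (\<integral>\<^sup>+t. ennreal (\<bar>c\<bar> / t\<^sup>2) * f (c / t) \<partial>lborel)"
proof -
  have im: "(\<lambda>t. c / t) ` (- {0}) = - {0}"
  proof (intro equalityI subsetI)
    fix x assume "x \<in> - {0 :: real}"
    then show "x \<in> (\<lambda>t. c / t) ` (- {0})"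
      using c by (intro image_eqI[of _ _ "c / x"]) auto
  qed (use c in auto)
  have "(\<integral>\<^sup>+t. f t \<partial>lborel) = (\<integral>\<^sup>+t\<in>- {0}. f t \<partial>lborel)"
    by (rule nn_integral_cong_nonzero) auto
  also have "\<dots> = (\<integral>\<^sup>+t\<in>- {0}. ennreal \<bar>- c / t\<^sup>2\<bar> * f (c / t) \<partial>lborel)"
    using c by (subst im[symmetric], intro nn_integral_change_of_variables)
      (auto simp: im inj_on_def power2_eq_square intro!: derivative_eq_intros)
  also have "\<dots> = (\<integral>\<^sup>+t. ennreal (\<bar>c\<bar> / t\<^sup>2) * f (c / t) \<partial>lborel)"
    by (rule nn_integral_cong_nonzero) (auto simp: abs_divide)
  finally show ?thesis .
qed

lemma nn_integral_lborel_affine: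
  fixes f :: "'a::euclidean_space \<Rightarrow> ennreal" and c :: real
  assumes [measurable]: "f \<in> borel_measurable borel" and c: "c \<noteq> 0"
  shows "(\<integral>\<^sup>+x. f x \<partial>lborel) = ennreal (\<bar>c\<bar> ^ DIM('a)) * (\<integral>\<^sup>+x. f (t + c *\<^sub>R x) \<partial>lborel)"
  by (subst lborel_affine[OF c, of t])
     (simp add: nn_integral_density nn_integral_distr nn_integral_cmult)

section \<open>Gamma and Beta integrals\<close>

lemma nn_integral_Gamma:
  fixes s l :: real
  assumes "s > 0" "l > 0"
  shows "(\<integral>\<^sup>+t\<in>{0<..}. ennreal (t powr (s - 1) * exp (- (t * l))) \<partial>lborel) = ennreal (Gamma s * l powr (- s))"
proof -
  have "ennreal (Gamma s) = (\<integral>\<^sup>+t. ennreal (indicator {0..} t * t powr (s - 1) / exp t) \<partial>lborel)"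
    by (rule Gamma_conv_nn_integral_real) fact
  also have "\<dots> = ennreal l * (\<integral>\<^sup>+t. ennreal (indicator {0..} (l * t) * (l * t) powr (s - 1) / exp (l * t)) \<partial>lborel)"
    using \<open>l > 0\<close> by (subst nn_integral_real_affine[where c=l and t=0]) auto
  also have "\<dots> = (\<integral>\<^sup>+t. ennreal l * ennreal (indicator {0..} (l * t) * (l * t) powr (s - 1) / exp (l * t)) \<partial>lborel)"
    by (intro nn_integral_cmult[symmetric]) auto
  also have "\<dots> = (\<integral>\<^sup>+t. ennreal (l powr s) * (ennreal (t powr (s - 1) * exp (- (t * l))) * indicator {0<..} t) \<partial>lborel)"
    (is "integral\<^sup>N _ ?F = integral\<^sup>N _ ?G")
  proof (rule nn_integral_cong_nonzero)
    fix t :: real assume "t \<noteq> 0"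
    show "?F t = ?G t"
    proof (cases "t > 0")
      case True
      have "l * ((l * t) powr (s - 1) / exp (l * t)) = l powr s * (t powr (s - 1) * exp (- (t * l)))"
        using assms True by (simp add: powr_mult powr_diff exp_minus field_simps)
      then show ?thesis
        using assms True by (simp add: ennreal_mult'[symmetric] ennreal_mult[symmetric])
    next
      case False
      then have "l * t < 0" using assms \<open>t \<noteq> 0\<close> by (simp add: mult_less_0_iff)
      then show ?thesis using False by auto
    qed
  qed
  also have "\<dots> = ennreal (l powr s) * (\<integral>\<^sup>+t\<in>{0<..}. ennreal (t powr (s - 1) * exp (- (t * l))) \<partial>lborel)"
    by (intro nn_integral_cmult) auto
  finally have "ennreal (Gamma s) = ennreal (l powr s) * (\<integral>\<^sup>+t\<in>{0<..}. ennreal (t powr (s - 1) * exp (- (t * l))) \<partial>lborel)" .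
  then have "ennreal (l powr (- s)) * ennreal (Gamma s) = ennreal (l powr (- s)) * ennreal (l powr s) * (\<integral>\<^sup>+t\<in>{0<..}. ennreal (t powr (s - 1) * exp (- (t * l))) \<partial>lborel)"
    by (simp add: mult.assoc)
  also have "ennreal (l powr (- s)) * ennreal (l powr s) = 1"
    using assms by (simp add: ennreal_mult[symmetric] powr_minus)
  finally show ?thesis
    using assms by (simp add: ennreal_mult'[symmetric] mult.commute)
qed

text \<open>
  Writing \<open>(s + p) powr (- q)\<close> as a Gamma integral in a second variable \<open>t\<close> and integrating first over
  \<open>s\<close> leaves another Gamma integral.
\<close>

lemma nn_integral_Beta_prime:
  fixes g q p :: real
  assumes g: "g > -1" and q: "q > g + 1" and p: "p > 0"
  shows "(\<integral>\<^sup>+s\<in>{0<..}. ennreal (s powr g * (s + p) powr (- q)) \<partial>lborel) =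
    ennreal (Beta (g + 1) (q - g - 1) * p powr (g + 1 - q))"
proof -
  have q0: "q > 0" using g q by simp
  have "ennreal (Gamma q) * (\<integral>\<^sup>+s\<in>{0<..}. ennreal (s powr g * (s + p) powr (- q)) \<partial>lborel)
     = (\<integral>\<^sup>+s\<in>{0<..}. (\<integral>\<^sup>+t\<in>{0<..}. ennreal (s powr g * t powr (q - 1) * exp (- (t * (s + p)))) \<partial>lborel) \<partial>lborel)"
    (is "_ * ?I = ?J")
  proof (subst nn_integral_cmult[symmetric], simp, intro nn_integral_cong)
    fix s :: real
    show "ennreal (Gamma q) * (ennreal (s powr g * (s + p) powr (- q)) * indicator {0<..} s) =
       (\<integral>\<^sup>+t\<in>{0<..}. ennreal (s powr g * t powr (q - 1) * exp (- (t * (s + p)))) \<partial>lborel) * indicator {0<..} s"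
    proof (cases "s > 0")
      case True
      have "(\<integral>\<^sup>+t\<in>{0<..}. ennreal (s powr g * t powr (q - 1) * exp (- (t * (s + p)))) \<partial>lborel)
         = ennreal (s powr g) * (\<integral>\<^sup>+t\<in>{0<..}. ennreal (t powr (q - 1) * exp (- (t * (s + p)))) \<partial>lborel)"
        by (subst nn_integral_cmult[symmetric]) (auto simp: ennreal_mult' mult_ac intro!: nn_integral_cong)
      also have "\<dots> = ennreal (s powr g) * ennreal (Gamma q * (s + p) powr (- q))"
        using True p q0 by (subst nn_integral_Gamma) auto
      finally show ?thesis using True q0
        by (simp add: ennreal_mult'[symmetric] mult_ac)
    qed auto
  qed
  also have "?J = (\<integral>\<^sup>+s. \<integral>\<^sup>+t. ennreal (s powr g * t powr (q - 1) * exp (- (t * (s + p)))) * indicator {0<..} t * indicator {0<..} s \<partial>lborel \<partial>lborel)"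
    by (subst nn_integral_multc) auto
  also have "\<dots> = (\<integral>\<^sup>+t. \<integral>\<^sup>+s. ennreal (s powr g * t powr (q - 1) * exp (- (t * (s + p)))) * indicator {0<..} t * indicator {0<..} s \<partial>lborel \<partial>lborel)"
    by (rule lborel_pair.Fubini') measurable
  also have "\<dots> = (\<integral>\<^sup>+t. ennreal (Gamma (g + 1)) * (ennreal (t powr ((q - g - 1) - 1) * exp (- (t * p))) * indicator {0<..} t) \<partial>lborel)"
    (is "integral\<^sup>N _ ?F = integral\<^sup>N _ ?G")
  proof (intro nn_integral_cong)
    fix t :: real
    show "?F t = ?G t"
    proof (cases "t > 0")
      case True
      have "(\<integral>\<^sup>+s. ennreal (s powr g * t powr (q - 1) * exp (- (t * (s + p)))) * indicator {0<..} t * indicator {0<..} s \<partial>lborel)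
        = (\<integral>\<^sup>+s. ennreal (t powr (q - 1) * exp (- (t * p))) * (ennreal (s powr ((g + 1) - 1) * exp (- (s * t))) * indicator {0<..} s) \<partial>lborel)"
        using True by (intro nn_integral_cong)
          (auto simp: ennreal_mult[symmetric] indicator_def exp_add[symmetric] algebra_simps exp_minus exp_diff divide_simps)
      also have "\<dots> = ennreal (t powr (q - 1) * exp (- (t * p))) * ennreal (Gamma (g + 1) * t powr (- (g + 1)))"
        using True g by (subst nn_integral_cmult, simp, subst nn_integral_Gamma) auto
      also have "\<dots> = ennreal (Gamma (g + 1) * (t powr ((q - g - 1) - 1) * exp (- (t * p))))"
      proof -
        have "t powr (q - 1) * t powr (- (g + 1)) = t powr ((q - g - 1) - 1)"
          by (simp add: powr_add[symmetric])
        then show ?thesis using g by (simp add: ennreal_mult[symmetric] mult_ac)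
      qed
      finally show ?thesis using True g by (simp add: ennreal_mult)
    qed auto
  qed
  also have "\<dots> = ennreal (Gamma (g + 1)) * ennreal (Gamma (q - g - 1) * p powr (- (q - g - 1)))"
    using q p by (subst nn_integral_cmult, simp, subst nn_integral_Gamma) auto
  finally have "ennreal (Gamma q) * ?I = ennreal (Gamma (g + 1) * (Gamma (q - g - 1) * p powr (g + 1 - q)))"
    using g q by (simp add: ennreal_mult[symmetric] minus_diff_eq[of "q - g" 1] algebra_simps)
  then have "ennreal (1 / Gamma q) * (ennreal (Gamma q) * ?I) = ennreal (1 / Gamma q) * ennreal (Gamma (g + 1) * (Gamma (q - g - 1) * p powr (g + 1 - q)))"
    by simp
  also have "ennreal (1 / Gamma q) * (ennreal (Gamma q) * ?I) = ?I"
    using Gamma_real_pos[OF q0] by (subst mult.assoc[symmetric], subst ennreal_mult[symmetric]) auto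
  also have "ennreal (1 / Gamma q) * ennreal (Gamma (g + 1) * (Gamma (q - g - 1) * p powr (g + 1 - q)))
     = ennreal (Beta (g + 1) (q - g - 1) * p powr (g + 1 - q))"
    using g q q0 by (subst ennreal_mult[symmetric]) (auto simp: Beta_def)
  finally show ?thesis .
qed

lemma nn_integral_Beta:
  fixes a b :: real
  assumes "a > 0" "b > 0"
  shows "(\<integral>\<^sup>+t\<in>{0<..<1}. ennreal (t powr (a - 1) * (1 - t) powr (b - 1)) \<partial>lborel) = ennreal (Beta a b)"
proof -
  have "((\<lambda>t. t powr (a - 1) * (1 - t) powr (b - 1)) has_integral Beta a b) {0<..<1}"
    using has_integral_Beta_real[OF assms] by (simp add: has_integral_Icc_iff_Ioo)
  then show ?thesis
    by (intro nn_integral_has_integral_lebesgue') auto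
qed

lemma nn_integral_powr_gaussian:
  fixes k :: real
  assumes k: "k > -1"
  shows "(\<integral>\<^sup>+v. ennreal (\<bar>v\<bar> powr k * exp (- v\<^sup>2)) \<partial>lborel) = ennreal (Gamma ((k + 1) / 2))"
proof -
  have im: "(\<lambda>v::real. v\<^sup>2) ` {0<..} = {0<..}"
  proof (intro equalityI subsetI)
    fix x :: real assume "x \<in> {0<..}"
    then show "x \<in> (\<lambda>v. v\<^sup>2) ` {0<..}" by (intro image_eqI[of _ _ "sqrt x"]) auto
  qed auto
  have "ennreal (Gamma ((k + 1) / 2)) = (\<integral>\<^sup>+t\<in>{0<..}. ennreal (t powr ((k + 1) / 2 - 1) * exp (- (t * 1))) \<partial>lborel)"
    using k by (subst nn_integral_Gamma) auto
  also have "\<dots> = (\<integral>\<^sup>+v\<in>{0<..}. ennreal \<bar>2 * v\<bar> * ennreal ((v\<^sup>2) powr ((k + 1) / 2 - 1) * exp (- (v\<^sup>2 * 1))) \<partial>lborel)"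
    by (subst im[symmetric], rule nn_integral_change_of_variables)
      (auto simp: im inj_on_def intro!: derivative_eq_intros)
  also have "\<dots> = (\<integral>\<^sup>+v\<in>{0<..}. (ennreal (\<bar>v\<bar> powr k * exp (- v\<^sup>2)) + ennreal (\<bar>-v\<bar> powr k * exp (- (-v)\<^sup>2))) \<partial>lborel)"
    (is "integral\<^sup>N _ ?F = integral\<^sup>N _ ?G")
  proof (intro nn_integral_cong)
    fix v :: real
    show "?F v = ?G v"
    proof (cases "v > 0")
      case True
      have "(v\<^sup>2) powr ((k + 1) / 2 - 1) = v powr (k - 1)"
      proof -
        have "(v\<^sup>2) powr ((k + 1) / 2 - 1) = v powr (2 * ((k + 1) / 2 - 1))"
          using True by (simp add: powr_powr powr_numeral[symmetric] del: powr_numeral)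
        also have "2 * ((k + 1) / 2 - 1) = k - 1" by simp
        finally show ?thesis .
      qed
      then have "2 * v * ((v\<^sup>2) powr ((k + 1) / 2 - 1) * exp (- v\<^sup>2)) = v powr k * exp (- v\<^sup>2) + v powr k * exp (- v\<^sup>2)"
        using True by (simp add: powr_diff)
      then show ?thesis using True
        by (simp add: ennreal_mult[symmetric] ennreal_plus[symmetric] del: ennreal_plus)
    qed auto
  qed
  also have "\<dots> = (\<integral>\<^sup>+v. ennreal (\<bar>v\<bar> powr k * exp (- v\<^sup>2)) \<partial>lborel)"
    by (rule nn_integral_real_even[symmetric]) measurable
  finally show ?thesis ..
qed

section \<open>Integration along lines through a point\<close>

text \<open>
  A substitute for the surface measure of the unit sphere.  A weight \<open>\<phi>\<close> on directions serves as one if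
  \<open>\<integral> \<phi> (y / t) / \<bar>t\<bar> dt\<close> has the same value for every \<open>y \<noteq> 0\<close>; the prefactor makes this value \<open>2\<close>, one
  for each of the two half-lines of a line.  The power \<open>DIM('a) + 2\<close> is chosen because the kernels
  below contribute a division by \<open>norm z ^ DIM('a)\<close> or \<open>norm z ^ (DIM('a) + 2)\<close>, and what remains is
  a Gaussian with a polynomial factor.
\<close>

definition polar_weight :: "'a::euclidean_space \<Rightarrow> real" where
  "polar_weight z = 2 / Gamma (real DIM('a) / 2 + 1) * norm z ^ (DIM('a) + 2) * exp (- (norm z)\<^sup>2)"

text \<open>
  The full area of the unit sphere in dimension \<open>d\<close> is \<open>2 pi powr (d / 2) / Gamma (d / 2)\<close>.  Half of it
  is the constant that appears when the square of the radius is the variable of integration.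
\<close>

definition half_sphere_area :: "nat \<Rightarrow> real" where
  "half_sphere_area d = pi powr (real d / 2) / Gamma (real d / 2)"

lemma polar_weight_nonneg [simp]: "polar_weight z \<ge> 0"
  by (simp add: polar_weight_def)

lemma polar_weight_measurable [measurable]: "polar_weight \<in> borel_measurable borel"
  unfolding polar_weight_def by measurable

lemma polar_weight_normalized:
  fixes y :: "'a::euclidean_space"
  assumes "y \<noteq> 0"
  shows "(\<integral>\<^sup>+t. ennreal (polar_weight ((1 / t) *\<^sub>R y) / \<bar>t\<bar>) \<partial>lborel) = 2"
proof -
  define r where "r = norm y"
  have r: "r > 0" using assms by (simp add: r_def)
  define c where "c = 2 / Gamma (real DIM('a) / 2 + 1)"
  have c: "c > 0" by (simp add: c_def add_pos_pos)
  have "(\<integral>\<^sup>+t. ennreal (polar_weight ((1 / t) *\<^sub>R y) / \<bar>t\<bar>) \<partial>lborel)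
      = (\<integral>\<^sup>+t. ennreal (\<bar>r\<bar> / t\<^sup>2) * ennreal (polar_weight ((1 / (r / t)) *\<^sub>R y) / \<bar>r / t\<bar>) \<partial>lborel)"
    using r by (intro nn_integral_inversion_real) auto
  also have "\<dots> = (\<integral>\<^sup>+t. ennreal c * ennreal (\<bar>t\<bar> powr (real DIM('a) + 1) * exp (- t\<^sup>2)) \<partial>lborel)"
    (is "integral\<^sup>N _ ?F = integral\<^sup>N _ ?G")
  proof (rule nn_integral_cong_nonzero)
    fix t :: real assume t: "t \<noteq> 0"
    have "polar_weight ((1 / (r / t)) *\<^sub>R y) = c * \<bar>t\<bar> ^ (DIM('a) + 2) * exp (- t\<^sup>2)"
      using r unfolding polar_weight_def c_def by (simp add: r_def[symmetric] field_simps)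
    then have "\<bar>r\<bar> / t\<^sup>2 * (polar_weight ((1 / (r / t)) *\<^sub>R y) / \<bar>r / t\<bar>) =
       r / t\<^sup>2 * (c * \<bar>t\<bar> ^ (DIM('a) + 2) * exp (- t\<^sup>2)) * \<bar>t\<bar> / r"
      using r by (simp add: abs_divide)
    also have "\<dots> = c * (\<bar>t\<bar> ^ (DIM('a) + 1) * exp (- t\<^sup>2))"
      using r t by (simp add: field_simps power2_eq_square)
    also have "\<bar>t\<bar> ^ (DIM('a) + 1) = \<bar>t\<bar> powr (real DIM('a) + 1)"
      using t powr_realpow[of "\<bar>t\<bar>" "DIM('a) + 1"] by (simp add: add.commute)
    finally show "?F t = ?G t"
      using c by (simp add: ennreal_mult[symmetric])
  qed
  also have "\<dots> = ennreal c * ennreal (Gamma ((real DIM('a) + 1 + 1) / 2))"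
    by (subst nn_integral_cmult) (auto simp: nn_integral_powr_gaussian)
  also have "\<dots> = ennreal (c * Gamma (real DIM('a) / 2 + 1))"
    using c by (subst ennreal_mult[symmetric]) (auto simp: add_divide_distrib add.commute)
  also have "c * Gamma (real DIM('a) / 2 + 1) = 2"
  proof -
    have "Gamma (real DIM('a) / 2 + 1) > 0" by (intro Gamma_real_pos) (simp add: add_nonneg_pos)
    moreover have "2 / G * G = 2" if "G > 0" for G :: real using that by simp
    ultimately show ?thesis unfolding c_def by blast
  qed
  finally show ?thesis by simp
qed

text \<open>
  Polar coordinates.  By Tonelli and the substitution \<open>y = t *\<^sub>R z\<close> for fixed \<open>t\<close>, the right-hand side
  is the integral of \<open>h y\<close> times the integral computed in \<open>polar_weight_normalized\<close>.  The factor \<open>2\<close>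
  is there because \<open>t\<close> runs through the whole line.
\<close>

lemma nn_integral_along_lines:
  fixes h :: "'a::euclidean_space \<Rightarrow> ennreal"
  assumes [measurable]: "h \<in> borel_measurable borel"
  shows "2 * (\<integral>\<^sup>+y. h y \<partial>lborel) =
    (\<integral>\<^sup>+z. ennreal (polar_weight z) * (\<integral>\<^sup>+t. ennreal (\<bar>t\<bar> ^ (DIM('a) - 1)) * h (t *\<^sub>R z) \<partial>lborel) \<partial>lborel)"
proof -
  have "(\<integral>\<^sup>+z. ennreal (polar_weight z) * (\<integral>\<^sup>+t. ennreal (\<bar>t\<bar> ^ (DIM('a) - 1)) * h (t *\<^sub>R z) \<partial>lborel) \<partial>lborel)
     = (\<integral>\<^sup>+z. \<integral>\<^sup>+t. ennreal (polar_weight z) * (ennreal (\<bar>t\<bar> ^ (DIM('a) - 1)) * h (t *\<^sub>R z)) \<partial>lborel \<partial>lborel)"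
    by (subst nn_integral_cmult) auto
  also have "\<dots> = (\<integral>\<^sup>+t. \<integral>\<^sup>+z. ennreal (polar_weight z) * (ennreal (\<bar>t\<bar> ^ (DIM('a) - 1)) * h (t *\<^sub>R z)) \<partial>lborel \<partial>lborel)"
    by (rule lborel_pair.Fubini') measurable
  also have "\<dots> = (\<integral>\<^sup>+t. \<integral>\<^sup>+y. h y * ennreal (polar_weight ((1 / t) *\<^sub>R y) / \<bar>t\<bar>) \<partial>lborel \<partial>lborel)"
  proof (rule nn_integral_cong_nonzero)
    fix t :: real assume t: "t \<noteq> 0"
    have "(\<integral>\<^sup>+z. ennreal (polar_weight z) * (ennreal (\<bar>t\<bar> ^ (DIM('a) - 1)) * h (t *\<^sub>R z)) \<partial>lborel)
      = ennreal (\<bar>1 / t\<bar> ^ DIM('a)) * (\<integral>\<^sup>+y. ennreal (polar_weight (0 + (1 / t) *\<^sub>R y)) * (ennreal (\<bar>t\<bar> ^ (DIM('a) - 1)) * h (t *\<^sub>R (0 + (1 / t) *\<^sub>R y))) \<partial>lborel)"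
      using t by (intro nn_integral_lborel_affine) auto
    also have "\<dots> = (\<integral>\<^sup>+y. ennreal (\<bar>1 / t\<bar> ^ DIM('a)) * (ennreal (polar_weight (0 + (1 / t) *\<^sub>R y)) * (ennreal (\<bar>t\<bar> ^ (DIM('a) - 1)) * h (t *\<^sub>R (0 + (1 / t) *\<^sub>R y)))) \<partial>lborel)"
      by (rule nn_integral_cmult[symmetric]) auto
    also have "\<dots> = (\<integral>\<^sup>+y. h y * ennreal (polar_weight ((1 / t) *\<^sub>R y) / \<bar>t\<bar>) \<partial>lborel)"
      (is "integral\<^sup>N _ ?f = integral\<^sup>N _ ?g")
    proof (intro nn_integral_cong)
      fix y :: 'a
      have "\<bar>1 / t\<bar> ^ DIM('a) * \<bar>t\<bar> ^ (DIM('a) - 1) = 1 / \<bar>t\<bar>"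
        using t by (cases "DIM('a)") (auto simp: field_simps power_abs abs_mult abs_divide)
      then have "\<bar>1 / t\<bar> ^ DIM('a) * (polar_weight ((1 / t) *\<^sub>R y) * \<bar>t\<bar> ^ (DIM('a) - 1)) = polar_weight ((1 / t) *\<^sub>R y) / \<bar>t\<bar>"
        by (metis mult.left_commute mult.right_neutral times_divide_eq_right)
      then have "ennreal (\<bar>1 / t\<bar> ^ DIM('a)) * (ennreal (polar_weight ((1 / t) *\<^sub>R y)) * ennreal (\<bar>t\<bar> ^ (DIM('a) - 1))) = ennreal (polar_weight ((1 / t) *\<^sub>R y) / \<bar>t\<bar>)"
        by (simp add: ennreal_mult[symmetric])
      then show "?f y = ?g y"
        using t by (simp add: mult_ac)
    qed
    finally show "(\<integral>\<^sup>+z. ennreal (polar_weight z) * (ennreal (\<bar>t\<bar> ^ (DIM('a) - 1)) * h (t *\<^sub>R z)) \<partial>lborel)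
       = (\<integral>\<^sup>+y. h y * ennreal (polar_weight ((1 / t) *\<^sub>R y) / \<bar>t\<bar>) \<partial>lborel)" .
  qed
  also have "\<dots> = (\<integral>\<^sup>+y. \<integral>\<^sup>+t. h y * ennreal (polar_weight ((1 / t) *\<^sub>R y) / \<bar>t\<bar>) \<partial>lborel \<partial>lborel)"
    by (rule lborel_pair.Fubini') measurable
  also have "\<dots> = (\<integral>\<^sup>+y. 2 * h y \<partial>lborel)"
    (is "integral\<^sup>N _ ?F = integral\<^sup>N _ ?G")
  proof (rule nn_integral_cong_nonzero)
    fix y :: 'a assume "y \<noteq> 0"
    then show "?F y = ?G y"
      by (subst nn_integral_cmult) (auto simp: polar_weight_normalized mult.commute)
  qed
  also have "\<dots> = 2 * (\<integral>\<^sup>+y. h y \<partial>lborel)"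
    by (rule nn_integral_cmult) auto
  finally show ?thesis ..
qed

text \<open>
  On each line through the origin the inversion acts as \<open>t \<mapsto> e / t\<close> for a constant \<open>e\<close>, so that the
  \<open>DIM('a)\<close>-dimensional formula reduces to the one-dimensional one.  A negative \<open>c\<close> composes the
  inversion with the reflection in its centre.
\<close>

lemma nn_integral_inversion:
  fixes h :: "'a::euclidean_space \<Rightarrow> ennreal"
  assumes [measurable]: "h \<in> borel_measurable borel" and c: "c \<noteq> 0"
  shows "(\<integral>\<^sup>+y. h y \<partial>lborel) =
    (\<integral>\<^sup>+y. ennreal ((\<bar>c\<bar> / (norm y)\<^sup>2) ^ DIM('a)) * h ((c / (norm y)\<^sup>2) *\<^sub>R y) \<partial>lborel)"
proof (rule ennreal_2_cancel)
  have "2 * (\<integral>\<^sup>+y. ennreal ((\<bar>c\<bar> / (norm y)\<^sup>2) ^ DIM('a)) * h ((c / (norm y)\<^sup>2) *\<^sub>R y) \<partial>lborel)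
     = (\<integral>\<^sup>+z. ennreal (polar_weight z) * (\<integral>\<^sup>+t. ennreal (\<bar>t\<bar> ^ (DIM('a) - 1)) * (ennreal ((\<bar>c\<bar> / (norm (t *\<^sub>R z))\<^sup>2) ^ DIM('a)) * h ((c / (norm (t *\<^sub>R z))\<^sup>2) *\<^sub>R (t *\<^sub>R z))) \<partial>lborel) \<partial>lborel)"
    by (rule nn_integral_along_lines) measurable
  also have "\<dots> = (\<integral>\<^sup>+z. ennreal (polar_weight z) * (\<integral>\<^sup>+t. ennreal (\<bar>t\<bar> ^ (DIM('a) - 1)) * h (t *\<^sub>R z) \<partial>lborel) \<partial>lborel)"
    (is "integral\<^sup>N _ ?F = integral\<^sup>N _ ?G")
  proof (rule nn_integral_cong_nonzero)
    fix z :: 'a assume z: "z \<noteq> 0"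
    define e where "e = c / (norm z)\<^sup>2"
    have e: "e \<noteq> 0" using z c by (simp add: e_def)
    have "(\<integral>\<^sup>+t. ennreal (\<bar>t\<bar> ^ (DIM('a) - 1)) * h (t *\<^sub>R z) \<partial>lborel)
       = (\<integral>\<^sup>+t. ennreal (\<bar>e\<bar> / t\<^sup>2) * (ennreal (\<bar>e / t\<bar> ^ (DIM('a) - 1)) * h ((e / t) *\<^sub>R z)) \<partial>lborel)"
      using e by (intro nn_integral_inversion_real) measurable
    also have "\<dots> = (\<integral>\<^sup>+t. ennreal (\<bar>t\<bar> ^ (DIM('a) - 1)) * (ennreal ((\<bar>c\<bar> / (norm (t *\<^sub>R z))\<^sup>2) ^ DIM('a)) * h ((c / (norm (t *\<^sub>R z))\<^sup>2) *\<^sub>R (t *\<^sub>R z))) \<partial>lborel)"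
      (is "integral\<^sup>N _ ?f = integral\<^sup>N _ ?g")
    proof (rule nn_integral_cong_nonzero)
      fix t :: real assume t: "t \<noteq> 0"
      have 1: "(c / (norm (t *\<^sub>R z))\<^sup>2) *\<^sub>R (t *\<^sub>R z) = (e / t) *\<^sub>R z"
      proof -
        have "(norm (t *\<^sub>R z))\<^sup>2 = t\<^sup>2 * (norm z)\<^sup>2" by (simp add: power_mult_distrib)
        then have "c / (norm (t *\<^sub>R z))\<^sup>2 * t = e / t"
          using t by (simp add: e_def) (simp add: power2_eq_square)
        then show ?thesis by simp
      qed
      have 2: "\<bar>c\<bar> / (norm (t *\<^sub>R z))\<^sup>2 = \<bar>e\<bar> / t\<^sup>2"
        using t by (simp add: e_def power_mult_distrib abs_divide field_simps)
      obtain m where m: "DIM('a) = Suc m" using DIM_positive[where 'a='a] by (cases "DIM('a)") auto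
      have "\<bar>t\<bar> ^ (DIM('a) - 1) * (\<bar>e\<bar> / t\<^sup>2) ^ DIM('a) = \<bar>e\<bar> / t\<^sup>2 * \<bar>e / t\<bar> ^ (DIM('a) - 1)"
      proof -
        have "\<bar>t\<bar> ^ m * (\<bar>e\<bar> / t\<^sup>2) ^ m = \<bar>e / t\<bar> ^ m"
        proof -
          have "\<bar>t\<bar> * (\<bar>e\<bar> / t\<^sup>2) = \<bar>e / t\<bar>"
            using t by (cases "t > 0") (auto simp: power2_eq_square abs_divide field_simps)
          then show ?thesis by (simp only: power_mult_distrib[symmetric])
        qed
        moreover have "\<bar>t\<bar> ^ (Suc m - 1) * (\<bar>e\<bar> / t\<^sup>2) ^ Suc m = \<bar>e\<bar> / t\<^sup>2 * (\<bar>t\<bar> ^ m * (\<bar>e\<bar> / t\<^sup>2) ^ m)"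
          by (simp only: diff_Suc_1 power_Suc mult_ac)
        ultimately show ?thesis by (simp only: m diff_Suc_1)
      qed
      then show "?f t = ?g t"
        unfolding 1 2 by (simp add: mult.assoc[symmetric] ennreal_mult[symmetric])
    qed
    finally show "?F z = ?G z"
      by simp
  qed
  also have "\<dots> = 2 * (\<integral>\<^sup>+y. h y \<partial>lborel)"
    by (rule nn_integral_along_lines[symmetric]) measurable
  finally show "2 * (\<integral>\<^sup>+y. h y \<partial>lborel) = 2 * (\<integral>\<^sup>+y. ennreal ((\<bar>c\<bar> / (norm y)\<^sup>2) ^ DIM('a)) * h ((c / (norm y)\<^sup>2) *\<^sub>R y) \<partial>lborel)" ..
qed

section \<open>Gaussian moments\<close>

lemma exp_minus_norm_sq: "exp (- (norm z)\<^sup>2) = (\<Prod>b\<in>Basis. exp (- (z \<bullet> b)\<^sup>2))"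
  for z :: "'a::euclidean_space"
proof -
  have "(norm z)\<^sup>2 = (\<Sum>b\<in>Basis. (z \<bullet> b)\<^sup>2)"
    unfolding power2_norm_eq_inner by (subst euclidean_inner) (simp add: power2_eq_square)
  then show ?thesis by (simp add: exp_sum sum_negf[symmetric])
qed

lemma nn_integral_gaussian_real: "(\<integral>\<^sup>+v. ennreal (exp (- v\<^sup>2)) \<partial>lborel) = ennreal (sqrt pi)"
proof -
  have "(\<integral>\<^sup>+v. ennreal (exp (- v\<^sup>2)) \<partial>lborel) = (\<integral>\<^sup>+v. ennreal (\<bar>v\<bar> powr 0 * exp (- v\<^sup>2)) \<partial>lborel)"
    by (rule nn_integral_cong_nonzero) auto
  also have "\<dots> = ennreal (Gamma ((0 + 1) / 2))" by (rule nn_integral_powr_gaussian) simp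
  finally show ?thesis by (simp add: Gamma_one_half_real)
qed

lemma nn_integral_gaussian_real_2: "(\<integral>\<^sup>+v. ennreal (v\<^sup>2 * exp (- v\<^sup>2)) \<partial>lborel) = ennreal (sqrt pi / 2)"
proof -
  have "(\<integral>\<^sup>+v. ennreal (v\<^sup>2 * exp (- v\<^sup>2)) \<partial>lborel) = (\<integral>\<^sup>+v. ennreal (\<bar>v\<bar> powr 2 * exp (- v\<^sup>2)) \<partial>lborel)"
    by simp
  also have "\<dots> = ennreal (Gamma ((2 + 1) / 2))" by (rule nn_integral_powr_gaussian) simp
  also have "(2 + 1) / 2 = 1 / 2 + (1 :: real)" by simp
  also have "Gamma (1 / 2 + 1 :: real) = sqrt pi / 2"
    by (subst Gamma_plus1) (auto simp: Gamma_one_half_real dest: nonpos_Ints_nonpos)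
  finally show ?thesis .
qed

lemma sqrt_pi_power: "sqrt pi ^ n = pi powr (real n / 2)"
  by (simp add: powr_half_sqrt[symmetric] powr_realpow[symmetric] powr_powr)

lemma nn_integral_gaussian:
  "(\<integral>\<^sup>+z. ennreal (exp (- (norm z)\<^sup>2)) \<partial>(lborel :: 'a::euclidean_space measure)) = ennreal (pi powr (real DIM('a) / 2))"
proof -
  have "(\<integral>\<^sup>+z. ennreal (exp (- (norm z)\<^sup>2)) \<partial>(lborel :: 'a measure)) = (\<integral>\<^sup>+z. (\<Prod>b\<in>Basis. ennreal (exp (- (z \<bullet> b)\<^sup>2))) \<partial>(lborel :: 'a measure))"
    by (simp add: exp_minus_norm_sq prod_ennreal)
  also have "\<dots> = (\<Prod>b\<in>(Basis :: 'a set). \<integral>\<^sup>+v. ennreal (exp (- v\<^sup>2)) \<partial>lborel)"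
    by (rule nn_integral_lborel_prod) auto
  finally show ?thesis
    by (simp add: nn_integral_gaussian_real ennreal_power sqrt_pi_power)
qed

lemma nn_integral_gaussian_coordinate:
  fixes i :: "'a::euclidean_space"
  assumes i: "i \<in> Basis"
  shows "(\<integral>\<^sup>+z. ennreal ((i \<bullet> z)\<^sup>2 * exp (- (norm z)\<^sup>2)) \<partial>lborel) = ennreal (pi powr (real DIM('a) / 2) / 2)"
proof -
  let ?f = "\<lambda>b v::real. ennreal (if b = i then v\<^sup>2 * exp (- v\<^sup>2) else exp (- v\<^sup>2))"
  have "(\<integral>\<^sup>+z. ennreal ((i \<bullet> z)\<^sup>2 * exp (- (norm z)\<^sup>2)) \<partial>lborel) = (\<integral>\<^sup>+z. (\<Prod>b\<in>Basis. ?f b (z \<bullet> b)) \<partial>(lborel :: 'a measure))"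
    (is "integral\<^sup>N _ ?F = integral\<^sup>N _ ?G")
  proof (intro nn_integral_cong)
    fix z :: 'a
    have "(\<Prod>b\<in>Basis. if b = i then (z \<bullet> b)\<^sup>2 * exp (- (z \<bullet> b)\<^sup>2) else exp (- (z \<bullet> b)\<^sup>2)) = (z \<bullet> i)\<^sup>2 * exp (- (norm z)\<^sup>2)"
      unfolding exp_minus_norm_sq using i by (subst (1 2) prod.remove[OF _ i]) (auto intro!: prod.cong)
    then show "?F z = ?G z"
      by (subst prod_ennreal) (auto simp: inner_commute)
  qed
  also have "\<dots> = (\<Prod>b\<in>(Basis :: 'a set). \<integral>\<^sup>+v. ?f b v \<partial>lborel)"
    by (rule nn_integral_lborel_prod) auto
  also have "\<dots> = ennreal (sqrt pi / 2) * (\<Prod>b\<in>Basis - {i}. ennreal (sqrt pi))"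
    using i by (subst prod.remove[OF _ i]) (auto simp: nn_integral_gaussian_real nn_integral_gaussian_real_2 if_distrib intro!: prod.cong)
  also have "\<dots> = ennreal (sqrt pi / 2 * sqrt pi ^ (DIM('a) - 1))"
    using i by (simp add: ennreal_power ennreal_mult[symmetric] card_Diff_singleton)
  also have "sqrt pi / 2 * sqrt pi ^ (DIM('a) - 1) = sqrt pi ^ DIM('a) / 2"
    using DIM_positive[where 'a='a] by (cases "DIM('a)") auto
  finally show ?thesis by (simp add: sqrt_pi_power)
qed

lemma lborel_reflect_coordinate:
  fixes h :: "'a::euclidean_space \<Rightarrow> ennreal"
  assumes j: "j \<in> Basis" and [measurable]: "h \<in> borel_measurable borel"
  shows "(\<integral>\<^sup>+z. h z \<partial>lborel) = (\<integral>\<^sup>+z. h (z - (2 * (z \<bullet> j)) *\<^sub>R j) \<partial>lborel)"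
proof -
  let ?c = "\<lambda>b::'a. if b = j then -1 else (1::real)"
  have eq: "0 + (\<Sum>b\<in>Basis. (?c b * (x \<bullet> b)) *\<^sub>R b) = x - (2 * (x \<bullet> j)) *\<^sub>R j" for x
  proof -
    have "(\<Sum>b\<in>Basis. (?c b * (x \<bullet> b)) *\<^sub>R b) = (\<Sum>b\<in>Basis. (x \<bullet> b) *\<^sub>R b - (if b = j then (2 * (x \<bullet> j)) *\<^sub>R j else 0))"
      by (intro sum.cong) (auto simp: scaleR_2[symmetric] simp flip: scaleR_add_left scaleR_minus_left scaleR_diff_left)
    also have "\<dots> = x - (2 * (x \<bullet> j)) *\<^sub>R j"
      using j by (simp add: sum_subtractf euclidean_representation)
    finally show ?thesis by simp
  qed
  have "(lborel :: 'a measure) = density (distr lborel borel (\<lambda>x. 0 + (\<Sum>b\<in>Basis. (?c b * (x \<bullet> b)) *\<^sub>R b))) (\<lambda>_. (\<Prod>b\<in>Basis. \<bar>?c b\<bar>))"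
    by (rule lborel_affine_euclidean) auto
  also have "(\<Prod>b\<in>Basis. \<bar>?c b\<bar>) = 1"
    by (rule prod.neutral) auto
  finally have *: "(lborel :: 'a measure) = distr lborel borel (\<lambda>x. x - (2 * (x \<bullet> j)) *\<^sub>R j)"
    unfolding eq by (simp add: density_1)
  show ?thesis
    by (subst *) (simp add: nn_integral_distr)
qed

text \<open>
  The second moment is a quadratic form in \<open>x\<close>.  Reflecting the variable in one coordinate \<open>j\<close> and
  applying the parallelogram identity shows that the form is additive when a multiple of \<open>j\<close> is added
  to a vector orthogonal to \<open>j\<close>; summing over the coordinates gives the value.
\<close>

lemma nn_integral_gaussian_inner:
  fixes x :: "'a::euclidean_space"
  shows "(\<integral>\<^sup>+z. ennreal ((x \<bullet> z)\<^sup>2 * exp (- (norm z)\<^sup>2)) \<partial>lborel) = ennreal ((norm x)\<^sup>2 * (pi powr (real DIM('a) / 2) / 2))"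
proof -
  define Q where "Q v = (\<integral>\<^sup>+z. ennreal ((v \<bullet> z)\<^sup>2 * exp (- (norm z)\<^sup>2)) \<partial>lborel)" for v :: 'a
  define P where "P = pi powr (real DIM('a) / 2) / 2"
  have P: "P \<ge> 0" by (simp add: P_def)
  have step: "Q (v + c *\<^sub>R j) = Q v + ennreal (c\<^sup>2 * P)" if j: "j \<in> Basis" and vj: "v \<bullet> j = 0" for v j :: 'a and c
  proof (rule ennreal_2_cancel)
    have refl: "(norm (z - (2 * (z \<bullet> j)) *\<^sub>R j))\<^sup>2 = (norm z)\<^sup>2" for z
      unfolding power2_norm_eq_inner using j
      by (simp add: inner_diff inner_commute algebra_simps)
    have "Q (v + c *\<^sub>R j) = (\<integral>\<^sup>+z. ennreal (((v + c *\<^sub>R j) \<bullet> (z - (2 * (z \<bullet> j)) *\<^sub>R j))\<^sup>2 * exp (- (norm z)\<^sup>2)) \<partial>lborel)"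
      unfolding Q_def by (subst lborel_reflect_coordinate[OF j]) (auto simp: refl)
    also have "\<dots> = (\<integral>\<^sup>+z. ennreal ((v \<bullet> z - c * (j \<bullet> z))\<^sup>2 * exp (- (norm z)\<^sup>2)) \<partial>lborel)"
    proof -
      have "(v + c *\<^sub>R j) \<bullet> (z - (2 * (z \<bullet> j)) *\<^sub>R j) = v \<bullet> z - c * (j \<bullet> z)" for z
        using j vj by (simp add: inner_add inner_diff algebra_simps inner_commute)
      then show ?thesis by simp
    qed
    finally have "2 * Q (v + c *\<^sub>R j) = Q (v + c *\<^sub>R j) + (\<integral>\<^sup>+z. ennreal ((v \<bullet> z - c * (j \<bullet> z))\<^sup>2 * exp (- (norm z)\<^sup>2)) \<partial>lborel)"
      by (simp add: mult_2)
    also have "\<dots> = (\<integral>\<^sup>+z. ennreal ((v \<bullet> z + c * (j \<bullet> z))\<^sup>2 * exp (- (norm z)\<^sup>2)) + ennreal ((v \<bullet> z - c * (j \<bullet> z))\<^sup>2 * exp (- (norm z)\<^sup>2)) \<partial>lborel)"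
      unfolding Q_def by (subst nn_integral_add) (auto simp: inner_add)
    also have "\<dots> = (\<integral>\<^sup>+z. ennreal 2 * ennreal ((v \<bullet> z)\<^sup>2 * exp (- (norm z)\<^sup>2)) + ennreal (2 * c\<^sup>2) * ennreal ((j \<bullet> z)\<^sup>2 * exp (- (norm z)\<^sup>2)) \<partial>lborel)"
      (is "integral\<^sup>N _ ?f = integral\<^sup>N _ ?g")
    proof (intro nn_integral_cong)
      fix z :: 'a
      have "(v \<bullet> z + c * (j \<bullet> z))\<^sup>2 * exp (- (norm z)\<^sup>2) + (v \<bullet> z - c * (j \<bullet> z))\<^sup>2 * exp (- (norm z)\<^sup>2) =
        2 * ((v \<bullet> z)\<^sup>2 * exp (- (norm z)\<^sup>2)) + (2 * c\<^sup>2) * ((j \<bullet> z)\<^sup>2 * exp (- (norm z)\<^sup>2))"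
        by (simp add: power2_eq_square algebra_simps)
      then show "?f z = ?g z"
        by (subst (1 2) ennreal_mult[symmetric]) (simp_all add: ennreal_plus[symmetric] del: ennreal_plus ennreal_numeral)
    qed
    also have "\<dots> = ennreal 2 * Q v + ennreal (2 * c\<^sup>2) * ennreal P"
      using j unfolding Q_def P_def
      by (subst nn_integral_add) (auto simp: nn_integral_cmult nn_integral_gaussian_coordinate)
    also have "\<dots> = 2 * (Q v + ennreal (c\<^sup>2 * P))"
      using P by (simp add: distrib_left ennreal_mult mult.assoc)
    finally show "2 * Q (v + c *\<^sub>R j) = 2 * (Q v + ennreal (c\<^sup>2 * P))" .
  qed
  have "Q (\<Sum>j\<in>S. (x \<bullet> j) *\<^sub>R j) = ennreal ((\<Sum>j\<in>S. (x \<bullet> j)\<^sup>2) * P)" if "S \<subseteq> Basis" for S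
    using finite_subset[OF that finite_Basis] that
  proof (induction S rule: finite_induct)
    case empty
    then show ?case by (simp add: Q_def)
  next
    case (insert j S)
    have "Q ((\<Sum>j\<in>S. (x \<bullet> j) *\<^sub>R j) + (x \<bullet> j) *\<^sub>R j) = Q (\<Sum>j\<in>S. (x \<bullet> j) *\<^sub>R j) + ennreal ((x \<bullet> j)\<^sup>2 * P)"
    proof (rule step)
      have "(x \<bullet> b) * (b \<bullet> j) = 0" if "b \<in> S" for b
      proof -
        have "b \<bullet> j = 0" using that insert.hyps insert.prems by (intro inner_not_same_Basis) auto
        then show ?thesis by simp
      qed
      then show "(\<Sum>j\<in>S. (x \<bullet> j) *\<^sub>R j) \<bullet> j = 0"
        by (auto simp: inner_sum_left intro!: sum.neutral)
    qed (use insert in auto)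
    then show ?case using insert P
      by (simp add: add.commute ennreal_plus[symmetric] distrib_right sum_nonneg del: ennreal_plus)
  qed
  from this[of Basis] have "Q x = ennreal ((\<Sum>j\<in>Basis. (x \<bullet> j)\<^sup>2) * P)"
    by (simp add: euclidean_representation)
  also have "(\<Sum>j\<in>Basis. (x \<bullet> j)\<^sup>2) = (norm x)\<^sup>2"
    unfolding power2_norm_eq_inner by (subst (2) euclidean_inner) (simp add: power2_eq_square)
  finally show ?thesis by (simp add: Q_def P_def)
qed

section \<open>Radial integrals and spherical means\<close>

lemma half_sphere_area_pos: "d > 0 \<Longrightarrow> half_sphere_area d > 0"
  by (simp add: half_sphere_area_def)

lemma polar_weight_div_norm:
  fixes z :: "'a::euclidean_space"
  assumes "z \<noteq> 0"
  shows "polar_weight z / norm z ^ DIM('a) = 2 / Gamma (real DIM('a) / 2 + 1) * ((norm z)\<^sup>2 * exp (- (norm z)\<^sup>2))"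
    and "polar_weight z / norm z ^ (DIM('a) + 2) = 2 / Gamma (real DIM('a) / 2 + 1) * exp (- (norm z)\<^sup>2)"
  using assms by (simp_all add: polar_weight_def power_add power2_eq_square)

lemma gamma_half_dim: "2 / Gamma (real n / 2 + 1) * (pi powr (real n / 2) / 2) = 2 / real n * half_sphere_area n"
  if "n > 0"
proof -
  have "Gamma (real n / 2 + 1) = real n / 2 * Gamma (real n / 2)"
    using that by (subst Gamma_plus1) (auto dest: nonpos_Ints_nonpos)
  then show ?thesis by (simp add: half_sphere_area_def)
qed

lemma polar_weight_second_moment:
  fixes x :: "'a::euclidean_space"
  shows "(\<integral>\<^sup>+z. ennreal (polar_weight z / norm z ^ (DIM('a) + 2) * (x \<bullet> z)\<^sup>2) \<partial>lborel)
    = ennreal (2 / real DIM('a) * half_sphere_area DIM('a) * (norm x)\<^sup>2)"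
proof -
  let ?c = "2 / Gamma (real DIM('a) / 2 + 1)"
  have c: "?c \<ge> 0" by simp
  have "(\<integral>\<^sup>+z. ennreal (polar_weight z / norm z ^ (DIM('a) + 2) * (x \<bullet> z)\<^sup>2) \<partial>lborel) =
    (\<integral>\<^sup>+z. ennreal ?c * ennreal ((x \<bullet> z)\<^sup>2 * exp (- (norm z)\<^sup>2)) \<partial>lborel)"
    by (rule nn_integral_cong_nonzero)
      (auto simp: polar_weight_div_norm(2) ennreal_mult[symmetric] mult_ac simp del: power_Suc power_add add_2_eq_Suc')
  also have "\<dots> = ennreal (?c * (pi powr (real DIM('a) / 2) / 2) * (norm x)\<^sup>2)"
    by (subst nn_integral_cmult) (auto simp: nn_integral_gaussian_inner ennreal_mult[symmetric] mult_ac)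
  finally show ?thesis by (subst (asm) gamma_half_dim) auto
qed

lemma polar_weight_moment:
  "(\<integral>\<^sup>+z. ennreal (polar_weight z / norm z ^ DIM('a)) \<partial>(lborel :: 'a::euclidean_space measure)) = ennreal (2 * half_sphere_area DIM('a))"
proof -
  have "(\<integral>\<^sup>+z. ennreal (polar_weight z / norm z ^ DIM('a)) \<partial>(lborel :: 'a measure))
    = (\<integral>\<^sup>+z. (\<Sum>b\<in>Basis. ennreal (polar_weight z / norm z ^ (DIM('a) + 2) * (b \<bullet> z)\<^sup>2)) \<partial>(lborel :: 'a measure))"
    (is "integral\<^sup>N _ ?F = integral\<^sup>N _ ?G")
  proof (rule nn_integral_cong_nonzero)
    fix z :: 'a assume z: "z \<noteq> 0"
    have "(\<Sum>b\<in>Basis. (b \<bullet> z)\<^sup>2) = (norm z)\<^sup>2"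
      unfolding power2_norm_eq_inner by (subst (2) euclidean_inner) (simp add: power2_eq_square inner_commute)
    then have "(\<Sum>b\<in>Basis. polar_weight z / norm z ^ (DIM('a) + 2) * (b \<bullet> z)\<^sup>2) = polar_weight z / norm z ^ DIM('a)"
      using z by (simp only: sum_distrib_left[symmetric]) (simp add: power2_eq_square)
    then show "?F z = ?G z"
      by (subst sum_ennreal) auto
  qed
  also have "\<dots> = (\<Sum>b\<in>(Basis::'a set). ennreal (2 / real DIM('a) * half_sphere_area DIM('a) * (norm b)\<^sup>2))"
    by (subst nn_integral_sum) (measurable, simp only: polar_weight_second_moment)
  also have "\<dots> = (\<Sum>b\<in>(Basis::'a set). ennreal (2 / real DIM('a) * half_sphere_area DIM('a)))"
    by (intro sum.cong) auto
  also have "\<dots> = ennreal (2 * half_sphere_area DIM('a))"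
    using half_sphere_area_pos[of "DIM('a)"] by (subst sum_ennreal) auto
  finally show ?thesis .
qed

lemma nn_integral_radial:
  fixes f :: "real \<Rightarrow> ennreal"
  assumes [measurable]: "f \<in> borel_measurable borel"
  shows "(\<integral>\<^sup>+y. f ((norm y)\<^sup>2) \<partial>(lborel :: 'a::euclidean_space measure)) =
    ennreal (half_sphere_area DIM('a)) * (\<integral>\<^sup>+t\<in>{0<..}. f t * ennreal (t powr (real DIM('a) / 2 - 1)) \<partial>lborel)"
    (is "_ = _ * ?I")
proof (rule ennreal_2_cancel)
  have "2 * (\<integral>\<^sup>+y. f ((norm y)\<^sup>2) \<partial>(lborel :: 'a measure)) =
     (\<integral>\<^sup>+z. ennreal (polar_weight z) * (\<integral>\<^sup>+t. ennreal (\<bar>t\<bar> ^ (DIM('a) - 1)) * f ((norm (t *\<^sub>R z))\<^sup>2) \<partial>lborel) \<partial>(lborel :: 'a measure))"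
    by (rule nn_integral_along_lines) measurable
  also have "\<dots> = (\<integral>\<^sup>+z. ennreal (polar_weight z / norm z ^ DIM('a)) * ?I \<partial>(lborel :: 'a measure))"
    (is "integral\<^sup>N _ ?F = integral\<^sup>N _ ?G")
  proof (rule nn_integral_cong_nonzero)
    fix z :: 'a assume z: "z \<noteq> 0"
    define n where "n = norm z"
    have n: "n > 0" using z by (simp add: n_def)
    have im: "(\<lambda>t. t\<^sup>2 * n\<^sup>2) ` {0<..} = {0<..}"
    proof (intro equalityI subsetI)
      fix x :: real assume "x \<in> {0<..}"
      then show "x \<in> (\<lambda>t. t\<^sup>2 * n\<^sup>2) ` {0<..}"
        using n by (intro image_eqI[of _ _ "sqrt x / n"]) (auto simp: power_divide)
    qed (use n in auto)
    have "?I = (\<integral>\<^sup>+t\<in>{0<..}. ennreal \<bar>2 * t * n\<^sup>2\<bar> * (f (t\<^sup>2 * n\<^sup>2) * ennreal ((t\<^sup>2 * n\<^sup>2) powr (real DIM('a) / 2 - 1))) \<partial>lborel)"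
      using n by (subst im[symmetric], intro nn_integral_change_of_variables)
        (auto simp: im inj_on_def power2_eq_iff intro!: derivative_eq_intros)
    also have "\<dots> = (\<integral>\<^sup>+t. ennreal (n ^ DIM('a)) * (2 * (ennreal (\<bar>t\<bar> ^ (DIM('a) - 1)) * f ((norm (t *\<^sub>R z))\<^sup>2)) * indicator {0<..} t) \<partial>lborel)"
      (is "integral\<^sup>N _ ?f = integral\<^sup>N _ ?g")
    proof (intro nn_integral_cong)
      fix t :: real
      show "?f t = ?g t"
      proof (cases "t > 0")
        case True
        have "(t\<^sup>2 * n\<^sup>2) powr (real DIM('a) / 2 - 1) = ((t * n) powr 2) powr (real DIM('a) / 2 - 1)"
          using True n by (simp add: power_mult_distrib)
        also have "\<dots> = (t * n) powr (real DIM('a) - 2)"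
          by (simp add: powr_powr algebra_simps)
        also have "\<dots> = (t * n) ^ DIM('a) / (t * n)\<^sup>2"
          using True n by (simp add: powr_diff powr_realpow)
        finally have "\<bar>2 * t * n\<^sup>2\<bar> * (t\<^sup>2 * n\<^sup>2) powr (real DIM('a) / 2 - 1) = 2 * (t ^ DIM('a) * n ^ DIM('a)) / t"
          using True n by (simp add: power_mult_distrib power2_eq_square)
        also have "t ^ DIM('a) = t * t ^ (DIM('a) - 1)"
          using DIM_positive[where 'a='a] by (cases "DIM('a)") auto
        finally have "\<bar>2 * t * n\<^sup>2\<bar> * (t\<^sup>2 * n\<^sup>2) powr (real DIM('a) / 2 - 1) = n ^ DIM('a) * 2 * t ^ (DIM('a) - 1)"
          using True by simp
        then have "ennreal \<bar>2 * t * n\<^sup>2\<bar> * ennreal ((t\<^sup>2 * n\<^sup>2) powr (real DIM('a) / 2 - 1)) = ennreal (n ^ DIM('a)) * (2 * ennreal (t ^ (DIM('a) - 1)))"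
          using n True by (simp add: ennreal_mult[symmetric] ennreal_numeral[symmetric] del: ennreal_numeral)
        then have "ennreal \<bar>2 * t * n\<^sup>2\<bar> * ennreal ((t\<^sup>2 * n\<^sup>2) powr (real DIM('a) / 2 - 1)) * f (t\<^sup>2 * n\<^sup>2) = ennreal (n ^ DIM('a)) * (2 * ennreal (t ^ (DIM('a) - 1))) * f (t\<^sup>2 * n\<^sup>2)"
          by (rule arg_cong)
        then show ?thesis
          using True by (simp add: n_def[symmetric] power_mult_distrib mult_ac)
      qed auto
    qed
    also have "\<dots> = ennreal (n ^ DIM('a)) * (\<integral>\<^sup>+t. ennreal (\<bar>t\<bar> ^ (DIM('a) - 1)) * f ((norm (t *\<^sub>R z))\<^sup>2) \<partial>lborel)"
      by (subst nn_integral_cmult, measurable, subst nn_integral_real_even, measurable) (simp add: mult_2)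
    finally have "ennreal (polar_weight z / n ^ DIM('a)) * ?I =
       ennreal (polar_weight z / n ^ DIM('a)) * ennreal (n ^ DIM('a)) * (\<integral>\<^sup>+t. ennreal (\<bar>t\<bar> ^ (DIM('a) - 1)) * f ((norm (t *\<^sub>R z))\<^sup>2) \<partial>lborel)"
      by (simp add: mult.assoc)
    also have "ennreal (polar_weight z / n ^ DIM('a)) * ennreal (n ^ DIM('a)) = ennreal (polar_weight z)"
      using n by (simp add: ennreal_mult[symmetric])
    finally show "?F z = ?G z"
      by (simp add: n_def)
  qed
  also have "\<dots> = ennreal (2 * half_sphere_area DIM('a)) * ?I"
    by (subst nn_integral_multc) (auto simp: polar_weight_moment)
  also have "\<dots> = 2 * (ennreal (half_sphere_area DIM('a)) * ?I)"
    using half_sphere_area_pos[of "DIM('a)"] by (simp add: ennreal_mult mult.assoc)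
  finally show "2 * (\<integral>\<^sup>+y. f ((norm y)\<^sup>2) \<partial>(lborel :: 'a measure)) = \<dots>" .
qed

text \<open>
  On the line \<open>t \<mapsto> x + t *\<^sub>R z\<close> the squared norm exceeds \<open>(norm x)\<^sup>2\<close> by \<open>2 b t + c t\<^sup>2\<close>, where
  \<open>b = x \<bullet> z\<close> and \<open>c = (norm z)\<^sup>2\<close>.  A sphere of radius larger than \<open>norm x\<close> meets the line at two
  points.  Completing the square, \<open>v = t + b / c\<close>, makes them opposite values of \<open>v\<close>, and folding the
  integral at \<open>v = 0\<close> adds their contributions.
\<close>

lemma nn_integral_line_outside:
  fixes b c :: real and f :: "real \<Rightarrow> ennreal"
  assumes [measurable]: "f \<in> borel_measurable borel" and c: "c > 0"
  defines "e \<equiv> \<bar>b\<bar> / c"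
  shows "(\<integral>\<^sup>+t. ennreal (1 / \<bar>t\<bar> ^ k) * f (2 * b * t + c * t\<^sup>2) * indicator {0<..} (2 * b * t + c * t\<^sup>2) \<partial>lborel)
    = (\<integral>\<^sup>+v\<in>{e<..}. ennreal (1 / (v - e) ^ k + 1 / (v + e) ^ k) * f (c * (v\<^sup>2 - e\<^sup>2)) \<partial>lborel)"
proof -
  define H where "H t = ennreal (1 / \<bar>t\<bar> ^ k) * f (2 * b * t + c * t\<^sup>2) * indicator {0<..} (2 * b * t + c * t\<^sup>2)" for t
  have [measurable]: "H \<in> borel_measurable borel" unfolding H_def by measurable
  have e: "e \<ge> 0" using c by (simp add: e_def)
  have "(\<integral>\<^sup>+t. H t \<partial>lborel) = (\<integral>\<^sup>+v. H (- b / c + 1 * v) \<partial>lborel)"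
    by (subst nn_integral_real_affine[where c=1 and t="- b / c"]) auto
  also have "\<dots> = (\<integral>\<^sup>+v\<in>{0<..}. (H (- b / c + 1 * v) + H (- b / c + 1 * (- v))) \<partial>lborel)"
    by (rule nn_integral_real_even) measurable
  also have "\<dots> = (\<integral>\<^sup>+v\<in>{e<..}. ennreal (1 / (v - e) ^ k + 1 / (v + e) ^ k) * f (c * (v\<^sup>2 - e\<^sup>2)) \<partial>lborel)"
    (is "integral\<^sup>N _ ?F = integral\<^sup>N _ ?G")
  proof (intro nn_integral_cong)
    fix v :: real
    have q: "2 * b * (- b / c + s) + c * (- b / c + s)\<^sup>2 = c * (v\<^sup>2 - e\<^sup>2)" if "s = v \<or> s = - v" for s
      using that c by (auto simp: e_def power2_eq_square field_simps)
    show "?F v = ?G v"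
    proof (cases "v > e")
      case False
      have "H (- b / c + 1 * v) = 0" "H (- b / c + 1 * (- v)) = 0" if "v > 0"
      proof -
        have "v\<^sup>2 \<le> e\<^sup>2" using that False by (intro power_mono) auto
        then have "\<not> c * (v\<^sup>2 - e\<^sup>2) > 0" using c by (simp add: zero_less_mult_iff)
        then show "H (- b / c + 1 * v) = 0" "H (- b / c + 1 * (- v)) = 0"
          unfolding H_def using q[of v] q[of "-v"] by auto
      qed
      then show ?thesis using False by (auto simp: indicator_def)
    next
      case True
      then have v: "v > 0" using e by simp
      have "e\<^sup>2 < v\<^sup>2" using True e by (intro power_strict_mono) auto
      then have pos: "c * (v\<^sup>2 - e\<^sup>2) > 0" using c by simp
      have "H (- b / c + 1 * v) + H (- b / c + 1 * (- v)) = ennreal (1 / \<bar>- b / c + v\<bar> ^ k + 1 / \<bar>- b / c - v\<bar> ^ k) * f (c * (v\<^sup>2 - e\<^sup>2))"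
        unfolding H_def using q[of v] q[of "-v"] pos by (simp add: ennreal_plus distrib_right)
      also have "1 / \<bar>- b / c + v\<bar> ^ k + 1 / \<bar>- b / c - v\<bar> ^ k = 1 / (v - e) ^ k + 1 / (v + e) ^ k"
      proof (cases "b \<ge> 0")
        case True
        then have "\<bar>- b / c + v\<bar> = v - e" "\<bar>- b / c - v\<bar> = v + e"
          using \<open>v > e\<close> v c unfolding e_def by (auto simp: abs_if field_simps)
        then show ?thesis by simp
      next
        case False
        then have "\<bar>- b / c + v\<bar> = v + e" "\<bar>- b / c - v\<bar> = v - e"
          using \<open>v > e\<close> v c unfolding e_def by (auto simp: abs_if field_simps)
        then show ?thesis by simp
      qed
      finally show ?thesis using True v by simp
    qed
  qed
  finally show ?thesis by (simp add: H_def)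
qed

lemma nn_integral_square_substitution:
  fixes f :: "real \<Rightarrow> ennreal"
  assumes [measurable]: "f \<in> borel_measurable borel" and c: "c > 0" and e: "e \<ge> 0"
  shows "(\<integral>\<^sup>+u\<in>{0<..}. f u \<partial>lborel) = (\<integral>\<^sup>+v\<in>{e<..}. ennreal (2 * c * v) * f (c * (v\<^sup>2 - e\<^sup>2)) \<partial>lborel)"
proof -
  have im: "(\<lambda>v. c * (v\<^sup>2 - e\<^sup>2)) ` {e<..} = {0<..}"
  proof (intro equalityI subsetI)
    fix x assume "x \<in> (\<lambda>v. c * (v\<^sup>2 - e\<^sup>2)) ` {e<..}"
    then obtain v where v: "x = c * (v\<^sup>2 - e\<^sup>2)" "v > e" by auto
    then have "e\<^sup>2 < v\<^sup>2" using e by (intro power_strict_mono) auto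
    then show "x \<in> {0<..}" using c v by simp
  next
    fix x :: real assume x: "x \<in> {0<..}"
    have "e\<^sup>2 < x / c + e\<^sup>2" using x c by simp
    then have "e < sqrt (x / c + e\<^sup>2)" using e by (simp add: real_less_rsqrt)
    then show "x \<in> (\<lambda>v. c * (v\<^sup>2 - e\<^sup>2)) ` {e<..}"
      using c x by (intro image_eqI[of _ _ "sqrt (x / c + e\<^sup>2)"]) (auto simp: add_nonneg_nonneg)
  qed
  have "(\<integral>\<^sup>+u\<in>{0<..}. f u \<partial>lborel) = (\<integral>\<^sup>+v\<in>{e<..}. ennreal \<bar>2 * c * v\<bar> * f (c * (v\<^sup>2 - e\<^sup>2)) \<partial>lborel)"
    using c e by (subst im[symmetric], intro nn_integral_change_of_variables)
      (auto simp: im inj_on_def power2_eq_iff intro!: derivative_eq_intros)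
  also have "\<dots> = (\<integral>\<^sup>+v\<in>{e<..}. ennreal (2 * c * v) * f (c * (v\<^sup>2 - e\<^sup>2)) \<partial>lborel)"
    using c e by (intro nn_integral_cong) (auto simp: indicator_def abs_mult)
  finally show ?thesis .
qed

text \<open>
  The two intersection points lie on different sides of \<open>x\<close>, at distances with sum \<open>2 v\<close> and product
  \<open>v\<^sup>2 - e\<^sup>2\<close>.  So the sum of the reciprocals is \<open>2 v / (v\<^sup>2 - e\<^sup>2)\<close>, whose numerator is absorbed by the
  substitution \<open>u = c * (v\<^sup>2 - e\<^sup>2)\<close>.  The direction of the line has disappeared from the result.
\<close>

lemma nn_integral_line_outside_1:
  fixes b c :: real and f :: "real \<Rightarrow> ennreal"
  assumes [measurable]: "f \<in> borel_measurable borel" and c: "c > 0"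
  shows "(\<integral>\<^sup>+t. ennreal (1 / \<bar>t\<bar>) * f (2 * b * t + c * t\<^sup>2) * indicator {0<..} (2 * b * t + c * t\<^sup>2) \<partial>lborel)
    = (\<integral>\<^sup>+u\<in>{0<..}. f u * ennreal (1 / u) \<partial>lborel)"
proof -
  define e where "e = \<bar>b\<bar> / c"
  have e: "e \<ge> 0" using c by (simp add: e_def)
  have "(\<integral>\<^sup>+u\<in>{0<..}. f u * ennreal (1 / u) \<partial>lborel) = (\<integral>\<^sup>+v\<in>{e<..}. ennreal (2 * c * v) * (f (c * (v\<^sup>2 - e\<^sup>2)) * ennreal (1 / (c * (v\<^sup>2 - e\<^sup>2)))) \<partial>lborel)"
    by (rule nn_integral_square_substitution) (use c e in auto)
  also have "\<dots> = (\<integral>\<^sup>+v\<in>{e<..}. ennreal (1 / (v - e) ^ 1 + 1 / (v + e) ^ 1) * f (c * (v\<^sup>2 - e\<^sup>2)) \<partial>lborel)"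
    (is "integral\<^sup>N _ ?F = integral\<^sup>N _ ?G")
  proof (intro nn_integral_cong)
    fix v :: real
    have prod: "ennreal (2 * c * v) * ennreal (1 / (c * (v\<^sup>2 - e\<^sup>2))) = ennreal (1 / (v - e) ^ 1 + 1 / (v + e) ^ 1)" if "v > e"
    proof -
      have *: "v\<^sup>2 - e\<^sup>2 = (v - e) * (v + e)" by (simp add: power2_eq_square algebra_simps)
      have pos: "v - e > 0" "v + e > 0" using that e by auto
      have "2 * c * v * (1 / (c * (v\<^sup>2 - e\<^sup>2))) = 1 / (v - e) ^ 1 + 1 / (v + e) ^ 1"
        unfolding * using pos c by (simp add: divide_simps)
      then show ?thesis
        using that e c pos unfolding * by (subst ennreal_mult[symmetric]) auto
    qed
    show "?F v = ?G v"
    proof (cases "v > e")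
      case True
      from arg_cong[OF prod[OF True], of "\<lambda>w. w * f (c * (v\<^sup>2 - e\<^sup>2))"]
      show ?thesis using True by (simp add: mult_ac)
    qed auto
  qed
  also have "\<dots> = (\<integral>\<^sup>+t. ennreal (1 / \<bar>t\<bar> ^ 1) * f (2 * b * t + c * t\<^sup>2) * indicator {0<..} (2 * b * t + c * t\<^sup>2) \<partial>lborel)"
    unfolding e_def using c by (intro nn_integral_line_outside[symmetric]) auto
  finally show ?thesis by simp
qed

text \<open>
  As for the first power, the sum of the reciprocal third powers of the two distances is rational in
  \<open>v\<^sup>2\<close> apart from a factor \<open>v\<close>, which the substitution absorbs.
\<close>

lemma nn_integral_line_outside_3:
  fixes b c :: real and f :: "real \<Rightarrow> ennreal"
  assumes [measurable]: "f \<in> borel_measurable borel" and c: "c > 0"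
  shows "(\<integral>\<^sup>+t. ennreal (1 / \<bar>t\<bar> ^ 3) * f (2 * b * t + c * t\<^sup>2) * indicator {0<..} (2 * b * t + c * t\<^sup>2) \<partial>lborel)
    = (\<integral>\<^sup>+u\<in>{0<..}. f u * ennreal ((c * u + 4 * b\<^sup>2) / u ^ 3) \<partial>lborel)"
proof -
  define e where "e = \<bar>b\<bar> / c"
  have e: "e \<ge> 0" using c by (simp add: e_def)
  have b: "b\<^sup>2 = c\<^sup>2 * e\<^sup>2" using c by (simp add: e_def power_divide)
  have "(\<integral>\<^sup>+u\<in>{0<..}. f u * ennreal ((c * u + 4 * b\<^sup>2) / u ^ 3) \<partial>lborel) = (\<integral>\<^sup>+v\<in>{e<..}. ennreal (2 * c * v) * (f (c * (v\<^sup>2 - e\<^sup>2)) * ennreal ((c * (c * (v\<^sup>2 - e\<^sup>2)) + 4 * b\<^sup>2) / (c * (v\<^sup>2 - e\<^sup>2)) ^ 3)) \<partial>lborel)"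
    by (rule nn_integral_square_substitution) (use c e in auto)
  also have "\<dots> = (\<integral>\<^sup>+v\<in>{e<..}. ennreal (1 / (v - e) ^ 3 + 1 / (v + e) ^ 3) * f (c * (v\<^sup>2 - e\<^sup>2)) \<partial>lborel)"
    (is "integral\<^sup>N _ ?F = integral\<^sup>N _ ?G")
  proof (intro nn_integral_cong)
    fix v :: real
    have prod: "ennreal (2 * c * v) * ennreal ((c * (c * (v\<^sup>2 - e\<^sup>2)) + 4 * b\<^sup>2) / (c * (v\<^sup>2 - e\<^sup>2)) ^ 3) = ennreal (1 / (v - e) ^ 3 + 1 / (v + e) ^ 3)" if "v > e"
    proof -
      have *: "v\<^sup>2 - e\<^sup>2 = (v - e) * (v + e)" by (simp add: power2_eq_square algebra_simps)
      have pos: "v - e > 0" "v + e > 0" using that e by auto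
      have "2 * c * v * ((c * (c * (v\<^sup>2 - e\<^sup>2)) + 4 * b\<^sup>2) / (c * (v\<^sup>2 - e\<^sup>2)) ^ 3) = 2 * v * c ^ 3 * ((v\<^sup>2 - e\<^sup>2) + 4 * e\<^sup>2) / (c ^ 3 * (v\<^sup>2 - e\<^sup>2) ^ 3)"
        unfolding b by (simp add: power_mult_distrib algebra_simps power2_eq_square power3_eq_cube)
      also have "\<dots> = 2 * v * (v\<^sup>2 + 3 * e\<^sup>2) / (v\<^sup>2 - e\<^sup>2) ^ 3" using c by simp
      also have "2 * v * (v\<^sup>2 + 3 * e\<^sup>2) = (v + e) ^ 3 + (v - e) ^ 3"
        by (simp add: power2_eq_square power3_eq_cube algebra_simps)
      also have "((v + e) ^ 3 + (v - e) ^ 3) / (v\<^sup>2 - e\<^sup>2) ^ 3 = 1 / (v - e) ^ 3 + 1 / (v + e) ^ 3"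
        unfolding * power_mult_distrib using pos by (simp add: add_divide_distrib)
      finally have **: "2 * c * v * ((c * (c * (v\<^sup>2 - e\<^sup>2)) + 4 * b\<^sup>2) / (c * (v\<^sup>2 - e\<^sup>2)) ^ 3) = 1 / (v - e) ^ 3 + 1 / (v + e) ^ 3" .
      have "(c * (c * (v\<^sup>2 - e\<^sup>2)) + 4 * b\<^sup>2) / (c * (v\<^sup>2 - e\<^sup>2)) ^ 3 \<ge> 0"
        using pos c by (intro divide_nonneg_nonneg add_nonneg_nonneg) (simp_all add: *)
      then show ?thesis
        using that e c ** by (intro ennreal_mult_eqI) auto
    qed
    show "?F v = ?G v"
    proof (cases "v > e")
      case True
      from arg_cong[OF prod[OF True], of "\<lambda>w. w * f (c * (v\<^sup>2 - e\<^sup>2))"]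
      show ?thesis using True by (simp add: mult_ac)
    qed auto
  qed
  also have "\<dots> = (\<integral>\<^sup>+t. ennreal (1 / \<bar>t\<bar> ^ 3) * f (2 * b * t + c * t\<^sup>2) * indicator {0<..} (2 * b * t + c * t\<^sup>2) \<partial>lborel)"
    unfolding e_def using c by (intro nn_integral_line_outside[symmetric]) auto
  finally show ?thesis by simp
qed

lemma nn_integral_shift:
  fixes h :: "'a::euclidean_space \<Rightarrow> ennreal"
  assumes [measurable]: "h \<in> borel_measurable borel"
  shows "(\<integral>\<^sup>+y. h y \<partial>lborel) = (\<integral>\<^sup>+z. h (x + z) \<partial>lborel)"
  using nn_integral_lborel_affine[of h 1 x] by simp

lemma nn_integral_kernel_outside_lines:
  fixes x :: "'a::euclidean_space" and f :: "real \<Rightarrow> ennreal"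
  assumes [measurable]: "f \<in> borel_measurable borel"
  shows "2 * (\<integral>\<^sup>+y. f ((norm y)\<^sup>2) * ennreal (1 / norm (x - y) ^ (DIM('a) + n)) * indicator {(norm x)\<^sup>2<..} ((norm y)\<^sup>2) \<partial>lborel)
    = (\<integral>\<^sup>+z. ennreal (polar_weight z / norm z ^ (DIM('a) + n)) *
        (\<integral>\<^sup>+t. ennreal (1 / \<bar>t\<bar> ^ (n + 1)) * f ((norm x)\<^sup>2 + (2 * (x \<bullet> z) * t + (norm z)\<^sup>2 * t\<^sup>2))
           * indicator {0<..} (2 * (x \<bullet> z) * t + (norm z)\<^sup>2 * t\<^sup>2) \<partial>lborel) \<partial>lborel)"
proof -
  define G where "G z = f ((norm (x + z))\<^sup>2) * ennreal (1 / norm z ^ (DIM('a) + n)) * indicator {(norm x)\<^sup>2<..} ((norm (x + z))\<^sup>2)" for z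
  have [measurable]: "G \<in> borel_measurable borel" unfolding G_def by measurable
  have "(\<integral>\<^sup>+y. f ((norm y)\<^sup>2) * ennreal (1 / norm (x - y) ^ (DIM('a) + n)) * indicator {(norm x)\<^sup>2<..} ((norm y)\<^sup>2) \<partial>lborel)
     = (\<integral>\<^sup>+z. G z \<partial>lborel)"
    unfolding G_def by (subst nn_integral_shift[where x=x]) auto
  then have "2 * (\<integral>\<^sup>+y. f ((norm y)\<^sup>2) * ennreal (1 / norm (x - y) ^ (DIM('a) + n)) * indicator {(norm x)\<^sup>2<..} ((norm y)\<^sup>2) \<partial>lborel)
     = (\<integral>\<^sup>+z. ennreal (polar_weight z) * (\<integral>\<^sup>+t. ennreal (\<bar>t\<bar> ^ (DIM('a) - 1)) * G (t *\<^sub>R z) \<partial>lborel) \<partial>lborel)"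
    by (simp add: nn_integral_along_lines)
  also have "\<dots> = (\<integral>\<^sup>+z. ennreal (polar_weight z / norm z ^ (DIM('a) + n)) *
        (\<integral>\<^sup>+t. ennreal (1 / \<bar>t\<bar> ^ (n + 1)) * f ((norm x)\<^sup>2 + (2 * (x \<bullet> z) * t + (norm z)\<^sup>2 * t\<^sup>2))
           * indicator {0<..} (2 * (x \<bullet> z) * t + (norm z)\<^sup>2 * t\<^sup>2) \<partial>lborel) \<partial>lborel)"
  proof (rule nn_integral_cong_nonzero)
    fix z :: 'a assume z: "z \<noteq> 0"
    have "(\<integral>\<^sup>+t. ennreal (\<bar>t\<bar> ^ (DIM('a) - 1)) * G (t *\<^sub>R z) \<partial>lborel) =
      (\<integral>\<^sup>+t. ennreal (1 / norm z ^ (DIM('a) + n)) * (ennreal (1 / \<bar>t\<bar> ^ (n + 1)) * f ((norm x)\<^sup>2 + (2 * (x \<bullet> z) * t + (norm z)\<^sup>2 * t\<^sup>2))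
           * indicator {0<..} (2 * (x \<bullet> z) * t + (norm z)\<^sup>2 * t\<^sup>2)) \<partial>lborel)"
      (is "integral\<^sup>N _ ?f = integral\<^sup>N _ ?g")
    proof (rule nn_integral_cong_nonzero)
      fix t :: real assume t: "t \<noteq> 0"
      have nrm: "(norm (x + t *\<^sub>R z))\<^sup>2 = (norm x)\<^sup>2 + (2 * (x \<bullet> z) * t + (norm z)\<^sup>2 * t\<^sup>2)"
        unfolding power2_norm_eq_inner by (simp add: inner_add inner_commute power2_eq_square algebra_simps)
      have ind: "indicator {(norm x)\<^sup>2<..} ((norm (x + t *\<^sub>R z))\<^sup>2) = (indicator {0<..} (2 * (x \<bullet> z) * t + (norm z)\<^sup>2 * t\<^sup>2) :: ennreal)"
        unfolding nrm by (auto simp: indicator_def)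
      obtain m where m: "DIM('a) = Suc m" using DIM_positive[where 'a='a] by (cases "DIM('a)") auto
      have "\<bar>t\<bar> ^ (DIM('a) - 1) * (1 / norm (t *\<^sub>R z) ^ (DIM('a) + n)) = 1 / norm z ^ (DIM('a) + n) * (1 / \<bar>t\<bar> ^ (n + 1))"
        using t by (simp add: m power_mult_distrib power_add)
      then have w: "ennreal (\<bar>t\<bar> ^ (DIM('a) - 1)) * ennreal (1 / norm (t *\<^sub>R z) ^ (DIM('a) + n)) = ennreal (1 / norm z ^ (DIM('a) + n)) * ennreal (1 / \<bar>t\<bar> ^ (n + 1))"
        by (subst (1 2) ennreal_mult[symmetric]) (auto simp del: norm_scaleR)
      show "?f t = ?g t"
        unfolding G_def ind unfolding nrm
        using arg_cong[OF w, of "\<lambda>w. w * (f ((norm x)\<^sup>2 + (2 * (x \<bullet> z) * t + (norm z)\<^sup>2 * t\<^sup>2)) * indicator {0<..} (2 * (x \<bullet> z) * t + (norm z)\<^sup>2 * t\<^sup>2))"]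
        by (simp only: mult_ac)
    qed
    also have "\<dots> = ennreal (1 / norm z ^ (DIM('a) + n)) * (\<integral>\<^sup>+t. (ennreal (1 / \<bar>t\<bar> ^ (n + 1)) * f ((norm x)\<^sup>2 + (2 * (x \<bullet> z) * t + (norm z)\<^sup>2 * t\<^sup>2))
           * indicator {0<..} (2 * (x \<bullet> z) * t + (norm z)\<^sup>2 * t\<^sup>2)) \<partial>lborel)"
      by (rule nn_integral_cmult) measurable
    finally have "ennreal (polar_weight z) * (\<integral>\<^sup>+t. ennreal (\<bar>t\<bar> ^ (DIM('a) - 1)) * G (t *\<^sub>R z) \<partial>lborel) =
       (ennreal (polar_weight z) * ennreal (1 / norm z ^ (DIM('a) + n))) * (\<integral>\<^sup>+t. (ennreal (1 / \<bar>t\<bar> ^ (n + 1)) * f ((norm x)\<^sup>2 + (2 * (x \<bullet> z) * t + (norm z)\<^sup>2 * t\<^sup>2))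
           * indicator {0<..} (2 * (x \<bullet> z) * t + (norm z)\<^sup>2 * t\<^sup>2)) \<partial>lborel)"
      by (simp only: mult.assoc)
    also have "ennreal (polar_weight z) * ennreal (1 / norm z ^ (DIM('a) + n)) = ennreal (polar_weight z / norm z ^ (DIM('a) + n))"
      by (subst ennreal_mult[symmetric]) (auto simp del: power_Suc)
    finally show "ennreal (polar_weight z) * (\<integral>\<^sup>+t. ennreal (\<bar>t\<bar> ^ (DIM('a) - 1)) * G (t *\<^sub>R z) \<partial>lborel) =
       ennreal (polar_weight z / norm z ^ (DIM('a) + n)) * (\<integral>\<^sup>+t. (ennreal (1 / \<bar>t\<bar> ^ (n + 1)) * f ((norm x)\<^sup>2 + (2 * (x \<bullet> z) * t + (norm z)\<^sup>2 * t\<^sup>2))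
           * indicator {0<..} (2 * (x \<bullet> z) * t + (norm z)\<^sup>2 * t\<^sup>2)) \<partial>lborel)" .
  qed
  finally show ?thesis .
qed

text \<open>
  The spherical mean of \<open>1 / norm (x - y) ^ DIM('a)\<close>, stated as an integral against a radial function
  outside the sphere through \<open>x\<close>: each line through \<open>x\<close> contributes the same amount.
\<close>

lemma nn_integral_poisson_outside:
  fixes x :: "'a::euclidean_space" and f :: "real \<Rightarrow> ennreal"
  assumes [measurable]: "f \<in> borel_measurable borel"
  shows "(\<integral>\<^sup>+y. f ((norm y)\<^sup>2) * ennreal (1 / norm (x - y) ^ DIM('a)) * indicator {(norm x)\<^sup>2<..} ((norm y)\<^sup>2) \<partial>lborel)
    = ennreal (half_sphere_area DIM('a)) * (\<integral>\<^sup>+u\<in>{0<..}. f ((norm x)\<^sup>2 + u) * ennreal (1 / u) \<partial>lborel)"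
    (is "?L = _ * ?I")
proof (rule ennreal_2_cancel)
  have "2 * ?L = (\<integral>\<^sup>+z. ennreal (polar_weight z / norm z ^ DIM('a)) *
        (\<integral>\<^sup>+t. ennreal (1 / \<bar>t\<bar>) * f ((norm x)\<^sup>2 + (2 * (x \<bullet> z) * t + (norm z)\<^sup>2 * t\<^sup>2))
           * indicator {0<..} (2 * (x \<bullet> z) * t + (norm z)\<^sup>2 * t\<^sup>2) \<partial>lborel) \<partial>lborel)"
    using nn_integral_kernel_outside_lines[of f x 0] by simp
  also have "\<dots> = (\<integral>\<^sup>+z. ennreal (polar_weight z / norm z ^ DIM('a)) * ?I \<partial>(lborel::'a measure))"
    by (rule nn_integral_cong_nonzero,
        subst nn_integral_line_outside_1[where f="\<lambda>u. f ((norm x)\<^sup>2 + u)"]) auto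
  also have "\<dots> = ennreal (2 * half_sphere_area DIM('a)) * ?I"
    by (subst nn_integral_multc) (auto simp: polar_weight_moment)
  also have "\<dots> = 2 * (ennreal (half_sphere_area DIM('a)) * ?I)"
    using half_sphere_area_pos[of "DIM('a)"] by (simp add: ennreal_mult mult.assoc)
  finally show "2 * ?L = 2 * (ennreal (half_sphere_area DIM('a)) * ?I)" .
qed

text \<open>
  The same with the exponent raised by two.  The contribution of a line now depends on its direction
  through \<open>(x \<bullet> z)\<^sup>2\<close>, and averaging over the directions replaces this by \<open>(norm x)\<^sup>2 (norm z)\<^sup>2 / DIM('a)\<close>.
\<close>

lemma nn_integral_poisson_outside_2:
  fixes x :: "'a::euclidean_space" and f :: "real \<Rightarrow> ennreal"
  assumes [measurable]: "f \<in> borel_measurable borel"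
  shows "(\<integral>\<^sup>+y. f ((norm y)\<^sup>2) * ennreal (1 / norm (x - y) ^ (DIM('a) + 2)) * indicator {(norm x)\<^sup>2<..} ((norm y)\<^sup>2) \<partial>lborel)
    = ennreal (half_sphere_area DIM('a)) *
      (\<integral>\<^sup>+u\<in>{0<..}. f ((norm x)\<^sup>2 + u) * ennreal (1 / u\<^sup>2 + 4 * (norm x)\<^sup>2 / real DIM('a) / u ^ 3) \<partial>lborel)"
    (is "?L = _ * ?I")
proof (rule ennreal_2_cancel)
  let ?s = "half_sphere_area DIM('a)"
  have s: "?s > 0" using half_sphere_area_pos[of "DIM('a)"] by simp
  have "2 * ?L = (\<integral>\<^sup>+z. ennreal (polar_weight z / norm z ^ (DIM('a) + 2)) *
        (\<integral>\<^sup>+t. ennreal (1 / \<bar>t\<bar> ^ 3) * f ((norm x)\<^sup>2 + (2 * (x \<bullet> z) * t + (norm z)\<^sup>2 * t\<^sup>2))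
           * indicator {0<..} (2 * (x \<bullet> z) * t + (norm z)\<^sup>2 * t\<^sup>2) \<partial>lborel) \<partial>lborel)"
    using nn_integral_kernel_outside_lines[of f x 2] by (simp only: numeral_3_eq_3 numeral_2_eq_2 Suc_eq_plus1 add.assoc) simp
  also have "\<dots> = (\<integral>\<^sup>+z. ennreal (polar_weight z / norm z ^ (DIM('a) + 2)) *
      (\<integral>\<^sup>+u\<in>{0<..}. f ((norm x)\<^sup>2 + u) * ennreal (((norm z)\<^sup>2 * u + 4 * (x \<bullet> z)\<^sup>2) / u ^ 3) \<partial>lborel) \<partial>lborel)"
    by (rule nn_integral_cong_nonzero,
        subst nn_integral_line_outside_3[where f="\<lambda>u. f ((norm x)\<^sup>2 + u)"]) auto
  also have "\<dots> = (\<integral>\<^sup>+z. \<integral>\<^sup>+u. f ((norm x)\<^sup>2 + u) * indicator {0<..} u * (ennreal (1 / u\<^sup>2) * ennreal (polar_weight z / norm z ^ DIM('a))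
       + ennreal (4 / u ^ 3) * ennreal (polar_weight z / norm z ^ (DIM('a) + 2) * (x \<bullet> z)\<^sup>2)) \<partial>lborel \<partial>lborel)"
    (is "integral\<^sup>N _ ?F = integral\<^sup>N _ ?G")
  proof (rule nn_integral_cong_nonzero)
    fix z :: 'a assume z: "z \<noteq> 0"
    define w where "w = polar_weight z / norm z ^ (DIM('a) + 2)"
    have w: "w \<ge> 0" unfolding w_def by (intro divide_nonneg_nonneg) auto
    have w': "polar_weight z / norm z ^ DIM('a) = w * (norm z)\<^sup>2" using z by (simp add: w_def power_add power2_eq_square)
    have "ennreal w * (\<integral>\<^sup>+u\<in>{0<..}. f ((norm x)\<^sup>2 + u) * ennreal (((norm z)\<^sup>2 * u + 4 * (x \<bullet> z)\<^sup>2) / u ^ 3) \<partial>lborel)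
      = (\<integral>\<^sup>+u. ennreal w * (f ((norm x)\<^sup>2 + u) * ennreal (((norm z)\<^sup>2 * u + 4 * (x \<bullet> z)\<^sup>2) / u ^ 3) * indicator {0<..} u) \<partial>lborel)"
      by (rule nn_integral_cmult[symmetric]) measurable
    also have "\<dots> = (\<integral>\<^sup>+u. f ((norm x)\<^sup>2 + u) * indicator {0<..} u * (ennreal (1 / u\<^sup>2) * ennreal (w * (norm z)\<^sup>2) + ennreal (4 / u ^ 3) * ennreal (w * (x \<bullet> z)\<^sup>2)) \<partial>lborel)"
      (is "integral\<^sup>N _ ?f = integral\<^sup>N _ ?g")
    proof (intro nn_integral_cong)
      fix u :: real
      show "?f u = ?g u"
      proof (cases "u > 0")
        case True
        have "w * (((norm z)\<^sup>2 * u + 4 * (x \<bullet> z)\<^sup>2) / u ^ 3) = 1 / u\<^sup>2 * (w * (norm z)\<^sup>2) + 4 / u ^ 3 * (w * (x \<bullet> z)\<^sup>2)"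
          using True by (simp add: power2_eq_square power3_eq_cube field_simps)
        moreover have "ennreal w * ennreal (((norm z)\<^sup>2 * u + 4 * (x \<bullet> z)\<^sup>2) / u ^ 3) = ennreal (w * (((norm z)\<^sup>2 * u + 4 * (x \<bullet> z)\<^sup>2) / u ^ 3))"
          using w True by (subst ennreal_mult) auto
        moreover have "ennreal (1 / u\<^sup>2) * ennreal (w * (norm z)\<^sup>2) + ennreal (4 / u ^ 3) * ennreal (w * (x \<bullet> z)\<^sup>2) = ennreal (1 / u\<^sup>2 * (w * (norm z)\<^sup>2) + 4 / u ^ 3 * (w * (x \<bullet> z)\<^sup>2))"
          using w True by (intro ennreal_mult_add_mult) auto
        ultimately have "ennreal w * ennreal (((norm z)\<^sup>2 * u + 4 * (x \<bullet> z)\<^sup>2) / u ^ 3) = ennreal (1 / u\<^sup>2) * ennreal (w * (norm z)\<^sup>2) + ennreal (4 / u ^ 3) * ennreal (w * (x \<bullet> z)\<^sup>2)"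
          by (simp only:)
        from arg_cong[OF this, of "\<lambda>w. f ((norm x)\<^sup>2 + u) * w"] show ?thesis
          using True by (simp only: mult_ac indicator_simps(1) greaterThan_iff mult_1_left mult_1_right)
      qed auto
    qed
    finally show "?F z = ?G z"
      by (simp only: w' w_def[symmetric])
  qed
  also have "\<dots> = (\<integral>\<^sup>+u. \<integral>\<^sup>+z. f ((norm x)\<^sup>2 + u) * indicator {0<..} u * (ennreal (1 / u\<^sup>2) * ennreal (polar_weight z / norm z ^ DIM('a))
       + ennreal (4 / u ^ 3) * ennreal (polar_weight z / norm z ^ (DIM('a) + 2) * (x \<bullet> z)\<^sup>2)) \<partial>lborel \<partial>lborel)"
    by (rule lborel_pair.Fubini') measurable
  also have "\<dots> = (\<integral>\<^sup>+u. 2 * ennreal ?s * (f ((norm x)\<^sup>2 + u) * ennreal (1 / u\<^sup>2 + 4 * (norm x)\<^sup>2 / real DIM('a) / u ^ 3) * indicator {0<..} u) \<partial>lborel)"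
  proof (intro nn_integral_cong)
    fix u :: real
    have "(\<integral>\<^sup>+z. f ((norm x)\<^sup>2 + u) * indicator {0<..} u * (ennreal (1 / u\<^sup>2) * ennreal (polar_weight z / norm z ^ DIM('a))
       + ennreal (4 / u ^ 3) * ennreal (polar_weight z / norm z ^ (DIM('a) + 2) * (x \<bullet> z)\<^sup>2)) \<partial>lborel)
      = f ((norm x)\<^sup>2 + u) * indicator {0<..} u * (ennreal (1 / u\<^sup>2) * ennreal (2 * ?s) + ennreal (4 / u ^ 3) * ennreal (2 / real DIM('a) * ?s * (norm x)\<^sup>2))"
      by (subst nn_integral_cmult, measurable, subst nn_integral_add, measurable, subst nn_integral_cmult, measurable,
          subst nn_integral_cmult, measurable, simp only: polar_weight_moment polar_weight_second_moment)
    also have "\<dots> = 2 * ennreal ?s * (f ((norm x)\<^sup>2 + u) * ennreal (1 / u\<^sup>2 + 4 * (norm x)\<^sup>2 / real DIM('a) / u ^ 3) * indicator {0<..} u)"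
    proof (cases "u > 0")
      case True
      have "ennreal (1 / u\<^sup>2) * ennreal (2 * ?s) + ennreal (4 / u ^ 3) * ennreal (2 / real DIM('a) * ?s * (norm x)\<^sup>2)
        = ennreal (1 / u\<^sup>2 * (2 * ?s) + 4 / u ^ 3 * (2 / real DIM('a) * ?s * (norm x)\<^sup>2))"
        using s True by (intro ennreal_mult_add_mult) auto
      also have "1 / u\<^sup>2 * (2 * ?s) + 4 / u ^ 3 * (2 / real DIM('a) * ?s * (norm x)\<^sup>2) = 2 * ?s * (1 / u\<^sup>2 + 4 * (norm x)\<^sup>2 / real DIM('a) / u ^ 3)"
        by (simp add: algebra_simps)
      also have "ennreal (2 * ?s * (1 / u\<^sup>2 + 4 * (norm x)\<^sup>2 / real DIM('a) / u ^ 3)) = 2 * ennreal ?s * ennreal (1 / u\<^sup>2 + 4 * (norm x)\<^sup>2 / real DIM('a) / u ^ 3)"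
        using s True by (subst ennreal_mult) (auto simp: ennreal_mult)
      finally show ?thesis using True by (simp only: mult_ac)
    qed auto
    finally show "(\<integral>\<^sup>+z. f ((norm x)\<^sup>2 + u) * indicator {0<..} u * (ennreal (1 / u\<^sup>2) * ennreal (polar_weight z / norm z ^ DIM('a))
       + ennreal (4 / u ^ 3) * ennreal (polar_weight z / norm z ^ (DIM('a) + 2) * (x \<bullet> z)\<^sup>2)) \<partial>lborel)
      = 2 * ennreal ?s * (f ((norm x)\<^sup>2 + u) * ennreal (1 / u\<^sup>2 + 4 * (norm x)\<^sup>2 / real DIM('a) / u ^ 3) * indicator {0<..} u)" .
  qed
  also have "\<dots> = 2 * (ennreal ?s * ?I)"
    by (subst nn_integral_cmult) (auto simp: mult.assoc)
  finally show "2 * ?L = 2 * (ennreal ?s * ?I)" .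
qed

section \<open>The power potential of the profile inside the ball\<close>

definition ball_weight :: "real \<Rightarrow> 'a::euclidean_space \<Rightarrow> real" where
  "ball_weight g y = (if norm y < 1 then (1 - (norm y)\<^sup>2) powr g else 0)"

lemma ball_weight_nonneg [simp]: "ball_weight g y \<ge> 0"
  by (simp add: ball_weight_def)

lemma ball_weight_measurable [measurable]: "ball_weight g \<in> borel_measurable borel"
  unfolding ball_weight_def by measurable

lemma norm_less_1_iff: "norm y < 1 \<longleftrightarrow> (norm y)\<^sup>2 < 1"
  using power_strict_mono[of "norm y" 1 2] power_mono[of 1 "norm y" 2] by (auto simp: not_less[symmetric])

lemma ball_weight_eq: "ball_weight g y = (if (norm y)\<^sup>2 < 1 then (1 - (norm y)\<^sup>2) powr g else 0)"
  by (simp add: ball_weight_def norm_less_1_iff)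

lemma nn_integral_ball_weight_moment:
  fixes k g :: real
  assumes k: "k > - real DIM('a) / 2" and g: "g > -1"
  shows "(\<integral>\<^sup>+y. ennreal ((norm y)\<^sup>2 powr k * ball_weight g y) \<partial>(lborel :: 'a::euclidean_space measure)) =
    ennreal (half_sphere_area DIM('a) * Beta (real DIM('a) / 2 + k) (g + 1))"
proof -
  define f where "f t = ennreal (t powr k * (if t < 1 then (1 - t) powr g else 0))" for t :: real
  have [measurable]: "f \<in> borel_measurable borel" unfolding f_def by measurable
  have "(\<integral>\<^sup>+y. ennreal ((norm y)\<^sup>2 powr k * ball_weight g y) \<partial>(lborel :: 'a measure)) = (\<integral>\<^sup>+y. f ((norm y)\<^sup>2) \<partial>(lborel :: 'a measure))"
    by (simp add: f_def ball_weight_eq)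
  also have "\<dots> = ennreal (half_sphere_area DIM('a)) * (\<integral>\<^sup>+t\<in>{0<..}. f t * ennreal (t powr (real DIM('a) / 2 - 1)) \<partial>lborel)"
    by (rule nn_integral_radial) measurable
  also have "(\<integral>\<^sup>+t\<in>{0<..}. f t * ennreal (t powr (real DIM('a) / 2 - 1)) \<partial>lborel)
     = (\<integral>\<^sup>+t\<in>{0<..<1}. ennreal (t powr ((real DIM('a) / 2 + k) - 1) * (1 - t) powr ((g + 1) - 1)) \<partial>lborel)"
    by (intro nn_integral_cong)
      (auto simp: f_def indicator_def ennreal_mult[symmetric] powr_diff powr_add algebra_simps)
  also have "\<dots> = ennreal (Beta (real DIM('a) / 2 + k) (g + 1))"
    using k g by (intro nn_integral_Beta) auto
  finally show ?thesis
    using half_sphere_area_pos[of "DIM('a)"] by (simp add: ennreal_mult'[symmetric])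
qed

lemma nn_integral_ball_weight:
  assumes g: "g > -1"
  shows "(\<integral>\<^sup>+y. ennreal (ball_weight g y) \<partial>(lborel :: 'a::euclidean_space measure)) =
    ennreal (half_sphere_area DIM('a) * Beta (real DIM('a) / 2) (g + 1))"
proof -
  have "(\<integral>\<^sup>+y. ennreal (ball_weight g y) \<partial>(lborel :: 'a measure)) = (\<integral>\<^sup>+y. ennreal ((norm y)\<^sup>2 powr 0 * ball_weight g y) \<partial>(lborel :: 'a measure))"
    by (rule nn_integral_cong_nonzero) auto
  also have "\<dots> = ennreal (half_sphere_area DIM('a) * Beta (real DIM('a) / 2 + 0) (g + 1))"
    by (rule nn_integral_ball_weight_moment) (use g in auto)
  finally show ?thesis by simp
qed

lemma Gamma_3_real: "Gamma (3 :: real) = 2"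
  using Gamma_fact[of 2, where 'a=real] by (simp add: numeral_eq_Suc)

lemma Gamma_2_real: "Gamma (2 :: real) = 1"
  using Gamma_fact[of 1, where 'a=real] by (simp add: numeral_eq_Suc)

lemma Beta_real_nonneg: "a > 0 \<Longrightarrow> b > 0 \<Longrightarrow> Beta a b \<ge> 0" for a b :: real
  by (simp add: Beta_def)

lemma Beta_complement_2: "Beta (2 - h) h = Gamma (2 - h) * Gamma h" for h :: real
  by (simp add: Beta_def Gamma_2_real)

lemma Beta_complement_3: "Beta (2 - h) (1 + h) = h / 2 * (Gamma (2 - h) * Gamma h)" if "h > 0" for h :: real
proof -
  have "h \<notin> \<int>\<^sub>\<le>\<^sub>0" using that by (auto dest: nonpos_Ints_nonpos)
  then have "Gamma (1 + h) = h * Gamma h" using Gamma_plus1[of h] by (simp add: add.commute)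
  then show ?thesis by (simp add: Beta_def Gamma_3_real)
qed

text \<open>
  The power of the point \<open>x\<close> with respect to the unit sphere is \<open>c\<close>.  If \<open>c > 0\<close>, the inversion with
  centre \<open>x\<close> and constant \<open>c\<close> maps the sphere and its inside to themselves; if \<open>c < 0\<close>, it maps the
  sphere to itself and exchanges inside and outside.
\<close>

lemma norm_inversion:
  fixes x z :: "'a::real_inner"
  assumes z: "z \<noteq> 0" and c: "c = (norm x)\<^sup>2 - 1"
  shows "1 - (norm (x + (c / (norm z)\<^sup>2) *\<^sub>R z))\<^sup>2 = c / (norm z)\<^sup>2 * (1 - (norm (x + z))\<^sup>2)"
proof -
  have nz: "(norm z)\<^sup>2 \<noteq> 0" using z by simp
  have 1: "(norm (x + s *\<^sub>R z))\<^sup>2 = (norm x)\<^sup>2 + 2 * s * (x \<bullet> z) + s\<^sup>2 * (norm z)\<^sup>2" for s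
    unfolding power2_norm_eq_inner by (simp add: inner_add inner_commute power2_eq_square algebra_simps)
  have "1 - (norm (x + (c / (norm z)\<^sup>2) *\<^sub>R z))\<^sup>2 = - c - 2 * (c / (norm z)\<^sup>2) * (x \<bullet> z) - c * c / (norm z)\<^sup>2"
    unfolding 1 using nz by (simp add: c power2_eq_square)
  also have "\<dots> = c / (norm z)\<^sup>2 * (1 - (norm (x + 1 *\<^sub>R z))\<^sup>2)"
    unfolding 1 using nz by (simp add: c field_simps)
  finally show ?thesis by simp
qed

lemma inverse_power_eq_powr: "t > 0 \<Longrightarrow> 1 / t ^ n = t powr (- real n)"
  by (simp add: powr_minus powr_realpow inverse_eq_divide)

text \<open>
  The inversion centred at \<open>x\<close> carries the ball to its complement.  The exponent \<open>g\<close> is the one for which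
  the Jacobian, the kernel and the weight leave the power \<open>- DIM('a) - 2\<close> of the distance to \<open>x\<close>, whose
  spherical means are known.  Two Beta integrals remain, which combine to an affine function of
  \<open>(norm x)\<^sup>2\<close>.
\<close>

lemma nn_integral_inside_profile:
  fixes x :: "'a::euclidean_space" and \<beta> :: real
  assumes \<beta>: "- real DIM('a) < \<beta>" "\<beta> < 4 - real DIM('a)" and x: "norm x < 1"
  defines "g \<equiv> (2 - \<beta> - real DIM('a)) / 2" and "h \<equiv> (\<beta> + real DIM('a)) / 2"
  shows "(\<integral>\<^sup>+y. ennreal (norm (x - y) powr \<beta> * ball_weight g y) \<partial>lborel) =
    ennreal (half_sphere_area DIM('a) * (Gamma (2 - h) * Gamma h) * (1 + \<beta> / real DIM('a) * (norm x)\<^sup>2))"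
proof -
  let ?d = "real DIM('a)"
  \<comment> \<open>The inversion has the negative constant \<open>- p\<close>, since \<open>x\<close> lies inside the sphere.\<close>
  define p where "p = 1 - (norm x)\<^sup>2"
  have p: "p > 0" using x by (simp add: p_def norm_less_1_iff)
  have g: "g > -1" "g < 1" and h: "h > 0" "h < 2" and gh: "g = 1 - h" and \<beta>h: "\<beta> = 2 * h - ?d"
    using \<beta> by (auto simp: g_def h_def field_simps)
  define f where "f t = ennreal (if 1 < t then (t - 1) powr g else 0)" for t :: real
  have [measurable]: "f \<in> borel_measurable borel" unfolding f_def by measurable
  define G where "G z = ennreal (norm z powr \<beta> * ball_weight g (x + z))" for z
  have [measurable]: "G \<in> borel_measurable borel" unfolding G_def by measurable
  have "(\<integral>\<^sup>+y. ennreal (norm (x - y) powr \<beta> * ball_weight g y) \<partial>lborel) = (\<integral>\<^sup>+z. G z \<partial>lborel)"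
    unfolding G_def by (subst nn_integral_shift[where x=x]) auto
  also have "\<dots> = (\<integral>\<^sup>+z. ennreal ((\<bar>- p\<bar> / (norm z)\<^sup>2) ^ DIM('a)) * G ((- p / (norm z)\<^sup>2) *\<^sub>R z) \<partial>lborel)"
    using p by (intro nn_integral_inversion) auto
  also have "\<dots> = (\<integral>\<^sup>+z. ennreal (p powr (1 + h)) * (f ((norm (x + z))\<^sup>2) * ennreal (1 / norm (x - (x + z)) ^ (DIM('a) + 2)) * indicator {(norm x)\<^sup>2<..} ((norm (x + z))\<^sup>2)) \<partial>lborel)"
    (is "integral\<^sup>N _ ?F = integral\<^sup>N _ ?G")
  proof (rule nn_integral_cong_nonzero)
    fix z :: 'a assume z: "z \<noteq> 0"
    define n where "n = norm z"
    have n: "n > 0" using z by (simp add: n_def)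
    define m where "m = (norm (x + z))\<^sup>2"
    have inv: "1 - (norm (x + (- p / (norm z)\<^sup>2) *\<^sub>R z))\<^sup>2 = p / n\<^sup>2 * (m - 1)"
      using norm_inversion[OF z, of "- p" x] by (simp add: p_def n_def m_def algebra_simps)
    show "?F z = ?G z"
    proof (cases "m > 1")
      case True
      have "p / n\<^sup>2 * (m - 1) > 0" using True p n by simp
      then have w: "ball_weight g (x + (- p / (norm z)\<^sup>2) *\<^sub>R z) = (p / n\<^sup>2 * (m - 1)) powr g"
        using inv unfolding ball_weight_eq by auto
      have nz: "norm ((- p / (norm z)\<^sup>2) *\<^sub>R z) = p / n"
        using p n by (simp add: n_def power2_eq_square)
      have "(p / n\<^sup>2) ^ DIM('a) * ((p / n) powr \<beta> * (p / n\<^sup>2 * (m - 1)) powr g)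
         = (p / n\<^sup>2) powr ?d * ((p / n) powr \<beta> * ((p / n\<^sup>2) powr g * (m - 1) powr g))"
        using p n True by (subst powr_mult) (auto simp: powr_realpow)
      also have "\<dots> = p powr (?d + \<beta> + g) * n powr (- (2 * ?d + \<beta> + 2 * g)) * (m - 1) powr g"
      proof -
        have n2: "n\<^sup>2 powr s = n powr (2 * s)" for s
          using n by (simp add: powr_powr powr_numeral[symmetric] del: powr_numeral)
        have "n powr (- (2 * ?d + \<beta> + 2 * g)) = 1 / (n powr (2 * ?d) * n powr \<beta> * n powr (2 * g))"
          by (subst powr_minus) (simp add: powr_add inverse_eq_divide)
        then show ?thesis
          using p n True by (simp add: powr_divide n2 powr_add)
      qed
      \<comment> \<open>The choice of \<open>g\<close> reduces the exponent of \<open>n\<close> to an integer.\<close>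
      also have "?d + \<beta> + g = 1 + h" by (simp add: gh \<beta>h)
      also have "- (2 * ?d + \<beta> + 2 * g) = - real (DIM('a) + 2)" by (simp add: gh \<beta>h)
      also have "n powr - real (DIM('a) + 2) = 1 / n ^ (DIM('a) + 2)"
        using n by (rule inverse_power_eq_powr[symmetric])
      finally have eqn: "(p / n\<^sup>2) ^ DIM('a) * ((p / n) powr \<beta> * (p / n\<^sup>2 * (m - 1)) powr g) = p powr (1 + h) * ((m - 1) powr g * (1 / n ^ (DIM('a) + 2)))"
        by (simp only: mult_ac)
      then have *: "ennreal ((p / n\<^sup>2) ^ DIM('a)) * ennreal ((p / n) powr \<beta> * (p / n\<^sup>2 * (m - 1)) powr g) = ennreal (p powr (1 + h)) * (ennreal ((m - 1) powr g) * ennreal (1 / n ^ (DIM('a) + 2)))"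
      proof -
        have "ennreal ((p / n\<^sup>2) ^ DIM('a)) * ennreal ((p / n) powr \<beta> * (p / n\<^sup>2 * (m - 1)) powr g) = ennreal (p powr (1 + h) * ((m - 1) powr g * (1 / n ^ (DIM('a) + 2))))"
          using p n by (intro ennreal_mult_eqI eqn) auto
        also have "\<dots> = ennreal (p powr (1 + h)) * (ennreal ((m - 1) powr g) * ennreal (1 / n ^ (DIM('a) + 2)))"
          using n by (subst ennreal_mult, simp, simp, subst ennreal_mult) auto
        finally show ?thesis .
      qed
      have "(norm x)\<^sup>2 < m" using True p by (simp add: p_def)
      then show ?thesis using True p * unfolding G_def w nz f_def m_def[symmetric] by (simp add: n_def)
    next
      case False
      have "p / n\<^sup>2 * (m - 1) \<le> 0" using False p n by (intro mult_nonneg_nonpos) auto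
      then have w: "ball_weight g (x + (- p / (norm z)\<^sup>2) *\<^sub>R z) = 0"
        using inv unfolding ball_weight_eq by auto
      then show ?thesis using False unfolding G_def w f_def m_def[symmetric] by simp
    qed
  qed
  also have "\<dots> = ennreal (p powr (1 + h)) * (\<integral>\<^sup>+z. f ((norm (x + z))\<^sup>2) * ennreal (1 / norm (x - (x + z)) ^ (DIM('a) + 2)) * indicator {(norm x)\<^sup>2<..} ((norm (x + z))\<^sup>2) \<partial>lborel)"
    by (rule nn_integral_cmult) measurable
  also have "(\<integral>\<^sup>+z. f ((norm (x + z))\<^sup>2) * ennreal (1 / norm (x - (x + z)) ^ (DIM('a) + 2)) * indicator {(norm x)\<^sup>2<..} ((norm (x + z))\<^sup>2) \<partial>lborel)
     = (\<integral>\<^sup>+y. f ((norm y)\<^sup>2) * ennreal (1 / norm (x - y) ^ (DIM('a) + 2)) * indicator {(norm x)\<^sup>2<..} ((norm y)\<^sup>2) \<partial>lborel)"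
    by (rule nn_integral_shift[symmetric]) measurable
  also have "\<dots> = ennreal (half_sphere_area DIM('a)) *
      (\<integral>\<^sup>+u\<in>{0<..}. f ((norm x)\<^sup>2 + u) * ennreal (1 / u\<^sup>2 + 4 * (norm x)\<^sup>2 / ?d / u ^ 3) \<partial>lborel)"
    by (rule nn_integral_poisson_outside_2) measurable
  also have "(\<integral>\<^sup>+u\<in>{0<..}. f ((norm x)\<^sup>2 + u) * ennreal (1 / u\<^sup>2 + 4 * (norm x)\<^sup>2 / ?d / u ^ 3) \<partial>lborel)
     = (\<integral>\<^sup>+s. f ((norm x)\<^sup>2 + (p + 1 * s)) * ennreal (1 / (p + 1 * s)\<^sup>2 + 4 * (norm x)\<^sup>2 / ?d / (p + 1 * s) ^ 3) * indicator {0<..} (p + 1 * s) \<partial>lborel)"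
    by (subst nn_integral_real_affine[where c=1 and t=p]) auto
  also have "\<dots> = (\<integral>\<^sup>+s. ennreal (s powr g * (s + p) powr (- 2)) * indicator {0<..} s + ennreal (4 * (norm x)\<^sup>2 / ?d) * (ennreal (s powr g * (s + p) powr (- 3)) * indicator {0<..} s) \<partial>lborel)"
    (is "integral\<^sup>N _ ?F = integral\<^sup>N _ ?G")
  proof (intro nn_integral_cong)
    fix s :: real
    show "?F s = ?G s"
    proof (cases "s > 0")
      case True
      have "1 / (p + s)\<^sup>2 = (s + p) powr (-2)" "1 / (p + s) ^ 3 = (s + p) powr (-3)"
        using True p inverse_power_eq_powr[of "p + s" 2] inverse_power_eq_powr[of "p + s" 3] by (auto simp: add.commute)
      then have "s powr g * (1 / (p + s)\<^sup>2 + 4 * (norm x)\<^sup>2 / ?d / (p + s) ^ 3) = s powr g * (s + p) powr (- 2) + 4 * (norm x)\<^sup>2 / ?d * (s powr g * (s + p) powr (- 3))"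
        by (simp add: algebra_simps divide_inverse)
      then have "ennreal (s powr g) * ennreal (1 / (p + s)\<^sup>2 + 4 * (norm x)\<^sup>2 / ?d / (p + s) ^ 3) = ennreal (s powr g * (s + p) powr (- 2)) + ennreal (4 * (norm x)\<^sup>2 / ?d) * ennreal (s powr g * (s + p) powr (- 3))"
        using True p by (subst ennreal_mult_eqI[OF _ _ refl]) (auto simp: ennreal_plus[symmetric] ennreal_mult[symmetric] simp del: ennreal_plus)
      then show ?thesis using True p by (simp add: f_def p_def)
    qed (auto simp: f_def p_def)
  qed
  also have "\<dots> = ennreal (Beta (g + 1) (2 - g - 1) * p powr (g + 1 - 2)) + ennreal (4 * (norm x)\<^sup>2 / ?d) * ennreal (Beta (g + 1) (3 - g - 1) * p powr (g + 1 - 3))"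
    using g p by (subst nn_integral_add, measurable, subst nn_integral_cmult, measurable)
      (subst (1 2) nn_integral_Beta_prime, auto)
  also have "Beta (g + 1) (2 - g - 1) = Gamma (2 - h) * Gamma h"
    by (simp add: gh Beta_complement_2[symmetric])
  also have "Beta (g + 1) (3 - g - 1) = h / 2 * (Gamma (2 - h) * Gamma h)"
  proof -
    have e: "g + 1 = 2 - h" "3 - g - 1 = 1 + h" by (simp_all add: gh)
    show ?thesis unfolding e by (rule Beta_complement_3[OF h(1)])
  qed
  finally have "(\<integral>\<^sup>+y. ennreal (norm (x - y) powr \<beta> * ball_weight g y) \<partial>lborel) =
    ennreal (p powr (1 + h)) * (ennreal (half_sphere_area DIM('a)) * (ennreal (Gamma (2 - h) * Gamma h * p powr (g + 1 - 2)) +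
       ennreal (4 * (norm x)\<^sup>2 / ?d) * ennreal (h / 2 * (Gamma (2 - h) * Gamma h) * p powr (g + 1 - 3))))" .
  also have "\<dots> = ennreal (p powr (1 + h) * (half_sphere_area DIM('a) * (Gamma (2 - h) * Gamma h * p powr (g + 1 - 2) +
       4 * (norm x)\<^sup>2 / ?d * (h / 2 * (Gamma (2 - h) * Gamma h) * p powr (g + 1 - 3)))))"
    using h half_sphere_area_pos[of "DIM('a)"] by (simp add: ennreal_mult[symmetric] ennreal_plus[symmetric] del: ennreal_plus)
  also have "p powr (1 + h) * (half_sphere_area DIM('a) * (Gamma (2 - h) * Gamma h * p powr (g + 1 - 2) +
       4 * (norm x)\<^sup>2 / ?d * (h / 2 * (Gamma (2 - h) * Gamma h) * p powr (g + 1 - 3))))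
     = half_sphere_area DIM('a) * (Gamma (2 - h) * Gamma h) * (p powr (1 + h) * p powr (g + 1 - 2) + 2 * h * (norm x)\<^sup>2 / ?d * (p powr (1 + h) * p powr (g + 1 - 3)))"
    by (simp add: algebra_simps)
  also have "p powr (1 + h) * p powr (g + 1 - 2) = p"
    using p by (simp add: powr_add[symmetric] gh)
  also have "p powr (1 + h) * p powr (g + 1 - 3) = 1"
    using p by (simp add: powr_add[symmetric] gh)
  also have "p + 2 * h * (norm x)\<^sup>2 / ?d * 1 = 1 + \<beta> / ?d * (norm x)\<^sup>2"
    by (simp add: p_def \<beta>h field_simps)
  finally show ?thesis .
qed

text \<open>
  Substituting \<open>t = T * s\<close> gives a Beta integral; the condition \<open>a + 2 * g = 2\<close> makes the power of
  \<open>\<bar>T\<bar>\<close> in front of it equal to two.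
\<close>

lemma nn_integral_boundary_line:
  fixes T c a g :: real
  assumes c: "c > 0" and a: "a + g > 0" "a + 2 * g = 2" "g > -1"
  shows "(\<integral>\<^sup>+t. ennreal (\<bar>t\<bar> powr (a - 1) * (if t * (T - t) > 0 then (c * (t * (T - t))) powr g else 0)) \<partial>lborel) =
    ennreal (T\<^sup>2 * c powr g * Beta (a + g) (g + 1))"
proof (cases "T = 0")
  case True
  have "\<not> t * (T - t) > 0" for t using True by (simp add: not_less)
  then show ?thesis using True by simp
next
  case False
  have "(\<integral>\<^sup>+t. ennreal (\<bar>t\<bar> powr (a - 1) * (if t * (T - t) > 0 then (c * (t * (T - t))) powr g else 0)) \<partial>lborel)
    = ennreal \<bar>T\<bar> * (\<integral>\<^sup>+s. ennreal (\<bar>0 + T * s\<bar> powr (a - 1) * (if (0 + T * s) * (T - (0 + T * s)) > 0 then (c * ((0 + T * s) * (T - (0 + T * s)))) powr g else 0)) \<partial>lborel)"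
    using False by (intro nn_integral_real_affine) auto
  also have "\<dots> = ennreal \<bar>T\<bar> * (\<integral>\<^sup>+s. ennreal (\<bar>T\<bar> powr (a - 1 + 2 * g) * c powr g) * (ennreal (s powr ((a + g) - 1) * (1 - s) powr ((g + 1) - 1)) * indicator {0<..<1} s) \<partial>lborel)"
  proof (intro arg_cong2[where f="(*)"] refl nn_integral_cong)
    fix s :: real
    have eq: "(0 + T * s) * (T - (0 + T * s)) = T\<^sup>2 * (s * (1 - s))" by (simp add: power2_eq_square algebra_simps)
    show "ennreal (\<bar>0 + T * s\<bar> powr (a - 1) * (if (0 + T * s) * (T - (0 + T * s)) > 0 then (c * ((0 + T * s) * (T - (0 + T * s)))) powr g else 0))
      = ennreal (\<bar>T\<bar> powr (a - 1 + 2 * g) * c powr g) * (ennreal (s powr ((a + g) - 1) * (1 - s) powr ((g + 1) - 1)) * indicator {0<..<1} s)"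
    proof (cases "0 < s \<and> s < 1")
      case True
      have T2: "T\<^sup>2 powr g = \<bar>T\<bar> powr (2 * g)"
        using False by (subst power2_abs[symmetric]) (simp add: powr_powr powr_numeral[symmetric] del: powr_numeral power2_abs)
      have "\<bar>T * s\<bar> powr (a - 1) * (c * (T\<^sup>2 * (s * (1 - s)))) powr g = \<bar>T\<bar> powr (a - 1) * s powr (a - 1) * (c powr g * (\<bar>T\<bar> powr (2 * g) * (s powr g * (1 - s) powr g)))"
        using True c by (simp add: powr_mult abs_mult T2)
      also have "\<dots> = \<bar>T\<bar> powr (a - 1 + 2 * g) * c powr g * (s powr ((a + g) - 1) * (1 - s) powr ((g + 1) - 1))"
        using True False by (simp add: powr_add powr_diff)
      finally show ?thesis
        unfolding eq using True False by (simp add: ennreal_mult[symmetric])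
    next
      case out: False
      then have "\<not> s * (1 - s) > 0" by (auto simp: zero_less_mult_iff)
      then have "\<not> T\<^sup>2 * (s * (1 - s)) > 0" by (simp add: zero_less_mult_iff)
      then show ?thesis unfolding eq using out by auto
    qed
  qed
  also have "\<dots> = ennreal \<bar>T\<bar> * (ennreal (\<bar>T\<bar> powr (a - 1 + 2 * g) * c powr g) * ennreal (Beta (a + g) (g + 1)))"
    using a by (subst nn_integral_cmult, measurable, subst nn_integral_Beta) auto
  also have "\<dots> = ennreal (\<bar>T\<bar> * (\<bar>T\<bar> powr (a - 1 + 2 * g) * c powr g * Beta (a + g) (g + 1)))"
  proof -
    have "Beta (a + g) (g + 1) \<ge> 0" using a by (intro Beta_real_nonneg) auto
    then show ?thesis by (simp add: ennreal_mult[symmetric])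
  qed
  also have "\<bar>T\<bar> * (\<bar>T\<bar> powr (a - 1 + 2 * g) * c powr g * Beta (a + g) (g + 1)) = T\<^sup>2 * c powr g * Beta (a + g) (g + 1)"
  proof -
    have e: "a - 1 + 2 * g = 1" using a by simp
    show ?thesis unfolding e using False by (simp add: power2_eq_square)
  qed
  finally show ?thesis .
qed

text \<open>
  At a boundary point the inversion degenerates.  Here every line through \<open>x\<close> meets the ball in a chord
  with one endpoint at \<open>x\<close>, along which the integrand is a multiple of a Beta density, so that polar coordinates
  around \<open>x\<close> suffice.
\<close>

lemma nn_integral_boundary_profile:
  fixes x :: "'a::euclidean_space" and \<beta> :: real
  assumes \<beta>: "- real DIM('a) < \<beta>" "\<beta> < 4 - real DIM('a)" and x: "norm x = 1"
  defines "g \<equiv> (2 - \<beta> - real DIM('a)) / 2" and "h \<equiv> (\<beta> + real DIM('a)) / 2"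
  shows "(\<integral>\<^sup>+y. ennreal (norm (x - y) powr \<beta> * ball_weight g y) \<partial>lborel) =
    ennreal (half_sphere_area DIM('a) * (Gamma (2 - h) * Gamma h) * (1 + \<beta> / real DIM('a) * (norm x)\<^sup>2))"
proof (rule ennreal_2_cancel)
  let ?d = "real DIM('a)"
  let ?s = "half_sphere_area DIM('a)"
  have s: "?s > 0" using half_sphere_area_pos[of "DIM('a)"] by simp
  have g: "g > -1" "g < 1" and h: "h > 0" "h < 2" and gh: "g = 1 - h" and \<beta>h: "\<beta> = 2 * h - ?d"
    using \<beta> by (auto simp: g_def h_def field_simps)
  define G where "G z = ennreal (norm z powr \<beta> * ball_weight g (x + z))" for z
  have [measurable]: "G \<in> borel_measurable borel" unfolding G_def by measurable
  define B where "B = Beta (1 + h) (2 - h)"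
  have B: "B \<ge> 0" unfolding B_def using h by (intro Beta_real_nonneg) auto
  have "2 * (\<integral>\<^sup>+y. ennreal (norm (x - y) powr \<beta> * ball_weight g y) \<partial>lborel) = 2 * (\<integral>\<^sup>+z. G z \<partial>lborel)"
    unfolding G_def by (subst nn_integral_shift[where x=x]) auto
  also have "\<dots> = (\<integral>\<^sup>+z. ennreal (polar_weight z) * (\<integral>\<^sup>+t. ennreal (\<bar>t\<bar> ^ (DIM('a) - 1)) * G (t *\<^sub>R z) \<partial>lborel) \<partial>lborel)"
    by (rule nn_integral_along_lines) measurable
  also have "\<dots> = (\<integral>\<^sup>+z. ennreal (4 * B) * ennreal (polar_weight z / norm z ^ (DIM('a) + 2) * (x \<bullet> z)\<^sup>2) \<partial>lborel)"
  proof (rule nn_integral_cong_nonzero)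
    fix z :: 'a assume z: "z \<noteq> 0"
    define n where "n = norm z"
    have n: "n > 0" using z by (simp add: n_def)
    \<comment> \<open>The line \<open>t \<mapsto> x + t *\<^sub>R z\<close> leaves the ball at the parameters \<open>0\<close> and \<open>T\<close>.\<close>
    define T where "T = - 2 * (x \<bullet> z) / n\<^sup>2"
    have "(\<integral>\<^sup>+t. ennreal (\<bar>t\<bar> ^ (DIM('a) - 1)) * G (t *\<^sub>R z) \<partial>lborel)
      = (\<integral>\<^sup>+t. ennreal (n powr \<beta>) * ennreal (\<bar>t\<bar> powr (2 * h - 1) * (if t * (T - t) > 0 then (n\<^sup>2 * (t * (T - t))) powr g else 0)) \<partial>lborel)"
      (is "integral\<^sup>N _ ?f = integral\<^sup>N _ ?g")
    proof (rule nn_integral_cong_nonzero)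
      fix t :: real assume t: "t \<noteq> 0"
      have "(norm (x + t *\<^sub>R z))\<^sup>2 = (norm x)\<^sup>2 + 2 * t * (x \<bullet> z) + t\<^sup>2 * (norm z)\<^sup>2"
        unfolding power2_norm_eq_inner by (simp add: inner_add inner_commute power2_eq_square algebra_simps)
      then have 1: "1 - (norm (x + t *\<^sub>R z))\<^sup>2 = n\<^sup>2 * (t * (T - t))"
        using n x by (simp add: T_def n_def[symmetric] power2_eq_square field_simps)
      then have "(norm (x + t *\<^sub>R z))\<^sup>2 < 1 \<longleftrightarrow> n\<^sup>2 * (t * (T - t)) > 0" by linarith
      also have "\<dots> \<longleftrightarrow> t * (T - t) > 0" using n by (simp add: zero_less_mult_iff)
      finally have w: "ball_weight g (x + t *\<^sub>R z) = (if t * (T - t) > 0 then (n\<^sup>2 * (t * (T - t))) powr g else 0)"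
        unfolding ball_weight_eq 1 by simp
      have "\<bar>t\<bar> ^ (DIM('a) - 1) = \<bar>t\<bar> powr (?d - 1)"
        using t by (subst powr_realpow[symmetric]) (auto simp: of_nat_diff Suc_leI)
      moreover have "\<bar>t\<bar> powr (?d - 1) * (\<bar>t\<bar> powr \<beta>) = \<bar>t\<bar> powr (2 * h - 1)"
        by (simp add: powr_add[symmetric] \<beta>h)
      ultimately have "\<bar>t\<bar> ^ (DIM('a) - 1) * (norm (t *\<^sub>R z) powr \<beta> * ball_weight g (x + t *\<^sub>R z)) =
         n powr \<beta> * (\<bar>t\<bar> powr (2 * h - 1) * (if t * (T - t) > 0 then (n\<^sup>2 * (t * (T - t))) powr g else 0))"
        unfolding w by (simp add: n_def powr_mult mult_ac)
      then show "?f t = ?g t"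
        unfolding G_def by (subst (1 2) ennreal_mult[symmetric]) (auto simp del: norm_scaleR)
    qed
    also have "\<dots> = ennreal (n powr \<beta>) * ennreal (T\<^sup>2 * (n\<^sup>2) powr g * Beta (2 * h + g) (g + 1))"
      using n g h gh by (subst nn_integral_cmult, measurable, subst nn_integral_boundary_line) auto
    also have "\<dots> = ennreal (n powr \<beta> * (T\<^sup>2 * (n\<^sup>2) powr g * B))"
      using B by (subst ennreal_mult) (auto simp: B_def gh add.commute)
    also have "n powr \<beta> * (T\<^sup>2 * (n\<^sup>2) powr g * B) = 4 * B * (1 / n ^ (DIM('a) + 2) * (x \<bullet> z)\<^sup>2)"
    proof -
      have "n\<^sup>2 powr g = n powr (2 * g)" using n by (simp add: powr_powr powr_numeral[symmetric] del: powr_numeral)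
      moreover have "T\<^sup>2 = 4 * (x \<bullet> z)\<^sup>2 * n powr (-4)"
      proof -
        have "T\<^sup>2 = 4 * (x \<bullet> z)\<^sup>2 * (1 / n ^ 4)" by (simp add: T_def power_divide power_mult_distrib)
        also have "1 / n ^ 4 = n powr (-4)" using n inverse_power_eq_powr[of n 4] by simp
        finally show ?thesis .
      qed
      ultimately have "n powr \<beta> * (T\<^sup>2 * (n\<^sup>2) powr g * B) = 4 * B * ((n powr \<beta> * n powr (-4) * n powr (2 * g)) * (x \<bullet> z)\<^sup>2)"
        by (simp only: mult_ac)
      also have "n powr \<beta> * n powr (-4) * n powr (2 * g) = n powr (- real (DIM('a) + 2))"
        by (simp add: powr_add[symmetric] \<beta>h gh)
      also have "\<dots> = 1 / n ^ (DIM('a) + 2)" using n by (rule inverse_power_eq_powr[symmetric])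
      finally show ?thesis .
    qed
    finally have "ennreal (polar_weight z) * (\<integral>\<^sup>+t. ennreal (\<bar>t\<bar> ^ (DIM('a) - 1)) * G (t *\<^sub>R z) \<partial>lborel) =
       ennreal (polar_weight z * (4 * B * (1 / n ^ (DIM('a) + 2) * (x \<bullet> z)\<^sup>2)))"
      using B n by (subst ennreal_mult) auto
    also have "polar_weight z * (4 * B * (1 / n ^ (DIM('a) + 2) * (x \<bullet> z)\<^sup>2)) = 4 * B * (polar_weight z / norm z ^ (DIM('a) + 2) * (x \<bullet> z)\<^sup>2)"
      by (simp add: n_def)
    also have "ennreal \<dots> = ennreal (4 * B) * ennreal (polar_weight z / norm z ^ (DIM('a) + 2) * (x \<bullet> z)\<^sup>2)"
      using B by (subst ennreal_mult) (auto intro!: mult_nonneg_nonneg divide_nonneg_nonneg)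
    finally show "ennreal (polar_weight z) * (\<integral>\<^sup>+t. ennreal (\<bar>t\<bar> ^ (DIM('a) - 1)) * G (t *\<^sub>R z) \<partial>lborel) =
       ennreal (4 * B) * ennreal (polar_weight z / norm z ^ (DIM('a) + 2) * (x \<bullet> z)\<^sup>2)" .
  qed
  also have "\<dots> = ennreal (4 * B) * ennreal (2 / ?d * ?s * (norm x)\<^sup>2)"
    by (subst nn_integral_cmult) (measurable, simp only: polar_weight_second_moment)
  also have "\<dots> = ennreal (4 * B * (2 / ?d * ?s))"
    using B s x by (subst ennreal_mult[symmetric]) auto
  also have "B = h / 2 * (Gamma (2 - h) * Gamma h)"
    using Beta_complement_3[OF h(1)] by (simp add: B_def Beta_commute)
  also have "4 * (h / 2 * (Gamma (2 - h) * Gamma h)) * (2 / ?d * ?s) = 2 * (?s * (Gamma (2 - h) * Gamma h) * (1 + \<beta> / ?d * (norm x)\<^sup>2))"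
    using x by (simp add: \<beta>h field_simps)
  also have "ennreal \<dots> = 2 * ennreal (?s * (Gamma (2 - h) * Gamma h) * (1 + \<beta> / ?d * (norm x)\<^sup>2))"
  proof -
    have "1 + \<beta> / ?d * (norm x)\<^sup>2 \<ge> 0" using x h by (simp add: \<beta>h field_simps)
    then show ?thesis using s h by (subst ennreal_mult) auto
  qed
  finally show "2 * (\<integral>\<^sup>+y. ennreal (norm (x - y) powr \<beta> * ball_weight g y) \<partial>lborel) =
    2 * ennreal (?s * (Gamma (2 - h) * Gamma h) * (1 + \<beta> / ?d * (norm x)\<^sup>2))" .
qed

section \<open>The gradient of the potential outside the ball\<close>

lemma norm_diff_inversion:
  fixes x y :: "'a::real_inner"
  assumes y: "y \<noteq> 0"
  shows "norm (x - ((norm x)\<^sup>2 / (norm y)\<^sup>2) *\<^sub>R y) = norm x / norm y * norm (x - y)"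
proof (rule power2_eq_imp_eq)
  have nz: "(norm y)\<^sup>2 \<noteq> 0" using y by simp
  have 1: "(norm (x - s *\<^sub>R y))\<^sup>2 = (norm x)\<^sup>2 - 2 * s * (x \<bullet> y) + s\<^sup>2 * (norm y)\<^sup>2" for s
    unfolding power2_norm_eq_inner by (simp add: inner_diff inner_commute power2_eq_square algebra_simps)
  have "(norm x / norm y * norm (x - y))\<^sup>2 = (norm x)\<^sup>2 / (norm y)\<^sup>2 * (norm (x - 1 *\<^sub>R y))\<^sup>2"
    by (simp add: power_mult_distrib power_divide)
  then show "(norm (x - ((norm x)\<^sup>2 / (norm y)\<^sup>2) *\<^sub>R y))\<^sup>2 = (norm x / norm y * norm (x - y))\<^sup>2"
    unfolding 1 using nz by (simp add: field_simps power2_eq_square)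
qed simp_all

lemma nn_integral_inversion_interval:
  fixes f :: "real \<Rightarrow> ennreal" and R :: real
  assumes [measurable]: "f \<in> borel_measurable borel" and R: "R > 0"
  shows "(\<integral>\<^sup>+u\<in>{0<..}. f u \<partial>lborel) = (\<integral>\<^sup>+t\<in>{0<..<R}. ennreal (R\<^sup>2 / t\<^sup>2) * f (R\<^sup>2 / t - R) \<partial>lborel)"
proof -
  have im: "(\<lambda>t. R\<^sup>2 / t - R) ` {0<..<R} = {0<..}"
  proof (intro equalityI subsetI)
    fix u assume "u \<in> (\<lambda>t. R\<^sup>2 / t - R) ` {0<..<R}"
    then show "u \<in> {0<..}" using R by (auto simp: field_simps power2_eq_square)
  next
    fix u :: real assume "u \<in> {0<..}"
    then show "u \<in> (\<lambda>t. R\<^sup>2 / t - R) ` {0<..<R}"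
      using R by (intro image_eqI[of _ _ "R\<^sup>2 / (u + R)"]) (auto simp: field_simps power2_eq_square)
  qed
  have "(\<integral>\<^sup>+u\<in>{0<..}. f u \<partial>lborel) = (\<integral>\<^sup>+t\<in>{0<..<R}. ennreal \<bar>- (R\<^sup>2 / t\<^sup>2)\<bar> * f (R\<^sup>2 / t - R) \<partial>lborel)"
    using R by (subst im[symmetric], intro nn_integral_change_of_variables)
      (unfold im, auto simp: inj_on_def power2_eq_square intro!: derivative_eq_intros)
  then show ?thesis by simp
qed

text \<open>
  The inversion about the origin in the sphere through \<open>x\<close> fixes \<open>x\<close> and multiplies distances to \<open>x\<close> by
  \<open>norm x / norm y\<close>, so that it transports the spherical means outside that sphere to its inside.
\<close>

lemma nn_integral_kernel_inside_eq_outside: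
  fixes x :: "'a::euclidean_space" and f :: "real \<Rightarrow> ennreal"
  assumes [measurable]: "f \<in> borel_measurable borel" and x: "x \<noteq> 0"
  shows "(\<integral>\<^sup>+y. f ((norm y)\<^sup>2) * ennreal (1 / norm (x - y) ^ (DIM('a) + k)) * indicator {..<(norm x)\<^sup>2} ((norm y)\<^sup>2) \<partial>lborel)
    = (\<integral>\<^sup>+y. f ((norm x) ^ 4 / (norm y)\<^sup>2) * ennreal (((norm x)\<^sup>2 / (norm y)\<^sup>2) powr ((real DIM('a) - real k) / 2)) *
         ennreal (1 / norm (x - y) ^ (DIM('a) + k)) * indicator {(norm x)\<^sup>2<..} ((norm y)\<^sup>2) \<partial>lborel)"
proof -
  define r where "r = norm x"
  have r: "r > 0" using x by (simp add: r_def)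
  have "(\<integral>\<^sup>+y. f ((norm y)\<^sup>2) * ennreal (1 / norm (x - y) ^ (DIM('a) + k)) * indicator {..<r\<^sup>2} ((norm y)\<^sup>2) \<partial>lborel)
    = (\<integral>\<^sup>+y. ennreal ((\<bar>r\<^sup>2\<bar> / (norm y)\<^sup>2) ^ DIM('a)) * (f ((norm ((r\<^sup>2 / (norm y)\<^sup>2) *\<^sub>R y))\<^sup>2) * ennreal (1 / norm (x - (r\<^sup>2 / (norm y)\<^sup>2) *\<^sub>R y) ^ (DIM('a) + k)) * indicator {..<r\<^sup>2} ((norm ((r\<^sup>2 / (norm y)\<^sup>2) *\<^sub>R y))\<^sup>2)) \<partial>lborel)"
    using r by (intro nn_integral_inversion) auto
  also have "\<dots> = (\<integral>\<^sup>+y. f (r ^ 4 / (norm y)\<^sup>2) * ennreal ((r\<^sup>2 / (norm y)\<^sup>2) powr ((real DIM('a) - real k) / 2)) *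
         ennreal (1 / norm (x - y) ^ (DIM('a) + k)) * indicator {r\<^sup>2<..} ((norm y)\<^sup>2) \<partial>lborel)"
    (is "integral\<^sup>N _ ?F = integral\<^sup>N _ ?G")
  proof (rule nn_integral_cong_AE, rule AE_mp[OF AE_lborel_singleton[of 0]], rule AE_mp[OF AE_lborel_singleton[of x]], rule AE_I2, intro impI)
    fix y :: 'a assume y: "y \<noteq> 0" and "y \<noteq> x"
    define n where "n = norm y"
    define m where "m = norm (x - y)"
    have n: "n > 0" and m: "m > 0" using y \<open>y \<noteq> x\<close> by (auto simp: n_def m_def)
    have 1: "(norm ((r\<^sup>2 / n\<^sup>2) *\<^sub>R y))\<^sup>2 = r ^ 4 / n\<^sup>2"
      using n by (simp add: n_def[symmetric] power_mult_distrib power_divide) (simp add: power2_eq_square power4_eq_xxxx field_simps)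
    have 2: "norm (x - (r\<^sup>2 / n\<^sup>2) *\<^sub>R y) = r / n * m"
      unfolding r_def n_def m_def by (rule norm_diff_inversion[OF y])
    have "r ^ 4 / n\<^sup>2 < r\<^sup>2 \<longleftrightarrow> r\<^sup>2 * r\<^sup>2 < r\<^sup>2 * n\<^sup>2"
      using n by (simp add: field_simps power2_eq_square power4_eq_xxxx)
    also have "\<dots> \<longleftrightarrow> r\<^sup>2 < n\<^sup>2" using r by (intro mult_less_cancel_left_pos) simp
    finally have 3: "indicator {..<r\<^sup>2} (r ^ 4 / n\<^sup>2) = (indicator {r\<^sup>2<..} (n\<^sup>2) :: ennreal)"
      by (auto simp: indicator_def)
    have "r\<^sup>2 / n\<^sup>2 = (r / n) powr 2" using r n by (simp add: power_divide)
    then have pw: "(r\<^sup>2 / n\<^sup>2) powr s = (r / n) powr (2 * s)" for s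
      by (simp only: powr_powr)
    have "(\<bar>r\<^sup>2\<bar> / n\<^sup>2) ^ DIM('a) * (1 / (r / n * m) ^ (DIM('a) + k)) = (r / n) powr (2 * real DIM('a)) * (r / n) powr (- real (DIM('a) + k)) * (1 / m ^ (DIM('a) + k))"
    proof -
      have "1 / (r / n * m) ^ (DIM('a) + k) = 1 / (r / n) ^ (DIM('a) + k) * (1 / m ^ (DIM('a) + k))"
        by (simp only: power_mult_distrib times_divide_times_eq mult_1)
      also have "1 / (r / n) ^ (DIM('a) + k) = (r / n) powr (- real (DIM('a) + k))"
        using r n by (intro inverse_power_eq_powr) simp
      finally have 1: "1 / (r / n * m) ^ (DIM('a) + k) = (r / n) powr (- real (DIM('a) + k)) * (1 / m ^ (DIM('a) + k))" .
      have "(\<bar>r\<^sup>2\<bar> / n\<^sup>2) ^ DIM('a) = (r / n) powr (2 * real DIM('a))"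
        using r n pw[of "real DIM('a)"] by (simp add: powr_realpow)
      then show ?thesis unfolding 1 by (simp only: mult.assoc)
    qed
    also have "\<dots> = (r\<^sup>2 / n\<^sup>2) powr ((real DIM('a) - real k) / 2) * (1 / m ^ (DIM('a) + k))"
    proof -
      have "2 * real DIM('a) + - real (DIM('a) + k) = 2 * ((real DIM('a) - real k) / 2)" by simp
      then show ?thesis unfolding pw by (simp only: powr_add[symmetric])
    qed
    finally have "ennreal ((\<bar>r\<^sup>2\<bar> / n\<^sup>2) ^ DIM('a)) * ennreal (1 / (r / n * m) ^ (DIM('a) + k)) = ennreal ((r\<^sup>2 / n\<^sup>2) powr ((real DIM('a) - real k) / 2)) * ennreal (1 / m ^ (DIM('a) + k))"
      using r n m by (subst (1 2) ennreal_mult[symmetric]) auto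
    from arg_cong[OF this, of "\<lambda>w. w * (f (r ^ 4 / n\<^sup>2) * indicator {r\<^sup>2<..} (n\<^sup>2))"]
    show "?F y = ?G y"
      unfolding n_def[symmetric] 1 2 3 m_def[symmetric] by (simp only: mult_ac)
  qed
  finally show ?thesis by (simp only: r_def)
qed

lemma nn_integral_poisson_inside:
  fixes x :: "'a::euclidean_space" and f :: "real \<Rightarrow> ennreal"
  assumes [measurable]: "f \<in> borel_measurable borel" and x: "x \<noteq> 0"
  shows "(\<integral>\<^sup>+y. f ((norm y)\<^sup>2) * ennreal (1 / norm (x - y) ^ DIM('a)) * indicator {..<(norm x)\<^sup>2} ((norm y)\<^sup>2) \<partial>lborel)
    = ennreal (half_sphere_area DIM('a)) *
      (\<integral>\<^sup>+t\<in>{0<..<(norm x)\<^sup>2}. f t * ennreal ((t / (norm x)\<^sup>2) powr (real DIM('a) / 2 - 1) / ((norm x)\<^sup>2 - t)) \<partial>lborel)"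
proof -
  define R where "R = (norm x)\<^sup>2"
  have R: "R > 0" using x by (simp add: R_def)
  have R2: "norm x ^ 4 = R\<^sup>2" by (simp add: R_def power_mult[symmetric])
  define F where "F s = f (R\<^sup>2 / s) * ennreal ((R / s) powr (real DIM('a) / 2))" for s
  have [measurable]: "F \<in> borel_measurable borel" unfolding F_def by measurable
  have "(\<integral>\<^sup>+y. f ((norm y)\<^sup>2) * ennreal (1 / norm (x - y) ^ DIM('a)) * indicator {..<(norm x)\<^sup>2} ((norm y)\<^sup>2) \<partial>lborel)
    = (\<integral>\<^sup>+y. F ((norm y)\<^sup>2) * ennreal (1 / norm (x - y) ^ DIM('a)) * indicator {(norm x)\<^sup>2<..} ((norm y)\<^sup>2) \<partial>lborel)"
    using nn_integral_kernel_inside_eq_outside[OF assms, of 0] unfolding R2 R_def[symmetric] F_def by simp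
  also have "\<dots> = ennreal (half_sphere_area DIM('a)) * (\<integral>\<^sup>+u\<in>{0<..}. F (R + u) * ennreal (1 / u) \<partial>lborel)"
    unfolding R_def by (rule nn_integral_poisson_outside) measurable
  also have "(\<integral>\<^sup>+u\<in>{0<..}. F (R + u) * ennreal (1 / u) \<partial>lborel) = (\<integral>\<^sup>+t\<in>{0<..<R}. ennreal (R\<^sup>2 / t\<^sup>2) * (F (R + (R\<^sup>2 / t - R)) * ennreal (1 / (R\<^sup>2 / t - R))) \<partial>lborel)"
    using R by (intro nn_integral_inversion_interval) auto
  also have "\<dots> = (\<integral>\<^sup>+t\<in>{0<..<R}. f t * ennreal ((t / R) powr (real DIM('a) / 2 - 1) / (R - t)) \<partial>lborel)"
    (is "integral\<^sup>N _ ?F = integral\<^sup>N _ ?G")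
  proof (intro nn_integral_cong)
    fix t :: real
    show "?F t = ?G t"
    proof (cases "0 < t \<and> t < R")
      case True
      have "R\<^sup>2 / (R + (R\<^sup>2 / t - R)) = t" "R / (R + (R\<^sup>2 / t - R)) = t / R"
        using True by (simp_all add: power2_eq_square)
      then have FR: "F (R + (R\<^sup>2 / t - R)) = f t * ennreal ((t / R) powr (real DIM('a) / 2))" unfolding F_def by (simp only:)
      have 1: "R\<^sup>2 / t - R = R * (R - t) / t"
        using True by (simp add: power2_eq_square field_simps)
      have "R\<^sup>2 / t\<^sup>2 * ((t / R) powr (real DIM('a) / 2) * (1 / (R * (R - t) / t))) = (t / R) powr (real DIM('a) / 2) / (t / R) / (R - t)"
        using True by (simp add: power2_eq_square)
      also have "(t / R) powr (real DIM('a) / 2) / (t / R) = (t / R) powr (real DIM('a) / 2 - 1)"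
        using True by (simp add: powr_diff)
      finally have "ennreal (R\<^sup>2 / t\<^sup>2) * (ennreal ((t / R) powr (real DIM('a) / 2)) * ennreal (1 / (R * (R - t) / t))) = ennreal ((t / R) powr (real DIM('a) / 2 - 1) / (R - t))"
        using True by (intro ennreal_mult3_eqI) auto
      from arg_cong[OF this, of "\<lambda>w. f t * w"] show ?thesis
        using True unfolding FR unfolding 1 by (simp add: mult_ac)
    qed auto
  qed
  finally show ?thesis by (simp add: R_def)
qed

lemma nn_integral_poisson_inside_2:
  fixes x :: "'a::euclidean_space" and f :: "real \<Rightarrow> ennreal"
  assumes [measurable]: "f \<in> borel_measurable borel" and x: "x \<noteq> 0"
  shows "(\<integral>\<^sup>+y. f ((norm y)\<^sup>2) * ennreal (1 / norm (x - y) ^ (DIM('a) + 2)) * indicator {..<(norm x)\<^sup>2} ((norm y)\<^sup>2) \<partial>lborel)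
    = ennreal (half_sphere_area DIM('a)) *
      (\<integral>\<^sup>+t\<in>{0<..<(norm x)\<^sup>2}. f t * ennreal ((t / (norm x)\<^sup>2) powr (real DIM('a) / 2 - 1) *
         (1 / ((norm x)\<^sup>2 - t)\<^sup>2 + 4 * t / real DIM('a) / ((norm x)\<^sup>2 - t) ^ 3)) \<partial>lborel)"
proof -
  let ?d = "real DIM('a)"
  define R where "R = (norm x)\<^sup>2"
  have R: "R > 0" using x by (simp add: R_def)
  have R2: "norm x ^ 4 = R\<^sup>2" by (simp add: R_def power_mult[symmetric])
  define F where "F s = f (R\<^sup>2 / s) * ennreal ((R / s) powr (?d / 2 - 1))" for s
  have [measurable]: "F \<in> borel_measurable borel" unfolding F_def by measurable
  have "(\<integral>\<^sup>+y. f ((norm y)\<^sup>2) * ennreal (1 / norm (x - y) ^ (DIM('a) + 2)) * indicator {..<(norm x)\<^sup>2} ((norm y)\<^sup>2) \<partial>lborel)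
    = (\<integral>\<^sup>+y. F ((norm y)\<^sup>2) * ennreal (1 / norm (x - y) ^ (DIM('a) + 2)) * indicator {(norm x)\<^sup>2<..} ((norm y)\<^sup>2) \<partial>lborel)"
  proof -
    have "(?d - real 2) / 2 = ?d / 2 - 1" by (simp add: field_simps)
    then show ?thesis
      using nn_integral_kernel_inside_eq_outside[OF assms, of 2] unfolding R2 R_def[symmetric] F_def by (simp only:)
  qed
  also have "\<dots> = ennreal (half_sphere_area DIM('a)) * (\<integral>\<^sup>+u\<in>{0<..}. F (R + u) * ennreal (1 / u\<^sup>2 + 4 * R / ?d / u ^ 3) \<partial>lborel)"
    unfolding R_def by (rule nn_integral_poisson_outside_2) measurable
  also have "(\<integral>\<^sup>+u\<in>{0<..}. F (R + u) * ennreal (1 / u\<^sup>2 + 4 * R / ?d / u ^ 3) \<partial>lborel) = (\<integral>\<^sup>+t\<in>{0<..<R}. ennreal (R\<^sup>2 / t\<^sup>2) * (F (R + (R\<^sup>2 / t - R)) * ennreal (1 / (R\<^sup>2 / t - R)\<^sup>2 + 4 * R / ?d / (R\<^sup>2 / t - R) ^ 3)) \<partial>lborel)"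
    using R by (intro nn_integral_inversion_interval) auto
  also have "\<dots> = (\<integral>\<^sup>+t\<in>{0<..<R}. f t * ennreal ((t / R) powr (?d / 2 - 1) * (1 / (R - t)\<^sup>2 + 4 * t / ?d / (R - t) ^ 3)) \<partial>lborel)"
    (is "integral\<^sup>N _ ?F = integral\<^sup>N _ ?G")
  proof (intro nn_integral_cong)
    fix t :: real
    show "?F t = ?G t"
    proof (cases "0 < t \<and> t < R")
      case True
      define q where "q = R - t"
      have q: "q > 0" using True by (simp add: q_def)
      have "R\<^sup>2 / (R + (R\<^sup>2 / t - R)) = t" "R / (R + (R\<^sup>2 / t - R)) = t / R"
        using True by (simp_all add: power2_eq_square)
      then have FR: "F (R + (R\<^sup>2 / t - R)) = f t * ennreal ((t / R) powr (?d / 2 - 1))" unfolding F_def by (simp only:)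
      have 1: "R\<^sup>2 / t - R = R * q / t"
        using True by (simp add: power2_eq_square field_simps q_def)
      have "R\<^sup>2 / t\<^sup>2 * (1 / (R * q / t)\<^sup>2 + 4 * R / ?d / (R * q / t) ^ 3) = 1 / q\<^sup>2 + 4 * t / ?d / q ^ 3"
        using True q R by (simp add: power2_eq_square power3_eq_cube field_simps)
      then have "R\<^sup>2 / t\<^sup>2 * ((t / R) powr (?d / 2 - 1) * (1 / (R * q / t)\<^sup>2 + 4 * R / ?d / (R * q / t) ^ 3)) = (t / R) powr (?d / 2 - 1) * (1 / q\<^sup>2 + 4 * t / ?d / q ^ 3)"
        by (simp only: mult.left_commute[of "R\<^sup>2 / t\<^sup>2"])
      then have "ennreal (R\<^sup>2 / t\<^sup>2) * (ennreal ((t / R) powr (?d / 2 - 1)) * ennreal (1 / (R * q / t)\<^sup>2 + 4 * R / ?d / (R * q / t) ^ 3)) = ennreal ((t / R) powr (?d / 2 - 1) * (1 / q\<^sup>2 + 4 * t / ?d / q ^ 3))"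
        using True q R by (intro ennreal_mult3_eqI) auto
      from arg_cong[OF this, of "\<lambda>w. f t * w"] show ?thesis
        using True unfolding FR unfolding 1 q_def[symmetric] by (simp add: mult_ac)
    qed auto
  qed
  finally show ?thesis by (simp add: R_def)
qed

text \<open>
  Bernoulli's inequality in the exponential form \<open>1 - z \<le> exp (- z)\<close>, \<open>1 + n z \<le> exp (n z)\<close>.
\<close>

lemma powr_mult_one_plus_le_one:
  fixes z n :: real
  assumes "0 \<le> z" "z < 1" "n \<ge> 0"
  shows "(1 - z) powr n * (1 + n * z) \<le> 1"
proof -
  have "ln (1 - z) \<le> - z" using assms ln_le_minus_one[of "1 - z"] by simp
  then have "n * ln (1 - z) \<le> n * (- z)" using assms(3) by (rule mult_left_mono)
  moreover have "(1 - z) powr n = exp (n * ln (1 - z))" using assms by (simp add: powr_def)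
  ultimately have "(1 - z) powr n \<le> exp (- (n * z))" by simp
  moreover have "1 + n * z \<le> exp (n * z)" by (rule exp_ge_add_one_self)
  ultimately have "(1 - z) powr n * (1 + n * z) \<le> exp (- (n * z)) * exp (n * z)"
    using assms by (intro mult_mono) auto
  then show ?thesis by (simp add: exp_minus)
qed

text \<open>
  With \<open>n = d / 2 - 1\<close> and \<open>z = 1 - t / R\<close>, clearing denominators turns the claim into
  \<open>(1 - z) powr n * (1 + n * z) \<le> 1\<close>; this is where \<open>d \<ge> 2\<close>, that is \<open>n \<ge> 0\<close>, enters.
\<close>

lemma outside_kernel_bound:
  fixes t R d :: real
  assumes t: "0 < t" "t < R" and d: "d \<ge> 2"
  shows "(t / R) powr (d / 2 - 1) / (R - t) + (R - t) * ((t / R) powr (d / 2 - 1) * (1 / (R - t)\<^sup>2 + 4 * t / d / (R - t) ^ 3))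
    \<le> 4 / d * R / (R - t)\<^sup>2"
proof -
  define P where "P = (t / R) powr (d / 2 - 1)"
  define q where "q = R - t"
  have q: "q > 0" using t by (simp add: q_def)
  have "(1 - q / R) powr (d / 2 - 1) * (1 + (d / 2 - 1) * (q / R)) \<le> 1"
    using t d by (intro powr_mult_one_plus_le_one) (auto simp: q_def field_simps)
  also have "1 - q / R = t / R" using t by (simp add: q_def field_simps)
  finally have "P * (1 + (d / 2 - 1) * (q / R)) \<le> 1" by (simp add: P_def)
  then have "P * (1 + (d / 2 - 1) * (q / R)) * R \<le> 1 * R" using t by (intro mult_right_mono) auto
  moreover have "P * (1 + (d / 2 - 1) * (q / R)) * R = P * (d / 2 * q + t)"
    using t by (simp add: q_def field_simps)
  ultimately have *: "P * (d / 2 * q + t) \<le> R" by (simp only: mult_1)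
  have "q * (P * (1 / q\<^sup>2 + 4 * t / d / q ^ 3)) = P / q + 4 * t / d * P / q\<^sup>2"
    using q by (simp add: power2_eq_square power3_eq_cube distrib_left)
  moreover have "4 / d * (P * (d / 2 * q + t)) / q\<^sup>2 = 2 * P / q + 4 * t / d * P / q\<^sup>2"
    using q d by (simp add: power2_eq_square distrib_left add_divide_distrib)
  ultimately have "P / q + q * (P * (1 / q\<^sup>2 + 4 * t / d / q ^ 3)) = 4 / d * (P * (d / 2 * q + t)) / q\<^sup>2"
    by simp
  also have "\<dots> \<le> 4 / d * R / q\<^sup>2"
    using * d by (intro divide_right_mono mult_left_mono) auto
  finally show ?thesis by (simp add: P_def q_def)
qed

text \<open>
  The integrand is, up to the factor \<open>norm x\<close>, the radial derivative of the kernel, and the right-hand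
  side belongs in the same way to the quadratic function that the potential equals on the ball.
  Since \<open>(x - y) \<bullet> x = ((norm (x - y))\<^sup>2 + (norm x)\<^sup>2 - (norm y)\<^sup>2) / 2\<close>, inverting the ball at \<open>x\<close>
  produces the two kernels with exponents \<open>- DIM('a)\<close> and \<open>- DIM('a) - 2\<close>.  Their spherical means are
  compared with \<open>1 / ((norm x)\<^sup>2 - t)\<^sup>2\<close>, for which the integral is the Beta integral that also occurs
  inside the ball.
\<close>

lemma nn_integral_gradient_outside:
  fixes x :: "'a::euclidean_space" and \<beta> :: real
  assumes \<beta>: "- real DIM('a) < \<beta>" "\<beta> < 4 - real DIM('a)" and x: "norm x > 1" and d: "DIM('a) \<ge> 2"
  defines "g \<equiv> (2 - \<beta> - real DIM('a)) / 2" and "h \<equiv> (\<beta> + real DIM('a)) / 2"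
  shows "(\<integral>\<^sup>+y. ennreal (norm (x - y) powr (\<beta> - 2) * ((x - y) \<bullet> x) * ball_weight g y) \<partial>lborel) \<le>
    ennreal (2 * half_sphere_area DIM('a) * (Gamma (2 - h) * Gamma h) * (norm x)\<^sup>2 / real DIM('a))"
proof -
  let ?d = "real DIM('a)"
  let ?s = "half_sphere_area DIM('a)"
  define R where "R = (norm x)\<^sup>2"
  define p where "p = R - 1"
  have R: "R > 1" using power_strict_mono[OF x, of 2] by (simp add: R_def)
  have p: "p > 0" using R by (simp add: p_def)
  have x0: "x \<noteq> 0" using x by auto
  have s: "?s > 0" using half_sphere_area_pos[of "DIM('a)"] by simp
  have g: "g > -1" "g < 1" and h: "h > 0" "h < 2" and gh: "g = 1 - h" and \<beta>h: "\<beta> = 2 * h - ?d"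
    using \<beta> by (auto simp: g_def h_def field_simps)
  have GG: "Gamma (2 - h) * Gamma h \<ge> 0" using h by (intro mult_nonneg_nonneg) auto
  define f where "f t = ennreal (if t < 1 then (1 - t) powr g else 0)" for t :: real
  have [measurable]: "f \<in> borel_measurable borel" unfolding f_def by measurable
  have fw: "f ((norm y)\<^sup>2) = ennreal (ball_weight g y)" for y :: 'a
    by (simp add: f_def ball_weight_eq)
  define G where "G z = ennreal (norm z powr (\<beta> - 2) * (((norm z)\<^sup>2 + R - (norm (x + z))\<^sup>2) / 2) * ball_weight g (x + z))" for z
  have [measurable]: "G \<in> borel_measurable borel" unfolding G_def by measurable
  have inner: "(x - y) \<bullet> x = ((norm (x - y))\<^sup>2 + R - (norm y)\<^sup>2) / 2" for y
    unfolding R_def power2_norm_eq_inner by (simp add: inner_diff inner_commute)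
  have "(\<integral>\<^sup>+y. ennreal (norm (x - y) powr (\<beta> - 2) * ((x - y) \<bullet> x) * ball_weight g y) \<partial>lborel) = (\<integral>\<^sup>+z. G z \<partial>lborel)"
    unfolding G_def inner by (subst nn_integral_shift[where x=x]) auto
  also have "\<dots> = (\<integral>\<^sup>+z. ennreal ((\<bar>p\<bar> / (norm z)\<^sup>2) ^ DIM('a)) * G ((p / (norm z)\<^sup>2) *\<^sub>R z) \<partial>lborel)"
    using p by (intro nn_integral_inversion) auto
  also have "\<dots> = (\<integral>\<^sup>+z. ennreal (p powr h / 2) * (f ((norm (x + z))\<^sup>2) * ennreal (1 / norm (x - (x + z)) ^ DIM('a)) * indicator {..<R} ((norm (x + z))\<^sup>2)
       + f ((norm (x + z))\<^sup>2) * ennreal (R - (norm (x + z))\<^sup>2) * ennreal (1 / norm (x - (x + z)) ^ (DIM('a) + 2)) * indicator {..<R} ((norm (x + z))\<^sup>2)) \<partial>lborel)"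
    (is "integral\<^sup>N _ ?F = integral\<^sup>N _ ?G")
  proof (rule nn_integral_cong_nonzero)
    fix z :: 'a assume z: "z \<noteq> 0"
    define n where "n = norm z"
    have n: "n > 0" using z by (simp add: n_def)
    define m where "m = (norm (x + z))\<^sup>2"
    have inv: "1 - (norm (x + (p / n\<^sup>2) *\<^sub>R z))\<^sup>2 = p / n\<^sup>2 * (1 - m)"
      using norm_inversion[OF z, of "p" x] by (simp add: p_def n_def m_def R_def)
    show "?F z = ?G z"
    proof (cases "m < 1")
      case True
      have "p / n\<^sup>2 * (1 - m) > 0" using True p n by simp
      then have w: "ball_weight g (x + (p / n\<^sup>2) *\<^sub>R z) = (p / n\<^sup>2 * (1 - m)) powr g"
        using inv unfolding ball_weight_eq by auto
      have nz: "norm ((p / n\<^sup>2) *\<^sub>R z) = p / n"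
        using p n by (simp add: n_def power2_eq_square)
      have "(norm (x + (p / n\<^sup>2) *\<^sub>R z))\<^sup>2 = 1 - p / n\<^sup>2 * (1 - m)" using inv by simp
      then have half: "((norm ((p / n\<^sup>2) *\<^sub>R z))\<^sup>2 + R - (norm (x + (p / n\<^sup>2) *\<^sub>R z))\<^sup>2) / 2 = p / n\<^sup>2 * (n\<^sup>2 + (R - m)) / 2"
        unfolding nz using n by (simp add: p_def power_divide field_simps power2_eq_square)
      have "(p / n\<^sup>2) ^ DIM('a) * ((p / n) powr (\<beta> - 2) * (p / n\<^sup>2 * (n\<^sup>2 + (R - m)) / 2) * (p / n\<^sup>2 * (1 - m)) powr g)
         = ((p / n\<^sup>2) powr ?d * (p / n) powr (\<beta> - 2) * (p / n\<^sup>2) powr 1 * (p / n\<^sup>2) powr g) * ((n\<^sup>2 + (R - m)) / 2 * (1 - m) powr g)"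
        using p n True by (subst powr_mult) (auto simp: powr_realpow)
      also have "(p / n\<^sup>2) powr ?d * (p / n) powr (\<beta> - 2) * (p / n\<^sup>2) powr 1 * (p / n\<^sup>2) powr g
        = p powr (?d + (\<beta> - 2) + 1 + g) * n powr (- (2 * ?d + (\<beta> - 2) + 2 + 2 * g))"
      proof -
        have n2: "n\<^sup>2 powr s = n powr (2 * s)" for s
          using n by (simp add: powr_powr powr_numeral[symmetric] del: powr_numeral)
        have "n powr (- (2 * ?d + (\<beta> - 2) + 2 + 2 * g)) = 1 / (n powr (2 * ?d) * n powr (\<beta> - 2) * n powr 2 * n powr (2 * g))"
          by (subst powr_minus) (simp only: powr_add inverse_eq_divide)
        then show ?thesis
          using p n by (simp only: powr_divide n2 powr_add less_imp_le zero_le_power2) (simp add: n2)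
      qed
      also have "?d + (\<beta> - 2) + 1 + g = h" by (simp add: gh \<beta>h)
      also have "- (2 * ?d + (\<beta> - 2) + 2 + 2 * g) = - real (DIM('a) + 2)" by (simp add: gh \<beta>h)
      also have "n powr - real (DIM('a) + 2) = 1 / n ^ (DIM('a) + 2)"
        using n by (rule inverse_power_eq_powr[symmetric])
      also have "p powr h * (1 / n ^ (DIM('a) + 2)) * ((n\<^sup>2 + (R - m)) / 2 * (1 - m) powr g) =
         p powr h / 2 * ((1 - m) powr g * (1 / n ^ DIM('a)) + (1 - m) powr g * (R - m) * (1 / n ^ (DIM('a) + 2)))"
        using n by (simp add: field_simps power_add power2_eq_square)
      finally have eqn: "(p / n\<^sup>2) ^ DIM('a) * ((p / n) powr (\<beta> - 2) * (p / n\<^sup>2 * (n\<^sup>2 + (R - m)) / 2) * (p / n\<^sup>2 * (1 - m)) powr g)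
        = p powr h / 2 * ((1 - m) powr g * (1 / n ^ DIM('a)) + (1 - m) powr g * (R - m) * (1 / n ^ (DIM('a) + 2)))" .
      have Rm: "R - m > 0" using True R by simp
      have "ennreal ((p / n\<^sup>2) ^ DIM('a)) * ennreal ((p / n) powr (\<beta> - 2) * (p / n\<^sup>2 * (n\<^sup>2 + (R - m)) / 2) * (p / n\<^sup>2 * (1 - m)) powr g)
        = ennreal (p powr h / 2 * ((1 - m) powr g * (1 / n ^ DIM('a)) + (1 - m) powr g * (R - m) * (1 / n ^ (DIM('a) + 2))))"
        using p n Rm by (intro ennreal_mult_eqI eqn) auto
      also have "\<dots> = ennreal (p powr h / 2) * (ennreal ((1 - m) powr g) * ennreal (1 / n ^ DIM('a)) + ennreal ((1 - m) powr g) * ennreal (R - m) * ennreal (1 / n ^ (DIM('a) + 2)))"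
      proof -
        have "ennreal ((1 - m) powr g) * ennreal (1 / n ^ DIM('a)) + ennreal ((1 - m) powr g) * ennreal (R - m) * ennreal (1 / n ^ (DIM('a) + 2))
           = ennreal ((1 - m) powr g) * ennreal (1 / n ^ DIM('a)) + ennreal ((1 - m) powr g * (R - m)) * ennreal (1 / n ^ (DIM('a) + 2))"
          using Rm by (simp add: ennreal_mult)
        also have "\<dots> = ennreal ((1 - m) powr g * (1 / n ^ DIM('a)) + (1 - m) powr g * (R - m) * (1 / n ^ (DIM('a) + 2)))"
          using Rm n by (intro ennreal_mult_add_mult) auto
        finally show ?thesis using Rm n
          by (subst ennreal_mult) (auto intro!: add_nonneg_nonneg mult_nonneg_nonneg)
      qed
      finally show ?thesis
        using True p R unfolding n_def[symmetric] G_def w half f_def m_def[symmetric] unfolding nz by (simp add: n_def)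
    next
      case False
      have "p / n\<^sup>2 * (1 - m) \<le> 0" using False p n by (intro mult_nonneg_nonpos) auto
      then have w: "ball_weight g (x + (p / n\<^sup>2) *\<^sub>R z) = 0"
        using inv unfolding ball_weight_eq by auto
      then show ?thesis using False unfolding G_def n_def[symmetric] w f_def m_def[symmetric] by simp
    qed
  qed
  also have "\<dots> = (\<integral>\<^sup>+y. ennreal (p powr h / 2) * (f ((norm y)\<^sup>2) * ennreal (1 / norm (x - y) ^ DIM('a)) * indicator {..<R} ((norm y)\<^sup>2)
       + f ((norm y)\<^sup>2) * ennreal (R - (norm y)\<^sup>2) * ennreal (1 / norm (x - y) ^ (DIM('a) + 2)) * indicator {..<R} ((norm y)\<^sup>2)) \<partial>lborel)"
    by (rule nn_integral_shift[symmetric]) measurable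
  also have "\<dots> = ennreal (p powr h / 2) * ((\<integral>\<^sup>+y. f ((norm y)\<^sup>2) * ennreal (1 / norm (x - y) ^ DIM('a)) * indicator {..<(norm x)\<^sup>2} ((norm y)\<^sup>2) \<partial>lborel)
       + (\<integral>\<^sup>+y. f ((norm y)\<^sup>2) * ennreal (R - (norm y)\<^sup>2) * ennreal (1 / norm (x - y) ^ (DIM('a) + 2)) * indicator {..<(norm x)\<^sup>2} ((norm y)\<^sup>2) \<partial>lborel))"
    unfolding R_def by (subst nn_integral_cmult, measurable, subst nn_integral_add, measurable)
  also have "\<dots> = ennreal (p powr h / 2) * (ennreal ?s *
      (\<integral>\<^sup>+t\<in>{0<..<R}. f t * ennreal ((t / R) powr (?d / 2 - 1) / (R - t)) \<partial>lborel) + ennreal ?s *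
      (\<integral>\<^sup>+t\<in>{0<..<R}. f t * ennreal (R - t) * ennreal ((t / R) powr (?d / 2 - 1) * (1 / (R - t)\<^sup>2 + 4 * t / ?d / (R - t) ^ 3)) \<partial>lborel))"
    unfolding R_def
    by (subst nn_integral_poisson_inside[OF _ x0], measurable,
        subst nn_integral_poisson_inside_2[OF _ x0, where f="\<lambda>t. f t * ennreal ((norm x)\<^sup>2 - t)"], measurable)
  also have "\<dots> = ennreal (p powr h / 2) * (ennreal ?s *
      (\<integral>\<^sup>+t. f t * ennreal ((t / R) powr (?d / 2 - 1) / (R - t)) * indicator {0<..<R} t +
       f t * ennreal (R - t) * ennreal ((t / R) powr (?d / 2 - 1) * (1 / (R - t)\<^sup>2 + 4 * t / ?d / (R - t) ^ 3)) * indicator {0<..<R} t \<partial>lborel))"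
    by (subst nn_integral_add) (auto simp: distrib_left)
  also have "\<dots> \<le> ennreal (p powr h / 2) * (ennreal ?s * (\<integral>\<^sup>+t. ennreal (4 / ?d * R) * (ennreal ((1 - t) powr g * ((1 - t) + p) powr (-2)) * indicator {0<..} (1 - t)) \<partial>lborel))"
  proof (intro mult_left_mono nn_integral_mono)
    fix t :: real
    show "f t * ennreal ((t / R) powr (?d / 2 - 1) / (R - t)) * indicator {0<..<R} t +
       f t * ennreal (R - t) * ennreal ((t / R) powr (?d / 2 - 1) * (1 / (R - t)\<^sup>2 + 4 * t / ?d / (R - t) ^ 3)) * indicator {0<..<R} t
       \<le> ennreal (4 / ?d * R) * (ennreal ((1 - t) powr g * ((1 - t) + p) powr (-2)) * indicator {0<..} (1 - t))"
    proof (cases "0 < t \<and> t < 1")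
      case True
      then have tR: "t < R" using R by simp
      have pos: "(t / R) powr (?d / 2 - 1) / (R - t) \<ge> 0" "(t / R) powr (?d / 2 - 1) * (1 / (R - t)\<^sup>2 + 4 * t / ?d / (R - t) ^ 3) \<ge> 0" "R - t \<ge> 0"
        using True tR by (auto intro!: mult_nonneg_nonneg add_nonneg_nonneg divide_nonneg_nonneg)
      have "f t * ennreal ((t / R) powr (?d / 2 - 1) / (R - t)) + f t * ennreal (R - t) * ennreal ((t / R) powr (?d / 2 - 1) * (1 / (R - t)\<^sup>2 + 4 * t / ?d / (R - t) ^ 3))
        = ennreal ((1 - t) powr g) * ennreal ((t / R) powr (?d / 2 - 1) / (R - t) + (R - t) * ((t / R) powr (?d / 2 - 1) * (1 / (R - t)\<^sup>2 + 4 * t / ?d / (R - t) ^ 3)))"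
        using ennreal_add_mult[OF pos] True by (simp only: distrib_left mult.assoc f_def if_True)
      also have "\<dots> \<le> ennreal ((1 - t) powr g) * ennreal (4 / ?d * R / (R - t)\<^sup>2)"
        using True tR d by (intro mult_left_mono ennreal_leI outside_kernel_bound) auto
      also have "\<dots> = ennreal (4 / ?d * R) * ennreal ((1 - t) powr g * ((1 - t) + p) powr (-2))"
      proof -
        have e: "((1 - t) + p) powr (-2) = 1 / (R - t)\<^sup>2"
          using inverse_power_eq_powr[of "(1 - t) + p" 2] True p by (simp add: p_def algebra_simps)
        show ?thesis
          using R unfolding e by (subst (1 2) ennreal_mult[symmetric]) auto
      qed
      finally show ?thesis using True tR by simp
    next
      case False
      then show ?thesis by (cases "t < 1") (auto simp: f_def)
    qed
  qed auto
  also have "(\<integral>\<^sup>+t. ennreal (4 / ?d * R) * (ennreal ((1 - t) powr g * ((1 - t) + p) powr (-2)) * indicator {0<..} (1 - t)) \<partial>lborel)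
     = ennreal (4 / ?d * R) * (\<integral>\<^sup>+t. ennreal ((1 + (-1) * t) powr g * ((1 + (-1) * t) + p) powr (-2)) * indicator {0<..} (1 + (-1) * t) \<partial>lborel)"
    by (subst nn_integral_cmult) auto
  also have "(\<integral>\<^sup>+t. ennreal ((1 + (-1) * t) powr g * ((1 + (-1) * t) + p) powr (-2)) * indicator {0<..} (1 + (-1) * t) \<partial>lborel)
     = (\<integral>\<^sup>+s\<in>{0<..}. ennreal (s powr g * (s + p) powr (-2)) \<partial>lborel)"
    by (subst nn_integral_real_affine[where c="-1" and t=1 and f="\<lambda>s. ennreal (s powr g * (s + p) powr (-2)) * indicator {0<..} s"]) auto
  also have "\<dots> = ennreal (Beta (g + 1) (2 - g - 1) * p powr (g + 1 - 2))"
    using g p by (intro nn_integral_Beta_prime) auto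
  also have "Beta (g + 1) (2 - g - 1) = Gamma (2 - h) * Gamma h"
    by (simp add: gh Beta_complement_2[symmetric])
  also have "ennreal (p powr h / 2) * (ennreal ?s * (ennreal (4 / ?d * R) * ennreal (Gamma (2 - h) * Gamma h * p powr (g + 1 - 2))))
     = ennreal (p powr h / 2 * (?s * (4 / ?d * R * (Gamma (2 - h) * Gamma h * p powr (g + 1 - 2)))))"
    using s R GG by (intro ennreal_mult4) auto
  also have "p powr h / 2 * (?s * (4 / ?d * R * (Gamma (2 - h) * Gamma h * p powr (g + 1 - 2)))) = (p powr h * p powr (g + 1 - 2)) * (2 * ?s * (Gamma (2 - h) * Gamma h) * R / ?d)"
    by (simp add: field_simps)
  also have "p powr h * p powr (g + 1 - 2) = 1" using p by (simp add: powr_add[symmetric] gh)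
  finally show ?thesis by (simp add: R_def)
qed


lemma nn_integral_lborel_dim1:
  fixes h :: "'a::euclidean_space \<Rightarrow> ennreal"
  assumes d: "DIM('a) = 1" and b: "b \<in> Basis" and [measurable]: "h \<in> borel_measurable borel"
  shows "(\<integral>\<^sup>+y. h y \<partial>lborel) = (\<integral>\<^sup>+t. h (t *\<^sub>R b) \<partial>lborel)"
proof -
  have B: "Basis = {b}" using d b by (metis card_1_singletonE singletonD)
  have "(lborel :: 'a measure) = distr lborel borel (\<lambda>t. t *\<^sub>R b)"
  proof (rule lborel_eqI)
    fix l u :: 'a assume le: "\<And>c. c \<in> Basis \<Longrightarrow> l \<bullet> c \<le> u \<bullet> c"
    have "(\<lambda>t. t *\<^sub>R b) -` box l u = {l \<bullet> b<..<u \<bullet> b}"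
      using b by (auto simp: box_def B)
    then have "emeasure (distr lborel borel (\<lambda>t. t *\<^sub>R b)) (box l u) = emeasure lborel {l \<bullet> b<..<u \<bullet> b}"
      by (subst emeasure_distr) auto
    then show "emeasure (distr lborel borel (\<lambda>t. t *\<^sub>R b)) (box l u) = (\<Prod>c\<in>Basis. (u - l) \<bullet> c)"
      using le[OF b] by (simp add: B inner_diff)
  qed simp
  then have "(\<integral>\<^sup>+y. h y \<partial>lborel) = (\<integral>\<^sup>+y. h y \<partial>distr lborel borel (\<lambda>t. t *\<^sub>R b))" by (simp only:)
  then show ?thesis by (simp add: nn_integral_distr)
qed

text \<open>
  For \<open>e \<le> 0\<close> the function \<open>r powr e\<close> decreases, for \<open>0 \<le> e \<le> 1\<close> it is concave and lies below its
  tangent at \<open>A\<close>.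
\<close>

lemma powr_add_le_tangent:
  fixes A c e :: real
  assumes A: "A > 0" and c: "c \<ge> 0" and e: "e \<le> 1"
  shows "(A + c) powr e \<le> A powr e + max 0 e * A powr (e - 1) * c"
proof (cases "e \<le> 0")
  case True
  then have "(A + c) powr e \<le> A powr e" using A c by (intro powr_mono2') auto
  then show ?thesis using True by simp
next
  case False
  have "(1 + c / A) powr e * 1 powr (1 - e) \<le> e * (1 + c / A) + (1 - e) * 1"
    using False e A c by (intro Youngs_inequality_0) (auto simp: add_pos_nonneg)
  then have "(1 + c / A) powr e \<le> 1 + e * (c / A)" by (simp add: algebra_simps)
  then have "A powr e * (1 + c / A) powr e \<le> A powr e * (1 + e * (c / A))"
    by (intro mult_left_mono) auto
  moreover have "A powr e * (1 + c / A) powr e = (A + c) powr e"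
  proof -
    have "A * (1 + c / A) = A + c" using A by (simp add: distrib_left)
    then show ?thesis using A c by (subst powr_mult[symmetric]) auto
  qed
  moreover have "A powr e * (1 + e * (c / A)) = A powr e + max 0 e * A powr (e - 1) * c"
    using A False by (simp add: powr_diff field_simps)
  ultimately show ?thesis by simp
qed

lemma nn_integral_Beta_symmetric:
  fixes a b :: real
  assumes "a > 0" "b > 0"
  shows "(\<integral>\<^sup>+t\<in>{-1<..<1}. ennreal ((1 + t) powr (a - 1) * (1 - t) powr (b - 1)) \<partial>lborel) = ennreal (2 powr (a + b - 1) * Beta a b)"
proof -
  have "(\<integral>\<^sup>+t\<in>{-1<..<1}. ennreal ((1 + t) powr (a - 1) * (1 - t) powr (b - 1)) \<partial>lborel)
    = ennreal \<bar>2\<bar> * (\<integral>\<^sup>+s. ennreal ((1 + (-1 + 2 * s)) powr (a - 1) * (1 - (-1 + 2 * s)) powr (b - 1)) * indicator {-1<..<1} (-1 + 2 * s) \<partial>lborel)"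
    by (rule nn_integral_real_affine) auto
  also have "\<dots> = ennreal 2 * (\<integral>\<^sup>+s. ennreal (2 powr (a + b - 2)) * (ennreal (s powr (a - 1) * (1 - s) powr (b - 1)) * indicator {0<..<1} s) \<partial>lborel)"
  proof (rule arg_cong2[where f="(*)"], simp, rule nn_integral_cong)
    fix s :: real
    show "ennreal ((1 + (-1 + 2 * s)) powr (a - 1) * (1 - (-1 + 2 * s)) powr (b - 1)) * indicator {-1<..<1} (-1 + 2 * s)
      = ennreal (2 powr (a + b - 2)) * (ennreal (s powr (a - 1) * (1 - s) powr (b - 1)) * indicator {0<..<1} s)"
    proof (cases "0 < s \<and> s < 1")
      case True
      have "1 - (-1 + 2 * s) = 2 * (1 - s)" by simp
      then have "(1 + (-1 + 2 * s)) powr (a - 1) * (1 - (-1 + 2 * s)) powr (b - 1) = (2 * s) powr (a - 1) * (2 * (1 - s)) powr (b - 1)"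
        by simp
      also have "\<dots> = (2 powr (a - 1) * 2 powr (b - 1)) * (s powr (a - 1) * (1 - s) powr (b - 1))"
        using True by (simp only: powr_mult) (simp only: mult_ac)
      also have "2 powr (a - 1) * 2 powr (b - 1) = (2::real) powr (a + b - 2)"
        by (simp add: powr_add[symmetric])
      finally show ?thesis using True by (simp add: ennreal_mult)
    qed auto
  qed
  also have "\<dots> = ennreal 2 * (ennreal (2 powr (a + b - 2)) * ennreal (Beta a b))"
    using assms by (subst nn_integral_cmult, measurable, subst nn_integral_Beta) auto
  also have "\<dots> = ennreal (2 * (2 powr (a + b - 2) * Beta a b))"
    using Beta_real_nonneg[OF assms] by (intro ennreal_mult3_eqI) auto
  also have "2 * (2 powr (a + b - 2) * Beta a b) = 2 powr (a + b - 1) * Beta a b"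
    by (simp add: powr_diff)
  finally show ?thesis .
qed

text \<open>
  On the line, the integrand at \<open>r = norm x\<close> is \<open>r * (r - t) powr (\<beta> - 1)\<close> times the weight.  Expanding
  the power at \<open>1 - t\<close> with \<open>powr_add_le_tangent\<close> leads to Beta integrals, with total at most
  \<open>r + r * (r - 1) = r\<^sup>2\<close> times the value for \<open>r = 1\<close>.
\<close>

lemma nn_integral_gradient_outside_dim1:
  fixes x :: "'a::euclidean_space" and \<beta> :: real
  assumes \<beta>: "- real DIM('a) < \<beta>" "\<beta> < 2" and x: "norm x > 1" and d: "DIM('a) = 1"
  defines "g \<equiv> (2 - \<beta> - real DIM('a)) / 2" and "h \<equiv> (\<beta> + real DIM('a)) / 2"
  shows "(\<integral>\<^sup>+y. ennreal (norm (x - y) powr (\<beta> - 2) * ((x - y) \<bullet> x) * ball_weight g y) \<partial>lborel) \<le>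
    ennreal (2 * half_sphere_area DIM('a) * (Gamma (2 - h) * Gamma h) * (norm x)\<^sup>2 / real DIM('a))"
proof -
  obtain b0 :: 'a where b0: "b0 \<in> Basis" using nonempty_Basis by blast
  have B: "Basis = {b0}" using d b0 by (metis card_1_singletonE singletonD)
  define b where "b = (if x \<bullet> b0 \<ge> 0 then b0 else - b0)"
  define r where "r = norm x"
  have r: "r > 1" using x by (simp add: r_def)
  have x0: "x = (x \<bullet> b0) *\<^sub>R b0" using euclidean_representation[of x] by (simp add: B)
  have nr: "r = \<bar>x \<bullet> b0\<bar>" unfolding r_def by (subst x0) (use b0 in simp)
  have xb: "x = r *\<^sub>R b" by (subst x0) (simp add: b_def nr)
  have nb: "norm b = 1" "b \<bullet> b = 1" using b0 by (auto simp: b_def)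
  have g: "g > -1" "g < 1" and h: "h > 0" "h < 2" and gh: "g = 1 - h" and \<beta>h: "\<beta> = 2 * h - 1"
    using \<beta> d by (auto simp: g_def h_def field_simps)
  define GG where "GG = Gamma (2 - h) * Gamma h"
  have GG: "GG \<ge> 0" using h unfolding GG_def by (intro mult_nonneg_nonneg) auto
  define H where "H y = ennreal (norm (x - y) powr (\<beta> - 2) * ((x - y) \<bullet> x) * ball_weight g y)" for y
  have [measurable]: "H \<in> borel_measurable borel" unfolding H_def by measurable
  have "(\<integral>\<^sup>+y. H y \<partial>lborel) = (\<integral>\<^sup>+t. H (t *\<^sub>R b0) \<partial>lborel)"
    by (rule nn_integral_lborel_dim1[OF d b0]) measurable
  also have "\<dots> = (\<integral>\<^sup>+t. H (t *\<^sub>R b) \<partial>lborel)"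
  proof (cases "x \<bullet> b0 \<ge> 0")
    case False
    have "(\<integral>\<^sup>+t. H (t *\<^sub>R b0) \<partial>lborel) = (\<integral>\<^sup>+t. H ((0 + (-1) * t) *\<^sub>R b0) \<partial>lborel)"
      by (subst nn_integral_real_affine[where c="-1" and t=0]) auto
    then show ?thesis using False by (simp add: b_def)
  qed (simp add: b_def)
  also have "\<dots> \<le> (\<integral>\<^sup>+t. ennreal r * (ennreal ((1 + t) powr ((g + 1) - 1) * (1 - t) powr ((1 - g) - 1)) * indicator {-1<..<1} t)
      + ennreal (r * (r - 1) * max 0 (\<beta> - 1)) * (ennreal ((1 + t) powr ((g + 1) - 1) * (1 - t) powr (- g - 1)) * indicator {-1<..<1} t) \<partial>lborel)"
  proof (intro nn_integral_mono)
    fix t :: real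
    show "H (t *\<^sub>R b) \<le> ennreal r * (ennreal ((1 + t) powr ((g + 1) - 1) * (1 - t) powr ((1 - g) - 1)) * indicator {-1<..<1} t)
      + ennreal (r * (r - 1) * max 0 (\<beta> - 1)) * (ennreal ((1 + t) powr ((g + 1) - 1) * (1 - t) powr (- g - 1)) * indicator {-1<..<1} t)"
    proof (cases "-1 < t \<and> t < 1")
      case True
      have "x - t *\<^sub>R b = (r - t) *\<^sub>R b" by (simp add: xb scaleR_diff_left)
      then have 1: "norm (x - t *\<^sub>R b) = r - t" "(x - t *\<^sub>R b) \<bullet> x = (r - t) * r"
        using True r nb by (auto simp: xb)
      have w: "ball_weight g (t *\<^sub>R b) = (1 + t) powr g * (1 - t) powr g"
      proof -
        have "1 - t\<^sup>2 = (1 + t) * (1 - t)" by (simp add: power2_eq_square algebra_simps)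
        then show ?thesis using True nb by (simp add: ball_weight_def powr_mult abs_less_iff)
      qed
      have "(r - t) powr (\<beta> - 2) * ((r - t) * r) = r * ((1 - t) + (r - 1)) powr (\<beta> - 1)"
      proof -
        have "(r - t) powr (\<beta> - 2) * (r - t) = (r - t) powr (\<beta> - 1)"
          using True r powr_add[of "r - t" "\<beta> - 2" 1] by simp
        then have "(r - t) powr (\<beta> - 2) * ((r - t) * r) = r * (r - t) powr (\<beta> - 1)"
          by (simp only: mult.assoc[symmetric]) (simp only: mult.commute)
        then show ?thesis by simp
      qed
      also have "\<dots> \<le> r * ((1 - t) powr (\<beta> - 1) + max 0 (\<beta> - 1) * (1 - t) powr ((\<beta> - 1) - 1) * (r - 1))"
        using True r \<beta> by (intro mult_left_mono powr_add_le_tangent) auto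
      finally have "(r - t) powr (\<beta> - 2) * ((r - t) * r) * ((1 + t) powr g * (1 - t) powr g) \<le> r * ((1 - t) powr (\<beta> - 1) + max 0 (\<beta> - 1) * (1 - t) powr ((\<beta> - 1) - 1) * (r - 1)) * ((1 + t) powr g * (1 - t) powr g)"
        by (intro mult_right_mono) auto
      also have "\<dots> = r * ((1 + t) powr g * ((1 - t) powr (\<beta> - 1) * (1 - t) powr g)) + r * (r - 1) * max 0 (\<beta> - 1) * ((1 + t) powr g * ((1 - t) powr ((\<beta> - 1) - 1) * (1 - t) powr g))"
        by (simp only: algebra_simps)
      also have "(1 - t) powr (\<beta> - 1) * (1 - t) powr g = (1 - t) powr ((1 - g) - 1)"
        by (simp add: powr_add[symmetric] \<beta>h gh)
      also have "(1 - t) powr ((\<beta> - 1) - 1) * (1 - t) powr g = (1 - t) powr (- g - 1)"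
        by (simp add: powr_add[symmetric] \<beta>h gh)
      finally have "H (t *\<^sub>R b) \<le> ennreal (r * ((1 + t) powr g * (1 - t) powr ((1 - g) - 1)) + r * (r - 1) * max 0 (\<beta> - 1) * ((1 + t) powr g * (1 - t) powr (- g - 1)))"
        unfolding H_def 1 w by (rule ennreal_leI)
      also have "\<dots> = ennreal r * ennreal ((1 + t) powr g * (1 - t) powr ((1 - g) - 1)) + ennreal (r * (r - 1) * max 0 (\<beta> - 1)) * ennreal ((1 + t) powr g * (1 - t) powr (- g - 1))"
        using r by (intro ennreal_mult_add_mult[symmetric]) auto
      finally show ?thesis using True by simp
    next
      case False
      then have "ball_weight g (t *\<^sub>R b) = 0" using nb by (auto simp: ball_weight_def abs_less_iff)
      then show ?thesis by (simp add: H_def)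
    qed
  qed
  also have "\<dots> = ennreal r * ennreal (2 * GG) + ennreal (r * (r - 1) * max 0 (\<beta> - 1)) * (\<integral>\<^sup>+t\<in>{-1<..<1}. ennreal ((1 + t) powr ((g + 1) - 1) * (1 - t) powr (- g - 1)) \<partial>lborel)"
  proof -
    have "(\<integral>\<^sup>+t\<in>{-1<..<1}. ennreal ((1 + t) powr ((g + 1) - 1) * (1 - t) powr ((1 - g) - 1)) \<partial>lborel) = ennreal (2 powr ((g + 1) + (1 - g) - 1) * Beta (g + 1) (1 - g))"
      using g by (intro nn_integral_Beta_symmetric) auto
    also have "Beta (g + 1) (1 - g) = GG"
      using Beta_complement_2[of h] by (simp add: gh GG_def)
    also have "2 powr ((g + 1) + (1 - g) - 1) = (2::real)" by simp
    finally have *: "(\<integral>\<^sup>+t\<in>{-1<..<1}. ennreal ((1 + t) powr ((g + 1) - 1) * (1 - t) powr ((1 - g) - 1)) \<partial>lborel) = ennreal (2 * GG)" .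
    show ?thesis
      by (subst nn_integral_add, measurable, subst nn_integral_cmult, measurable, subst nn_integral_cmult, measurable, simp only: *)
  qed
  also have "ennreal (r * (r - 1) * max 0 (\<beta> - 1)) * (\<integral>\<^sup>+t\<in>{-1<..<1}. ennreal ((1 + t) powr ((g + 1) - 1) * (1 - t) powr (- g - 1)) \<partial>lborel)
      \<le> ennreal (r * (r - 1) * (2 * GG))"
  proof (cases "\<beta> \<le> 1")
    case True
    then show ?thesis by simp
  next
    case False
    then have g0: "g < 0" by (simp add: gh \<beta>h)
    have "(\<integral>\<^sup>+t\<in>{-1<..<1}. ennreal ((1 + t) powr ((g + 1) - 1) * (1 - t) powr (- g - 1)) \<partial>lborel) = ennreal (2 powr ((g + 1) + (- g) - 1) * Beta (g + 1) (- g))"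
      using g g0 by (intro nn_integral_Beta_symmetric) auto
    also have "2 powr ((g + 1) + (- g) - 1) * Beta (g + 1) (- g) = Gamma (2 - h) * Gamma (- g)"
      using gh by (simp add: Beta_def)
    finally have *: "(\<integral>\<^sup>+t\<in>{-1<..<1}. ennreal ((1 + t) powr ((g + 1) - 1) * (1 - t) powr (- g - 1)) \<partial>lborel) = ennreal (Gamma (2 - h) * Gamma (- g))" .
    have "ennreal (r * (r - 1) * max 0 (\<beta> - 1)) * (\<integral>\<^sup>+t\<in>{-1<..<1}. ennreal ((1 + t) powr ((g + 1) - 1) * (1 - t) powr (- g - 1)) \<partial>lborel)
      = ennreal (r * (r - 1) * max 0 (\<beta> - 1) * (Gamma (2 - h) * Gamma (- g)))"
      unfolding * using r g0 h by (intro ennreal_mult_eqI) auto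
    also have "r * (r - 1) * max 0 (\<beta> - 1) * (Gamma (2 - h) * Gamma (- g)) = r * (r - 1) * (2 * (- g)) * (Gamma (2 - h) * Gamma (- g))"
      using False by (simp add: gh \<beta>h)
    also have "r * (r - 1) * (2 * (- g)) * (Gamma (2 - h) * Gamma (- g)) = r * (r - 1) * (2 * (Gamma (2 - h) * (- g * Gamma (- g))))"
      by simp
    also have "- g * Gamma (- g) = Gamma h"
    proof -
      have "- g \<notin> \<int>\<^sub>\<le>\<^sub>0" using g0 by (auto dest: nonpos_Ints_nonpos)
      from Gamma_plus1[OF this] show ?thesis by (simp add: gh)
    qed
    finally show ?thesis by (simp add: GG_def)
  qed
  also have "ennreal r * ennreal (2 * GG) + ennreal (r * (r - 1) * (2 * GG)) = ennreal (r * (2 * GG) + r * (r - 1) * (2 * GG))"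
    using r GG by (simp add: ennreal_mult ennreal_plus)
  also have "r * (2 * GG) + r * (r - 1) * (2 * GG) = 2 * half_sphere_area DIM('a) * GG * (norm x)\<^sup>2 / real DIM('a)"
    by (simp add: d r_def half_sphere_area_def Gamma_one_half_real powr_half_sqrt power2_eq_square algebra_simps)
  finally show ?thesis by (simp add: H_def GG_def add_left_mono)
qed

section \<open>The potential of the profile\<close>

lemma nn_integral_gradient_bound:
  fixes x :: "'a::euclidean_space" and \<beta> :: real
  assumes \<beta>: "- real DIM('a) < \<beta>" "\<beta> < 2" "\<beta> < 4 - real DIM('a)" and x: "norm x > 1"
  shows "(\<integral>\<^sup>+y. ennreal (norm (x - y) powr (\<beta> - 2) * ((x - y) \<bullet> x) * ball_weight ((2 - \<beta> - real DIM('a)) / 2) y) \<partial>lborel) \<le>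
    ennreal (2 * half_sphere_area DIM('a) * (Gamma (2 - (\<beta> + real DIM('a)) / 2) * Gamma ((\<beta> + real DIM('a)) / 2)) * (norm x)\<^sup>2 / real DIM('a))"
proof (cases "DIM('a) = 1")
  case True
  then show ?thesis using \<beta> x by (intro nn_integral_gradient_outside_dim1) auto
next
  case False
  then have "DIM('a) \<ge> 2" using DIM_positive[where 'a='a] by linarith
  then show ?thesis using \<beta> x by (intro nn_integral_gradient_outside) auto
qed

lemma pow_potential_deriv:
  assumes "r > 0"
  shows "(pow_potential \<beta> has_real_derivative r powr (\<beta> - 1)) (at r)"
proof (cases "\<beta> = 0")
  case True
  have "(ln has_real_derivative r powr (- 1)) (at r)"
    using assms by (auto intro!: derivative_eq_intros simp: powr_minus inverse_eq_divide)
  moreover have "pow_potential \<beta> = ln" using True by (simp add: pow_potential_def fun_eq_iff)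
  ultimately show ?thesis using True by simp
next
  case False
  have "((\<lambda>r. r powr \<beta> / \<beta>) has_real_derivative r powr (\<beta> - 1)) (at r)"
    using assms False by (auto intro!: derivative_eq_intros)
  moreover have "pow_potential \<beta> = (\<lambda>r. r powr \<beta> / \<beta>)" using False by (simp add: pow_potential_def fun_eq_iff)
  ultimately show ?thesis by simp
qed

lemma pow_potential_mono:
  assumes "0 < r" "r \<le> s"
  shows "pow_potential \<beta> r \<le> pow_potential \<beta> s"
proof (rule DERIV_nonneg_imp_nondecreasing[where f="pow_potential \<beta>"])
  fix t assume "r \<le> t" "t \<le> s"
  then show "\<exists>y. (pow_potential \<beta> has_real_derivative y) (at t) \<and> y \<ge> 0"
    using assms by (intro exI[of _ "t powr (\<beta> - 1)"]) (auto intro!: pow_potential_deriv)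
qed fact

lemma pow_potential_mono':
  assumes "0 < r \<or> r = 0 \<and> \<beta> > 0" "r \<le> s"
  shows "pow_potential \<beta> r \<le> pow_potential \<beta> s"
  using assms pow_potential_mono[of r s \<beta>] by (auto simp: pow_potential_def)

lemma pow_potential_measurable [measurable]: "pow_potential \<beta> \<in> borel_measurable borel"
  unfolding pow_potential_def by measurable

lemma nn_integral_along_ray:
  fixes e y :: "'a::euclidean_space"
  assumes e: "norm e = 1" and y: "norm y < 1" and r: "r > 1"
  shows "(\<integral>\<^sup>+\<tau>\<in>{1..r}. ennreal (norm (\<tau> *\<^sub>R e - y) powr (\<beta> - 2) * ((\<tau> *\<^sub>R e - y) \<bullet> e)) \<partial>lborel)
    = ennreal (pow_potential \<beta> (norm (r *\<^sub>R e - y)) - pow_potential \<beta> (norm (e - y)))"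
proof -
  have pos: "(\<tau> *\<^sub>R e - y) \<bullet> e > 0" if "\<tau> \<ge> 1" for \<tau>
  proof -
    have "y \<bullet> e \<le> norm y * norm e" by (rule norm_cauchy_schwarz)
    then show ?thesis using that y e by (simp add: inner_diff power2_norm_eq_inner[symmetric])
  qed
  have npos: "norm (\<tau> *\<^sub>R e - y) > 0" if "\<tau> \<ge> 1" for \<tau>
    using pos[OF that] by auto
  have "(\<integral>\<^sup>+\<tau>. ennreal (norm (\<tau> *\<^sub>R e - y) powr (\<beta> - 2) * ((\<tau> *\<^sub>R e - y) \<bullet> e)) * indicator {1..r} \<tau> \<partial>lborel)
     = ennreal (pow_potential \<beta> (norm (r *\<^sub>R e - y)) - pow_potential \<beta> (norm (1 *\<^sub>R e - y)))"
  proof (rule nn_integral_FTC_Icc)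
    fix \<tau> assume "\<tau> \<in> {1..r}"
    then have \<tau>: "1 \<le> \<tau>" "\<tau> \<le> r" by auto
    let ?n = "norm (\<tau> *\<^sub>R e - y)"
    have sq: "(norm (\<tau> *\<^sub>R e - y)) = sqrt (\<tau>\<^sup>2 - 2 * \<tau> * (y \<bullet> e) + (norm y)\<^sup>2)" for \<tau>
      unfolding norm_eq_sqrt_inner using e
      by (simp add: inner_diff inner_commute power2_eq_square norm_eq_1 algebra_simps)
    have n: "?n > 0" using npos \<tau> by simp
    then have n': "\<tau>\<^sup>2 - 2 * \<tau> * (y \<bullet> e) + (norm y)\<^sup>2 > 0" unfolding sq by simp
    have "((\<lambda>\<tau>. sqrt (\<tau>\<^sup>2 - 2 * \<tau> * (y \<bullet> e) + (norm y)\<^sup>2)) has_real_derivative (\<tau> - y \<bullet> e) / ?n) (at \<tau>)"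
      unfolding sq using n' by (auto intro!: derivative_eq_intros simp: field_simps)
    then have "((\<lambda>\<tau>. norm (\<tau> *\<^sub>R e - y)) has_real_derivative (\<tau> - y \<bullet> e) / ?n) (at \<tau>)"
      by (subst (asm) sq[symmetric, abs_def])
    then have "((\<lambda>\<tau>. pow_potential \<beta> (norm (\<tau> *\<^sub>R e - y))) has_real_derivative ?n powr (\<beta> - 1) * ((\<tau> - y \<bullet> e) / ?n)) (at \<tau>)"
      by (rule DERIV_chain2[where f="pow_potential \<beta>" and g="\<lambda>\<tau>. norm (\<tau> *\<^sub>R e - y)", OF pow_potential_deriv[OF n]])
    moreover have "?n powr (\<beta> - 1) * ((\<tau> - y \<bullet> e) / ?n) = ?n powr (\<beta> - 2) * ((\<tau> *\<^sub>R e - y) \<bullet> e)"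
    proof -
      have "?n powr (\<beta> - 1) = ?n powr (\<beta> - 2) * ?n" using n powr_add[of ?n "\<beta> - 2" 1] by simp
      then show ?thesis using n e by (simp add: inner_diff power2_norm_eq_inner[symmetric])
    qed
    ultimately show "((\<lambda>\<tau>. pow_potential \<beta> (norm (\<tau> *\<^sub>R e - y))) has_real_derivative ?n powr (\<beta> - 2) * ((\<tau> *\<^sub>R e - y) \<bullet> e)) (at \<tau>)"
      by simp
    show "0 \<le> ?n powr (\<beta> - 2) * ((\<tau> *\<^sub>R e - y) \<bullet> e)" using pos[OF \<tau>(1)] by simp
  qed (use r in auto)
  then show ?thesis by simp
qed

lemma norm_le_norm_scaleR_diff:
  fixes e y :: "'a::euclidean_space"
  assumes e: "norm e = 1" and y: "norm y < 1" and r: "r \<ge> 1"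
  shows "norm (e - y) \<le> norm (r *\<^sub>R e - y)"
proof (rule power2_le_imp_le)
  have "y \<bullet> e \<le> norm y * norm e" by (rule norm_cauchy_schwarz)
  then have ye: "y \<bullet> e \<le> 1" using e y by simp
  have 1: "(norm (s *\<^sub>R e - y))\<^sup>2 = s\<^sup>2 - 2 * s * (y \<bullet> e) + (norm y)\<^sup>2" for s
    unfolding power2_norm_eq_inner using e
    by (simp add: inner_diff inner_commute power2_eq_square norm_eq_1 algebra_simps)
  have "0 \<le> (r - 1) * ((r + 1) - 2 * (y \<bullet> e))" using r ye by (intro mult_nonneg_nonneg) auto
  then have "(norm (1 *\<^sub>R e - y))\<^sup>2 \<le> (norm (r *\<^sub>R e - y))\<^sup>2"
    unfolding 1 by (simp add: power2_eq_square algebra_simps)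
  then show "(norm (e - y))\<^sup>2 \<le> (norm (r *\<^sub>R e - y))\<^sup>2" by simp
qed simp

text \<open>
  Integrating the gradient bound along the ray from the boundary point \<open>e\<close>.  Points \<open>y\<close> of the ball
  satisfy \<open>(\<tau> *\<^sub>R e - y) \<bullet> e > 0\<close>, so all integrands are nonnegative and the order of integration may be
  exchanged.
\<close>

lemma nn_integral_potential_increase:
  fixes e :: "'a::euclidean_space" and \<beta> :: real
  assumes \<beta>: "- real DIM('a) < \<beta>" "\<beta> < 2" "\<beta> < 4 - real DIM('a)" and e: "norm e = 1" and r: "r > 1"
  defines "g \<equiv> (2 - \<beta> - real DIM('a)) / 2" and "h \<equiv> (\<beta> + real DIM('a)) / 2"
  shows "(\<integral>\<^sup>+y. ennreal ((pow_potential \<beta> (norm (r *\<^sub>R e - y)) - pow_potential \<beta> (norm (e - y))) * ball_weight g y) \<partial>lborel) \<le>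
    ennreal (half_sphere_area DIM('a) * (Gamma (2 - h) * Gamma h) / real DIM('a) * (r\<^sup>2 - 1))"
proof -
  define C where "C = half_sphere_area DIM('a) * (Gamma (2 - h) * Gamma h) / real DIM('a)"
  have h: "h > 0" "h < 2" using \<beta> by (auto simp: h_def field_simps)
  have C: "C \<ge> 0" unfolding C_def using h half_sphere_area_pos[of "DIM('a)"]
    by (intro divide_nonneg_nonneg mult_nonneg_nonneg) auto
  define k where "k \<tau> y = norm (\<tau> *\<^sub>R e - y) powr (\<beta> - 2) * ((\<tau> *\<^sub>R e - y) \<bullet> e)" for \<tau> :: real and y :: 'a
  have [measurable]: "(\<lambda>(\<tau>, y). k \<tau> y) \<in> borel_measurable (borel \<Otimes>\<^sub>M borel)"
    unfolding k_def by measurable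
  have "(\<integral>\<^sup>+y. ennreal ((pow_potential \<beta> (norm (r *\<^sub>R e - y)) - pow_potential \<beta> (norm (e - y))) * ball_weight g y) \<partial>lborel)
    = (\<integral>\<^sup>+y. \<integral>\<^sup>+\<tau>. ennreal (ball_weight g y) * (ennreal (k \<tau> y) * indicator {1..r} \<tau>) \<partial>lborel \<partial>lborel)"
    (is "integral\<^sup>N _ ?F = integral\<^sup>N _ ?G")
  proof (intro nn_integral_cong)
    fix y :: 'a
    show "?F y = ?G y"
    proof (cases "norm y < 1")
      case True
      have "(\<integral>\<^sup>+\<tau>. ennreal (ball_weight g y) * (ennreal (k \<tau> y) * indicator {1..r} \<tau>) \<partial>lborel) = ennreal (ball_weight g y) * (\<integral>\<^sup>+\<tau>\<in>{1..r}. ennreal (k \<tau> y) \<partial>lborel)"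
        by (rule nn_integral_cmult) measurable
      also have "(\<integral>\<^sup>+\<tau>\<in>{1..r}. ennreal (k \<tau> y) \<partial>lborel) = ennreal (pow_potential \<beta> (norm (r *\<^sub>R e - y)) - pow_potential \<beta> (norm (e - y)))"
        unfolding k_def by (rule nn_integral_along_ray[OF e True r])
      finally show ?thesis by (simp add: ennreal_mult' mult.commute)
    qed (simp add: ball_weight_def)
  qed
  also have "\<dots> = (\<integral>\<^sup>+\<tau>. \<integral>\<^sup>+y. ennreal (ball_weight g y) * (ennreal (k \<tau> y) * indicator {1..r} \<tau>) \<partial>lborel \<partial>lborel)"
    by (rule lborel_pair.Fubini') measurable
  \<comment> \<open>The gradient bound is available for \<open>\<tau> > 1\<close>; the endpoint \<open>\<tau> = 1\<close> is a null set.\<close>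
  also have "\<dots> \<le> (\<integral>\<^sup>+\<tau>. ennreal (2 * C * \<tau>) * indicator {1..r} \<tau> \<partial>lborel)"
  proof (rule nn_integral_mono_AE, rule AE_mp[OF AE_lborel_singleton[of 1]], rule AE_I2, rule impI)
    fix \<tau> :: real assume ne: "\<tau> \<noteq> 1"
    show "(\<integral>\<^sup>+y. ennreal (ball_weight g y) * (ennreal (k \<tau> y) * indicator {1..r} \<tau>) \<partial>lborel) \<le> ennreal (2 * C * \<tau>) * indicator {1..r} \<tau>"
    proof (cases "\<tau> \<in> {1..r}")
      case True
      then have \<tau>: "\<tau> > 1" using ne by simp
      have "(\<integral>\<^sup>+y. ennreal (ball_weight g y) * (ennreal (k \<tau> y) * indicator {1..r} \<tau>) \<partial>lborel)
        = (\<integral>\<^sup>+y. ennreal (1 / \<tau>) * ennreal (norm (\<tau> *\<^sub>R e - y) powr (\<beta> - 2) * ((\<tau> *\<^sub>R e - y) \<bullet> (\<tau> *\<^sub>R e)) * ball_weight g y) \<partial>lborel)"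
        using True \<tau> by (intro nn_integral_cong) (auto simp: k_def ennreal_mult'[symmetric] mult_ac)
      also have "\<dots> = ennreal (1 / \<tau>) * (\<integral>\<^sup>+y. ennreal (norm (\<tau> *\<^sub>R e - y) powr (\<beta> - 2) * ((\<tau> *\<^sub>R e - y) \<bullet> (\<tau> *\<^sub>R e)) * ball_weight g y) \<partial>lborel)"
        by (rule nn_integral_cmult) measurable
      also have "\<dots> \<le> ennreal (1 / \<tau>) * ennreal (2 * half_sphere_area DIM('a) * (Gamma (2 - h) * Gamma h) * (norm (\<tau> *\<^sub>R e))\<^sup>2 / real DIM('a))"
        unfolding g_def h_def using \<beta> \<tau> e by (intro mult_left_mono nn_integral_gradient_bound) auto
      also have "\<dots> = ennreal (1 / \<tau> * (2 * half_sphere_area DIM('a) * (Gamma (2 - h) * Gamma h) * (norm (\<tau> *\<^sub>R e))\<^sup>2 / real DIM('a)))"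
        using \<tau> h half_sphere_area_pos[of "DIM('a)"]
        by (intro ennreal_mult_eqI refl divide_nonneg_nonneg mult_nonneg_nonneg) auto
      also have "1 / \<tau> * (2 * half_sphere_area DIM('a) * (Gamma (2 - h) * Gamma h) * (norm (\<tau> *\<^sub>R e))\<^sup>2 / real DIM('a)) = 2 * C * \<tau>"
        using \<tau> e by (simp add: C_def power2_eq_square)
      finally show ?thesis using True by simp
    qed simp
  qed
  also have "\<dots> = ennreal (C * r\<^sup>2 - C * 1\<^sup>2)"
    using C r by (intro nn_integral_FTC_Icc) (auto intro!: derivative_eq_intros)
  also have "C * r\<^sup>2 - C * 1\<^sup>2 = C * (r\<^sup>2 - 1)" by (simp add: algebra_simps)
  finally show ?thesis by (simp only: C_def)
qed

subsection \<open>Values on the closed ball\<close>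

lemma nn_integral_profile:
  fixes x :: "'a::euclidean_space" and \<beta> :: real
  assumes \<beta>: "- real DIM('a) < \<beta>" "\<beta> < 4 - real DIM('a)" and x: "norm x \<le> 1"
  shows "(\<integral>\<^sup>+y. ennreal (norm (x - y) powr \<beta> * ball_weight ((2 - \<beta> - real DIM('a)) / 2) y) \<partial>lborel) =
    ennreal (half_sphere_area DIM('a) * (Gamma (2 - (\<beta> + real DIM('a)) / 2) * Gamma ((\<beta> + real DIM('a)) / 2)) * (1 + \<beta> / real DIM('a) * (norm x)\<^sup>2))"
  using nn_integral_inside_profile[OF \<beta>, of x] nn_integral_boundary_profile[OF \<beta>, of x] x by linarith

lemma profile_value_nonneg:
  fixes \<beta> s d :: real
  assumes "- d < \<beta>" "d > 0" "0 \<le> s" "s \<le> 1"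
  shows "0 \<le> 1 + \<beta> / d * s"
proof -
  have "- d * s \<le> \<beta> * s" using assms by (intro mult_right_mono) auto
  moreover have "d * s \<le> d" using assms by (simp add: mult_left_le)
  ultimately have "0 \<le> d + \<beta> * s" by linarith
  then show ?thesis using assms by (simp add: field_simps)
qed

lemma has_bochner_integral_profile:
  fixes x :: "'a::euclidean_space" and \<beta> :: real
  assumes \<beta>: "- real DIM('a) < \<beta>" "\<beta> < 4 - real DIM('a)" and x: "norm x \<le> 1"
  shows "has_bochner_integral lborel (\<lambda>y. norm (x - y) powr \<beta> * ball_weight ((2 - \<beta> - real DIM('a)) / 2) y)
    (half_sphere_area DIM('a) * (Gamma (2 - (\<beta> + real DIM('a)) / 2) * Gamma ((\<beta> + real DIM('a)) / 2)) * (1 + \<beta> / real DIM('a) * (norm x)\<^sup>2))"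
proof (rule has_bochner_integral_nn_integral)
  have "(norm x)\<^sup>2 \<le> 1" using x by (simp add: power_le_one)
  then have "0 \<le> 1 + \<beta> / real DIM('a) * (norm x)\<^sup>2"
    using \<beta> by (intro profile_value_nonneg) auto
  then show "0 \<le> half_sphere_area DIM('a) * (Gamma (2 - (\<beta> + real DIM('a)) / 2) * Gamma ((\<beta> + real DIM('a)) / 2)) * (1 + \<beta> / real DIM('a) * (norm x)\<^sup>2)"
    using \<beta> half_sphere_area_pos[of "DIM('a)"] by (intro mult_nonneg_nonneg) (auto simp: field_simps)
qed (use nn_integral_profile[OF \<beta> x] in auto)

lemma has_bochner_integral_ball_weight:
  assumes g: "g > -1"
  shows "has_bochner_integral lborel (ball_weight g :: 'a::euclidean_space \<Rightarrow> real) (half_sphere_area DIM('a) * Beta (real DIM('a) / 2) (g + 1))"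
proof (rule has_bochner_integral_nn_integral)
  show "0 \<le> half_sphere_area DIM('a) * Beta (real DIM('a) / 2) (g + 1)"
    using g half_sphere_area_pos[of "DIM('a)"] by (intro mult_nonneg_nonneg Beta_real_nonneg) auto
qed (use nn_integral_ball_weight[OF g] in auto)

text \<open>
  A bound uniform in \<open>b\<close>.  For \<open>r < 1\<close> and \<open>u = - ln r\<close> the quotient is at most \<open>u * exp (b * u)\<close>, and each
  of the factors \<open>u / 12\<close> and \<open>exp (b * u)\<close> is at most \<open>exp (u / 12)\<close>; for \<open>1 \<le> r \<le> 2\<close> it is at most
  \<open>ln r\<close>.
\<close>

lemma abs_pow_quotient_bound:
  fixes r b :: real
  assumes r: "0 < r" "r \<le> 2" and b: "0 < b" "b \<le> 1 / 12"
  shows "\<bar>(r powr (- b) - 1) / (- b)\<bar> \<le> 12 * r powr (- 1 / 6) + 2"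
proof (cases "r \<ge> 1")
  case True
  have "r powr (- b) = exp (- (b * ln r))" using r by (simp add: powr_def)
  moreover have "1 + - (b * ln r) \<le> exp (- (b * ln r))" by (rule exp_ge_add_one_self)
  ultimately have "1 - r powr (- b) \<le> b * ln r" by simp
  then have "(1 - r powr (- b)) / b \<le> ln r" using b by (simp add: field_simps)
  moreover have "r powr (- b) \<le> 1" using True b powr_mono[of "- b" 0 r] by simp
  moreover have "ln r \<le> r" using r ln_le_minus_one[of r] by simp
  moreover have "\<bar>(r powr (- b) - 1) / (- b)\<bar> = (1 - r powr (- b)) / b"
    using b \<open>r powr (- b) \<le> 1\<close> by (simp add: abs_divide)
  ultimately have "\<bar>(r powr (- b) - 1) / (- b)\<bar> \<le> 2" using r by linarith
  then show ?thesis by (simp add: add_increasing)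
next
  case False
  define u where "u = - ln r"
  have u: "u \<ge> 0" using False r by (simp add: u_def)
  have rp: "r powr s = exp (- (s * u))" for s using r by (simp add: powr_def u_def)
  have "1 + - (b * u) \<le> exp (- (b * u))" by (rule exp_ge_add_one_self)
  then have "(1 + - (b * u)) * exp (b * u) \<le> exp (- (b * u)) * exp (b * u)" by (rule mult_right_mono) simp
  then have 1: "exp (b * u) - 1 \<le> b * (u * exp (b * u))" by (simp add: exp_minus algebra_simps)
  have "1 + u / 12 \<le> exp (u / 12)" by (rule exp_ge_add_one_self)
  then have 2: "u \<le> 12 * exp (u / 12)" by linarith
  have 3: "b * u \<le> u / 12" using b u mult_right_mono[of b "1/12" u] by simp
  have "u * exp (b * u) \<le> (12 * exp (u / 12)) * exp (u / 12)"
    using 2 3 u by (intro mult_mono) auto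
  also have "\<dots> = 12 * exp (u / 6)" by (simp add: exp_add[symmetric])
  finally have "b * (u * exp (b * u)) \<le> b * (12 * exp (u / 6))" using b by (intro mult_left_mono) auto
  with 1 have "exp (b * u) - 1 \<le> (12 * exp (u / 6)) * b" by (simp only: mult.commute)
  then have 4: "(exp (b * u) - 1) / b \<le> 12 * exp (u / 6)" by (subst pos_divide_le_eq[OF b(1)])
  have "\<bar>(r powr (- b) - 1) / (- b)\<bar> = (exp (b * u) - 1) / b"
    using b u by (simp add: rp abs_divide)
  moreover have "r powr (- 1 / 6) = exp (u / 6)" by (simp add: rp)
  ultimately show ?thesis using 4 by simp
qed

text \<open>
  The logarithm is the limit of \<open>(r powr b - 1) / b\<close> as \<open>b\<close> increases to \<open>0\<close>, so its potential is the
  derivative at \<open>b = 0\<close> of a product of Gamma functions, known from the power case.  The exponent of the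
  weight varies with \<open>b\<close>, and an integrable bound independent of \<open>b\<close> is needed to exchange limit
  and integral.
\<close>

lemma has_bochner_integral_log_profile:
  fixes x :: "'a::euclidean_space"
  assumes d: "DIM('a) < 4" and x: "norm x \<le> 1"
  defines "D \<equiv> real DIM('a)"
  shows "has_bochner_integral lborel (\<lambda>y. ln (norm (x - y)) * ball_weight ((2 - D) / 2) y)
    (half_sphere_area DIM('a) * (Gamma (2 - D / 2) * Gamma (D / 2)) * ((Digamma (D / 2) - Digamma 2) / 2 + (norm x)\<^sup>2 / D))"
proof -
  let ?s = "half_sphere_area DIM('a)"
  have D: "D \<ge> 1" "D \<le> 3" using d DIM_positive[where 'a='a] by (auto simp: D_def)
  define g where "g = (2 - D) / 2"
  have g: "g \<ge> - 1 / 2" using D by (simp add: g_def)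
  \<comment> \<open>For negative \<open>b n\<close> the exponent \<open>gn n\<close> exceeds \<open>g\<close>, so the weight is at most the limiting one.\<close>
  define b where "b n = - (1 / (12 * real (Suc n)))" for n
  have b: "b n < 0" "- b n > 0" "- b n \<le> 1 / 12" "b n > -1" for n
    by (auto simp: b_def field_simps)
  define gn where "gn n = (2 - b n - D) / 2" for n
  have gn: "gn n > -1" "gn n \<ge> g" for n using D b[of n] by (auto simp: gn_def g_def field_simps)
  have blim: "b \<longlonglongrightarrow> 0"
  proof -
    have "(\<lambda>n. - (1 / 12) * inverse (real (Suc n))) \<longlonglongrightarrow> - (1 / 12) * 0"
      by (intro tendsto_intros LIMSEQ_inverse_real_of_nat)
    then show ?thesis by (simp add: b_def[abs_def] field_simps)
  qed
  \<comment> \<open>The integral of \<open>r powr t - 1\<close> against the weight that belongs to the exponent \<open>t\<close>.\<close>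
  define \<phi> where "\<phi> t = ?s * (Gamma (2 - (t + D) / 2) * (Gamma ((t + D) / 2) * (1 + t / D * (norm x)\<^sup>2) - Gamma (D / 2) / Gamma (2 - t / 2)))" for t
  have I: "has_bochner_integral lborel (\<lambda>y. (norm (x - y) powr b n - 1) / b n * ball_weight (gn n) y) (\<phi> (b n) / b n)" for n
  proof -
    have "has_bochner_integral lborel (\<lambda>y. norm (x - y) powr b n * ball_weight (gn n) y)
      (?s * (Gamma (2 - (b n + D) / 2) * Gamma ((b n + D) / 2)) * (1 + b n / D * (norm x)\<^sup>2))"
    proof -
      have "- D < b n" "b n < 4 - D" using D b[of n] by linarith+
      then show ?thesis using has_bochner_integral_profile[OF _ _ x, of "b n"] by (simp add: gn_def D_def)
    qed
    moreover have "has_bochner_integral lborel (ball_weight (gn n) :: 'a \<Rightarrow> real) (?s * Beta (D / 2) (gn n + 1))"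
      using has_bochner_integral_ball_weight[OF gn(1), of n, where 'a='a] by (simp add: D_def)
    ultimately have "has_bochner_integral lborel (\<lambda>y. (norm (x - y) powr b n * ball_weight (gn n) y - ball_weight (gn n) y) / b n)
      ((?s * (Gamma (2 - (b n + D) / 2) * Gamma ((b n + D) / 2)) * (1 + b n / D * (norm x)\<^sup>2) - ?s * Beta (D / 2) (gn n + 1)) / b n)"
      by (intro has_bochner_integral_divide_zero has_bochner_integral_diff)
    moreover have "Beta (D / 2) (gn n + 1) = Gamma (2 - (b n + D) / 2) * (Gamma (D / 2) / Gamma (2 - b n / 2))"
    proof -
      have e: "gn n + 1 = 2 - (b n + D) / 2" "D / 2 + (2 - (b n + D) / 2) = 2 - b n / 2"
        by (simp_all add: gn_def field_simps)
      show ?thesis unfolding Beta_def e by simp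
    qed
    ultimately show ?thesis by (simp add: \<phi>_def algebra_simps diff_divide_distrib)
  qed
  have lim: "(\<lambda>n. \<phi> (b n) / b n) \<longlonglongrightarrow> ?s * (Gamma (2 - D / 2) * Gamma (D / 2)) * ((Digamma (D / 2) - Digamma 2) / 2 + (norm x)\<^sup>2 / D)"
  proof -
    have nn: "D / 2 \<notin> \<int>\<^sub>\<le>\<^sub>0" "2 - D / 2 \<notin> \<int>\<^sub>\<le>\<^sub>0" "(2 :: real) \<notin> \<int>\<^sub>\<le>\<^sub>0" using D by (auto dest!: nonpos_Ints_nonpos)
    have "(\<phi> has_field_derivative ?s * (Gamma (2 - D / 2) * Gamma (D / 2)) * ((Digamma (D / 2) - Digamma 2) / 2 + (norm x)\<^sup>2 / D)) (at 0)"
      unfolding \<phi>_def using nn D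
      by (auto intro!: derivative_eq_intros simp: Gamma_2_real field_simps)
    then have "((\<lambda>t. (\<phi> t - \<phi> 0) / (t - 0)) \<longlongrightarrow> ?s * (Gamma (2 - D / 2) * Gamma (D / 2)) * ((Digamma (D / 2) - Digamma 2) / 2 + (norm x)\<^sup>2 / D)) (at 0)"
      by (simp add: has_field_derivative_iff)
    moreover have "\<phi> 0 = 0" by (simp add: \<phi>_def Gamma_2_real)
    moreover have "filterlim b (at 0) sequentially"
      using blim b(1) by (auto simp: filterlim_at intro!: always_eventually less_imp_neq)
    ultimately show ?thesis by (auto dest: filterlim_compose simp: o_def)
  qed
  \<comment> \<open>The dominating function.  Its first term is the profile for the exponent \<open>- 1 / 2\<close>, and in the
    second term the exponent \<open>g - 1 / 8\<close> still exceeds \<open>- 1\<close>, since \<open>g \<ge> - 1 / 2\<close>.\<close>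
  define W where "W y = 12 * (norm (x - y) powr (- 1 / 2) * ball_weight (g + 1 / 4) y + ball_weight (g - 1 / 8) y) + 2 * ball_weight g y" for y
  have Wint: "integrable lborel W"
  proof -
    have e: "(2 - (- 1 / 2) - real DIM('a)) / 2 = g + 1 / 4" by (simp add: g_def D_def field_simps)
    have "- real DIM('a) < - 1 / 2" "- 1 / 2 < 4 - real DIM('a)" using D unfolding D_def by linarith+
    from has_bochner_integral_profile[OF this x, unfolded e]
    have "integrable lborel (\<lambda>y. norm (x - y) powr (- 1 / 2) * ball_weight (g + 1 / 4) y)"
      by (rule integrable.intros)
    moreover have "integrable lborel (ball_weight (g - 1 / 8) :: 'a \<Rightarrow> real)" "integrable lborel (ball_weight g :: 'a \<Rightarrow> real)"
      using has_bochner_integral_ball_weight[of "g - 1 / 8", where 'a='a] has_bochner_integral_ball_weight[of "g", where 'a='a] g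
      by (auto simp: has_bochner_integral_iff)
    ultimately show ?thesis unfolding W_def by auto
  qed
  have bound: "norm ((norm (x - y) powr b n - 1) / b n * ball_weight (gn n) y) \<le> W y" if xy: "y \<noteq> x" for n y
  proof (cases "norm y < 1")
    case False
    then show ?thesis by (simp add: ball_weight_def W_def)
  next
    case True
    define r where "r = norm (x - y)"
    define w where "w = 1 - (norm y)\<^sup>2"
    have r: "r > 0" "r \<le> 2" using xy norm_triangle_ineq4[of x y] x True by (auto simp: r_def)
    have w: "0 < w" "w \<le> 1" using True by (auto simp: w_def norm_less_1_iff)
    have bw: "ball_weight s y = w powr s" for s using True by (simp add: ball_weight_def w_def)
    have "\<bar>(r powr b n - 1) / b n\<bar> \<le> 12 * r powr (- 1 / 6) + 2"
      using abs_pow_quotient_bound[OF r, of "- b n"] b[of n] by simp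
    moreover have "w powr gn n \<le> w powr g" using w gn(2)[of n] by (intro powr_mono') auto
    ultimately have "\<bar>(r powr b n - 1) / b n\<bar> * w powr gn n \<le> (12 * r powr (- 1 / 6) + 2) * w powr g"
      by (intro mult_mono) auto
    \<comment> \<open>Young with the exponents \<open>1 / 3\<close> and \<open>2 / 3\<close> separates the two singularities.\<close>
    moreover have "r powr (- 1 / 6) * w powr g \<le> r powr (- 1 / 2) * w powr (g + 1 / 4) + w powr (g - 1 / 8)"
    proof -
      have "(r powr (- 1 / 2) * w powr (g + 1 / 4)) powr (1 / 3) * (w powr (g - 1 / 8)) powr (2 / 3)
         \<le> 1 / 3 * (r powr (- 1 / 2) * w powr (g + 1 / 4)) + 2 / 3 * w powr (g - 1 / 8)"
        using r w by (intro Youngs_inequality_0) auto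
      also have "\<dots> \<le> r powr (- 1 / 2) * w powr (g + 1 / 4) + w powr (g - 1 / 8)"
        by (intro add_mono) auto
      also have "(r powr (- 1 / 2) * w powr (g + 1 / 4)) powr (1 / 3) * (w powr (g - 1 / 8)) powr (2 / 3)
        = r powr (- 1 / 6) * (w powr ((g + 1 / 4) * (1 / 3)) * w powr ((g - 1 / 8) * (2 / 3)))"
        using r w by (simp add: powr_mult powr_powr)
      also have "w powr ((g + 1 / 4) * (1 / 3)) * w powr ((g - 1 / 8) * (2 / 3)) = w powr g"
      proof -
        have "(g + 1 / 4) * (1 / 3) + (g - 1 / 8) * (2 / 3) = g" by (simp add: field_simps)
        then show ?thesis by (simp only: powr_add[symmetric])
      qed
      finally show ?thesis .
    qed
    moreover have "(12 * r powr (- 1 / 6) + 2) * w powr g = 12 * (r powr (- 1 / 6) * w powr g) + 2 * w powr g"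
      by (simp only: distrib_right mult.assoc)
    moreover have "norm ((norm (x - y) powr b n - 1) / b n * ball_weight (gn n) y) = \<bar>(r powr b n - 1) / b n\<bar> * w powr gn n"
      unfolding bw r_def[symmetric] real_norm_def abs_mult by simp
    moreover have "W y = 12 * (r powr (- 1 / 2) * w powr (g + 1 / 4) + w powr (g - 1 / 8)) + 2 * w powr g"
      unfolding W_def bw r_def[symmetric] ..
    moreover have "N \<le> V" if "q \<le> m" "p \<le> s" "m = 12 * p + 2 * c" "N = q" "V = 12 * s + 2 * c" for N V q m p s c :: real
      using that by linarith
    ultimately show ?thesis by blast
  qed
  have ptw: "(\<lambda>n. (norm (x - y) powr b n - 1) / b n * ball_weight (gn n) y) \<longlonglongrightarrow> ln (norm (x - y)) * ball_weight g y" if xy: "y \<noteq> x" for y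
  proof (cases "norm y < 1")
    case False
    then show ?thesis by (simp add: ball_weight_def)
  next
    case True
    define r where "r = norm (x - y)"
    define w where "w = 1 - (norm y)\<^sup>2"
    have r: "r > 0" using xy by (simp add: r_def)
    have w: "0 < w" using True by (auto simp: w_def norm_less_1_iff)
    have "((\<lambda>t. r powr t) has_field_derivative ln r) (at 0)"
      using r by (auto intro!: derivative_eq_intros)
    then have "((\<lambda>t. (r powr t - r powr 0) / (t - 0)) \<longlongrightarrow> ln r) (at 0)"
      by (simp add: has_field_derivative_iff)
    moreover have "filterlim b (at 0) sequentially"
      using blim b(1) by (auto simp: filterlim_at intro!: always_eventually less_imp_neq)
    ultimately have "(\<lambda>n. (r powr b n - r powr 0) / (b n - 0)) \<longlonglongrightarrow> ln r"
      by (rule filterlim_compose)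
    then have 1: "(\<lambda>n. (r powr b n - 1) / b n) \<longlonglongrightarrow> ln r" using r by simp
    have "gn \<longlonglongrightarrow> (2 - 0 - D) / 2" unfolding gn_def[abs_def] by (intro tendsto_intros blim) auto
    then have "(\<lambda>n. w powr gn n) \<longlonglongrightarrow> w powr g" using w by (intro tendsto_intros) (auto simp: g_def)
    from tendsto_mult[OF 1 this]
    have "(\<lambda>n. (r powr b n - 1) / b n * w powr gn n) \<longlonglongrightarrow> ln r * w powr g" .
    moreover have "ball_weight s y = w powr s" for s using True by (simp add: ball_weight_def w_def)
    ultimately show ?thesis by (simp only: r_def)
  qed
  have AE: "AE y in (lborel :: 'a measure). y \<noteq> x" by (rule AE_lborel_singleton)
  have int: "integrable lborel (\<lambda>y. ln (norm (x - y)) * ball_weight g y)"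
    by (rule integrable_dominated_convergence[where s="\<lambda>n y. (norm (x - y) powr b n - 1) / b n * ball_weight (gn n) y" and w=W])
      (use AE ptw bound Wint in auto)
  have "(\<lambda>n. \<integral>y. (norm (x - y) powr b n - 1) / b n * ball_weight (gn n) y \<partial>lborel) \<longlonglongrightarrow> (\<integral>y. ln (norm (x - y)) * ball_weight g y \<partial>lborel)"
    by (rule integral_dominated_convergence[where w=W])
      (use AE ptw bound Wint in auto)
  moreover have "(\<integral>y. (norm (x - y) powr b n - 1) / b n * ball_weight (gn n) y \<partial>lborel) = \<phi> (b n) / b n" for n
    using I[of n] by (simp add: has_bochner_integral_iff)
  ultimately have "(\<lambda>n. \<phi> (b n) / b n) \<longlonglongrightarrow> (\<integral>y. ln (norm (x - y)) * ball_weight g y \<partial>lborel)"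
    by (simp only:)
  from LIMSEQ_unique[OF this lim]
  have "(\<integral>y. ln (norm (x - y)) * ball_weight g y \<partial>lborel) = ?s * (Gamma (2 - D / 2) * Gamma (D / 2)) * ((Digamma (D / 2) - Digamma 2) / 2 + (norm x)\<^sup>2 / D)" .
  then show ?thesis using int by (simp add: has_bochner_integral_iff g_def)
qed

section \<open>The candidate minimizer\<close>

text \<open>
  The potential at the centre of the unit ball, in units of \<open>half_sphere_area d * (Gamma (2 - h) * Gamma h)\<close>
  with \<open>h = (\<beta> + d) / 2\<close>.
\<close>

definition potential_offset :: "real \<Rightarrow> real \<Rightarrow> real" where
  "potential_offset d \<beta> = (if \<beta> = 0 then (Digamma (d / 2) - Digamma 2) / 2 else 1 / \<beta>)"

lemma has_bochner_integral_pow_potential_ball: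
  fixes x :: "'a::euclidean_space" and \<beta> :: real
  assumes \<beta>: "- real DIM('a) < \<beta>" "\<beta> < 4 - real DIM('a)" and x: "norm x \<le> 1"
  defines "g \<equiv> (2 - \<beta> - real DIM('a)) / 2" and "h \<equiv> (\<beta> + real DIM('a)) / 2"
  shows "has_bochner_integral lborel (\<lambda>y. pow_potential \<beta> (norm (x - y)) * ball_weight g y)
    (half_sphere_area DIM('a) * (Gamma (2 - h) * Gamma h) * (potential_offset (real DIM('a)) \<beta> + (norm x)\<^sup>2 / real DIM('a)))"
proof (cases "\<beta> = 0")
  case True
  have "DIM('a) < 4" using \<beta>(2) True by simp
  from has_bochner_integral_log_profile[OF this x] show ?thesis
    using True by (simp add: pow_potential_def potential_offset_def g_def h_def)
next
  case False
  have "has_bochner_integral lborel (\<lambda>y. norm (x - y) powr \<beta> * ball_weight g y / \<beta>)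
    (half_sphere_area DIM('a) * (Gamma (2 - h) * Gamma h) * (1 + \<beta> / real DIM('a) * (norm x)\<^sup>2) / \<beta>)"
    unfolding g_def h_def using has_bochner_integral_profile[OF \<beta> x] by (intro has_bochner_integral_divide_zero)
  moreover have "half_sphere_area DIM('a) * (Gamma (2 - h) * Gamma h) * (1 + \<beta> / real DIM('a) * (norm x)\<^sup>2) / \<beta>
    = half_sphere_area DIM('a) * (Gamma (2 - h) * Gamma h) * (1 / \<beta> + (norm x)\<^sup>2 / real DIM('a))"
    using False by (simp add: add_divide_distrib[symmetric] field_simps)
  ultimately show ?thesis using False by (simp add: pow_potential_def potential_offset_def)
qed

text \<open>
  Only the increase of the potential from the boundary point \<open>x / norm x\<close> to \<open>x\<close> is estimated; the
  value at the boundary point is known.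
\<close>

lemma pow_potential_outside_ball:
  fixes x :: "'a::euclidean_space" and \<beta> :: real
  assumes \<beta>: "- real DIM('a) < \<beta>" "\<beta> < 2" "\<beta> < 4 - real DIM('a)" and x: "norm x > 1"
  defines "g \<equiv> (2 - \<beta> - real DIM('a)) / 2" and "h \<equiv> (\<beta> + real DIM('a)) / 2"
  defines "C \<equiv> half_sphere_area DIM('a) * (Gamma (2 - h) * Gamma h)"
  shows "integrable lborel (\<lambda>y. pow_potential \<beta> (norm (x - y)) * ball_weight g y)" (is ?int)
    and "(\<integral>y. pow_potential \<beta> (norm (x - y)) * ball_weight g y \<partial>lborel)
      \<le> C * (potential_offset (real DIM('a)) \<beta> + (norm x)\<^sup>2 / real DIM('a))" (is ?upper)
    and "(\<integral>y. pow_potential \<beta> (norm (x - y)) * ball_weight g y \<partial>lborel) \<ge> C * potential_offset (real DIM('a)) \<beta>" (is ?lower)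
proof -
  define r where "r = norm x"
  define e where "e = (1 / r) *\<^sub>R x"
  have r: "r > 1" using x by (simp add: r_def)
  have x0: "x \<noteq> 0" using x by auto
  have e: "norm e = 1" using x0 by (simp add: e_def r_def)
  have xe: "x = r *\<^sub>R e" using r by (simp add: e_def)
  have h: "h > 0" "h < 2" using \<beta> by (auto simp: h_def field_simps)
  have C: "C \<ge> 0" unfolding C_def using h half_sphere_area_pos[of "DIM('a)"] by (intro mult_nonneg_nonneg) auto
  define u where "u x y = pow_potential \<beta> (norm (x - y)) * ball_weight g y" for x y :: 'a
  have [measurable]: "u x \<in> borel_measurable borel" for x unfolding u_def by measurable
  have base: "has_bochner_integral lborel (u e) (C * (potential_offset (real DIM('a)) \<beta> + (norm e)\<^sup>2 / real DIM('a)))"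
    unfolding u_def C_def g_def h_def using e by (intro has_bochner_integral_pow_potential_ball \<beta>) auto
  have diff_nn: "u x y - u e y \<ge> 0" for y
  proof (cases "norm y < 1")
    case True
    have "e \<noteq> y" using e True by auto
    then have "norm (e - y) > 0" by simp
    moreover have "norm (e - y) \<le> norm (x - y)" unfolding xe using e True r by (intro norm_le_norm_scaleR_diff) auto
    ultimately have "pow_potential \<beta> (norm (e - y)) \<le> pow_potential \<beta> (norm (x - y))" by (rule pow_potential_mono)
    then show ?thesis unfolding u_def by (simp add: mult_right_mono)
  qed (simp add: u_def ball_weight_def)
  have nn: "(\<integral>\<^sup>+y. ennreal (u x y - u e y) \<partial>lborel) \<le> ennreal (C / real DIM('a) * (r\<^sup>2 - 1))"
    using nn_integral_potential_increase[OF \<beta> e r]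
    unfolding u_def xe[symmetric] C_def g_def h_def by (simp add: left_diff_distrib)
  then have "(\<integral>\<^sup>+y. ennreal (norm (u x y - u e y)) \<partial>lborel) < \<infinity>"
    using diff_nn by (simp add: le_less_trans)
  then have I: "integrable lborel (\<lambda>y. u x y - u e y)"
    by (intro integrableI_bounded) auto
  have "r\<^sup>2 \<ge> 1" using r by simp
  then have nn': "C / real DIM('a) * (r\<^sup>2 - 1) \<ge> 0" using C by simp
  have le: "(\<integral>y. u x y - u e y \<partial>lborel) \<le> C / real DIM('a) * (r\<^sup>2 - 1)"
    using nn diff_nn nn' by (subst integral_eq_nn_integral) (auto simp: enn2real_leI)
  have ge: "(\<integral>y. u x y - u e y \<partial>lborel) \<ge> 0"
    using diff_nn by (intro integral_nonneg_AE) auto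
  have Ie: "integrable lborel (u e)" using base by (simp add: has_bochner_integral_iff)
  have "integrable lborel (\<lambda>y. (u x y - u e y) + u e y)"
    using I Ie by (rule Bochner_Integration.integrable_add)
  then have Ix: "integrable lborel (u x)" by simp
  have split: "(\<integral>y. u x y \<partial>lborel) = (\<integral>y. u x y - u e y \<partial>lborel) + C * (potential_offset (real DIM('a)) \<beta> + 1 / real DIM('a))"
    using base e Ix by (subst Bochner_Integration.integral_diff) (auto simp: has_bochner_integral_iff)
  show ?int using Ix by (simp add: u_def[abs_def])
  have "(\<integral>y. u x y \<partial>lborel) \<le> C / real DIM('a) * (r\<^sup>2 - 1) + C * (potential_offset (real DIM('a)) \<beta> + 1 / real DIM('a))"
    using split le by simp
  also have "\<dots> = C * (potential_offset (real DIM('a)) \<beta> + (norm x)\<^sup>2 / real DIM('a))"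
    by (simp add: r_def algebra_simps diff_divide_distrib)
  finally show ?upper by (simp add: u_def)
  have "C * (1 / real DIM('a)) \<ge> 0" using C by simp
  then have "C * potential_offset (real DIM('a)) \<beta> \<le> C * (potential_offset (real DIM('a)) \<beta> + 1 / real DIM('a))"
    by (simp add: distrib_left)
  then show ?lower using split ge by (simp add: u_def)
qed

definition ball_measure :: "real \<Rightarrow> 'a::euclidean_space measure" where
  "ball_measure \<beta> = density lborel (\<lambda>y. ennreal (ball_weight ((2 - \<beta> - real DIM('a)) / 2) y / norm_const DIM('a) \<beta>))"

text \<open>
  Defined as the push-forward of a normalized measure on the unit ball, so that its integrals reduce to
  those already computed; \<open>minimizer_eq_density\<close> gives the density.
\<close>

definition minimizer :: "real \<Rightarrow> 'a::euclidean_space \<Rightarrow> 'a measure" where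
  "minimizer \<beta> a = distr (ball_measure \<beta>) borel (\<lambda>y. a + radius2 DIM('a) \<beta> *\<^sub>R y)"

lemma norm_const_eq:
  assumes "\<beta> < 4 - real d" "d > 0"
  shows "norm_const d \<beta> = half_sphere_area d * Beta (real d / 2) ((2 - \<beta> - real d) / 2 + 1)"
proof -
  have e: "(2 - \<beta> - real d) / 2 + 1 = (4 - \<beta> - real d) / 2" "real d / 2 + (4 - \<beta> - real d) / 2 = (4 - \<beta>) / 2"
    by (simp_all add: field_simps)
  have "Gamma (real d / 2) > 0" using assms by simp
  then show ?thesis unfolding Beta_def e norm_const_def half_sphere_area_def by simp
qed

lemma norm_const_pos:
  assumes "\<beta> < 4 - real d"
  shows "norm_const d \<beta> > 0"
proof -
  have "Gamma ((4 - \<beta> - real d) / 2) > 0" "Gamma ((4 - \<beta>) / 2) > 0"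
    using assms by (intro Gamma_real_pos; simp)+
  then show ?thesis by (simp add: norm_const_def)
qed

lemma radius2_powr:
  assumes "- real d < \<beta>" "\<beta> < 2" "d > 0"
  shows "radius2 d \<beta> > 0"
    and "radius2 d \<beta> powr (2 - \<beta>) = Gamma ((4 - \<beta>) / 2) * Gamma ((\<beta> + real d) / 2) / Gamma (1 + real d / 2)"
proof -
  have pos: "Gamma ((4 - \<beta>) / 2) * Gamma ((\<beta> + real d) / 2) / Gamma (1 + real d / 2) > 0"
    using assms by (intro mult_pos_pos divide_pos_pos Gamma_real_pos) auto
  then show "radius2 d \<beta> > 0" unfolding radius2_def powr_gt_zero by linarith
  show "radius2 d \<beta> powr (2 - \<beta>) = Gamma ((4 - \<beta>) / 2) * Gamma ((\<beta> + real d) / 2) / Gamma (1 + real d / 2)"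
  proof -
    have "(X powr (1 / (2 - \<beta>))) powr (2 - \<beta>) = X" if "X > 0" for X
      using that assms by (simp add: powr_powr)
    then show ?thesis unfolding radius2_def using pos by blast
  qed
qed

text \<open>
  The meaning of the radius: it is the scale at which the quadratic coefficient of the potential
  becomes \<open>1 / 2\<close>, the coefficient of the attractive part.
\<close>

lemma radius2_coefficient:
  assumes "- real d < \<beta>" "\<beta> < 2" "\<beta> < 4 - real d" "d > 0"
  defines "h \<equiv> (\<beta> + real d) / 2"
  shows "half_sphere_area d * (Gamma (2 - h) * Gamma h) / norm_const d \<beta> = radius2 d \<beta> powr (2 - \<beta>) * (real d / 2)"
proof -
  have e: "(4 - \<beta> - real d) / 2 = 2 - h" by (simp add: h_def field_simps)
  have "real d / 2 \<notin> \<int>\<^sub>\<le>\<^sub>0" using assms by (auto dest: nonpos_Ints_nonpos)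
  then have G: "Gamma (1 + real d / 2) = real d / 2 * Gamma (real d / 2)"
    using Gamma_plus1[of "real d / 2"] by (simp add: add.commute)
  have "Gamma (2 - h) > 0" using assms by (intro Gamma_real_pos) (simp add: h_def field_simps)
  moreover have "Gamma (real d / 2) > 0" "Gamma ((4 - \<beta>) / 2) > 0" using assms by simp_all
  ultimately show ?thesis
    unfolding radius2_powr(2)[OF assms(1,2,4)] G h_def[symmetric] norm_const_def e half_sphere_area_def
    using assms(4) by (simp add: field_simps)
qed

lemma minimizer_eq_density:
  fixes a :: "'a::euclidean_space" and \<beta> :: real
  assumes \<beta>: "- real DIM('a) < \<beta>" "\<beta> < 2" "\<beta> < 4 - real DIM('a)"
  shows "minimizer \<beta> a = density lborel (\<lambda>x. ennreal
          (inverse (norm_const DIM('a) \<beta>) * radius2 DIM('a) \<beta> powr (\<beta> - 2)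
            * ((radius2 DIM('a) \<beta>)\<^sup>2 - (norm (x - a))\<^sup>2) powr ((2 - \<beta> - real DIM('a)) / 2)
            * indicator (ball a (radius2 DIM('a) \<beta>)) x))" (is "_ = density lborel ?\<rho>")
proof (rule measure_eqI)
  let ?R = "radius2 DIM('a) \<beta>" and ?M = "norm_const DIM('a) \<beta>" and ?g = "(2 - \<beta> - real DIM('a)) / 2"
  have R: "?R > 0" using \<beta> by (intro radius2_powr) auto
  have M: "?M > 0" using \<beta> by (intro norm_const_pos) auto
  have [measurable]: "ball a ?R \<in> sets borel" by simp
  have [measurable]: "?\<rho> \<in> borel_measurable borel" by measurable
  show "sets (minimizer \<beta> a) = sets (density lborel ?\<rho>)" by (simp add: minimizer_def)
  fix A assume "A \<in> sets (minimizer \<beta> a)"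
  then have [measurable]: "A \<in> sets borel" by (simp add: minimizer_def)
  have "emeasure (minimizer \<beta> a) A = (\<integral>\<^sup>+x. indicator A x \<partial>minimizer \<beta> a)" by (simp add: minimizer_def)
  also have "\<dots> = (\<integral>\<^sup>+y. ennreal (ball_weight ?g y / ?M) * indicator A (a + ?R *\<^sub>R y) \<partial>lborel)"
    unfolding minimizer_def ball_measure_def by (subst nn_integral_distr, simp, simp) (subst nn_integral_density, auto)
  also have "\<dots> = (\<integral>\<^sup>+y. ennreal (?R ^ DIM('a)) * (?\<rho> (a + ?R *\<^sub>R y) * indicator A (a + ?R *\<^sub>R y)) \<partial>lborel)"
    (is "integral\<^sup>N _ ?F = integral\<^sup>N _ ?G")
  proof (intro nn_integral_cong)
    fix y :: 'a
    have "ball_weight ?g y / ?M = ?R ^ DIM('a) * (inverse ?M * ?R powr (\<beta> - 2) * (?R\<^sup>2 - (norm (a + ?R *\<^sub>R y - a))\<^sup>2) powr ?g * indicator (ball a ?R) (a + ?R *\<^sub>R y))"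
    proof (cases "norm y < 1")
      case True
      have in_ball: "a + ?R *\<^sub>R y \<in> ball a ?R" using True R by (simp add: dist_norm)
      have "1 - (norm y)\<^sup>2 > 0" using True by (simp add: norm_less_1_iff)
      moreover have "?R\<^sup>2 - (norm (a + ?R *\<^sub>R y - a))\<^sup>2 = ?R\<^sup>2 * (1 - (norm y)\<^sup>2)"
        using R by (simp add: power_mult_distrib algebra_simps)
      ultimately have "(?R\<^sup>2 - (norm (a + ?R *\<^sub>R y - a))\<^sup>2) powr ?g = ?R powr (2 * ?g) * (1 - (norm y)\<^sup>2) powr ?g"
        using R by (simp add: powr_mult powr_powr powr_numeral[symmetric] del: powr_numeral)
      then have A: "?R ^ DIM('a) * (inverse ?M * ?R powr (\<beta> - 2) * (?R\<^sup>2 - (norm (a + ?R *\<^sub>R y - a))\<^sup>2) powr ?g * indicator (ball a ?R) (a + ?R *\<^sub>R y))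
        = (?R powr real DIM('a) * ?R powr (\<beta> - 2) * ?R powr (2 * ?g)) * (inverse ?M * (1 - (norm y)\<^sup>2) powr ?g)"
        using R in_ball by (simp add: powr_realpow)
      have e: "real DIM('a) + (\<beta> - 2) + 2 * ?g = 0" by (simp add: field_simps)
      have "?R powr real DIM('a) * ?R powr (\<beta> - 2) * ?R powr (2 * ?g) = ?R powr (real DIM('a) + (\<beta> - 2) + 2 * ?g)"
        by (simp only: powr_add)
      also have "\<dots> = 1" unfolding e using R by (simp only: powr_zero_eq_one if_False less_imp_neq[symmetric])
      finally have B: "?R powr real DIM('a) * ?R powr (\<beta> - 2) * ?R powr (2 * ?g) = 1" .
      have "ball_weight ?g y = (1 - (norm y)\<^sup>2) powr ?g" using True by (simp only: ball_weight_def if_True)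
      then show ?thesis unfolding A B by (simp only: divide_inverse mult_1 mult.commute)
    next
      case False
      then have "a + ?R *\<^sub>R y \<notin> ball a ?R" using R by (simp add: dist_norm)
      then show ?thesis using False by (simp only: ball_weight_def if_False indicator_simps(2)) simp
    qed
    then have "ennreal (ball_weight ?g y / ?M) = ennreal (?R ^ DIM('a)) * ?\<rho> (a + ?R *\<^sub>R y)"
      using R by (simp only: ennreal_mult' zero_le_power less_imp_le)
    then show "?F y = ?G y"
      by (simp only: mult.assoc)
  qed
  also have "\<dots> = ennreal (?R ^ DIM('a)) * (\<integral>\<^sup>+y. ?\<rho> (a + ?R *\<^sub>R y) * indicator A (a + ?R *\<^sub>R y) \<partial>lborel)"
    by (rule nn_integral_cmult) measurable
  also have "\<dots> = (\<integral>\<^sup>+x. ?\<rho> x * indicator A x \<partial>lborel)"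
    using R by (subst nn_integral_lborel_affine[where c="?R" and t=a and f="\<lambda>x. ?\<rho> x * indicator A x"]) auto
  also have "\<dots> = emeasure (density lborel ?\<rho>) A"
    by (subst emeasure_density) auto
  finally show "emeasure (minimizer \<beta> a) A = emeasure (density lborel ?\<rho>) A" .
qed

lemma sets_minimizer [simp]: "sets (minimizer \<beta> a) = sets borel"
  by (simp add: minimizer_def)

lemma integrable_minimizer_iff:
  fixes a :: "'a::euclidean_space" and f :: "'a \<Rightarrow> real"
  assumes [measurable]: "f \<in> borel_measurable borel" and \<beta>: "\<beta> < 4 - real DIM('a)"
  defines "g \<equiv> (2 - \<beta> - real DIM('a)) / 2"
  shows "integrable (minimizer \<beta> a) f \<longleftrightarrow> integrable lborel (\<lambda>y. f (a + radius2 DIM('a) \<beta> *\<^sub>R y) * ball_weight g y)"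
    and "(\<integral>x. f x \<partial>minimizer \<beta> a) = (\<integral>y. f (a + radius2 DIM('a) \<beta> *\<^sub>R y) * ball_weight g y \<partial>lborel) / norm_const DIM('a) \<beta>"
proof -
  have M: "norm_const DIM('a) \<beta> > 0" using \<beta> by (intro norm_const_pos) auto
  have "integrable (minimizer \<beta> a) f \<longleftrightarrow> integrable lborel (\<lambda>y. (ball_weight g y / norm_const DIM('a) \<beta>) *\<^sub>R f (a + radius2 DIM('a) \<beta> *\<^sub>R y))"
    unfolding minimizer_def ball_measure_def g_def[symmetric] using M
    by (subst integrable_distr_eq, simp, simp, subst integrable_density) auto
  also have "(\<lambda>y. (ball_weight g y / norm_const DIM('a) \<beta>) *\<^sub>R f (a + radius2 DIM('a) \<beta> *\<^sub>R y)) = (\<lambda>y. (1 / norm_const DIM('a) \<beta>) * (f (a + radius2 DIM('a) \<beta> *\<^sub>R y) * ball_weight g y))"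
    by (simp add: mult.commute)
  also have "integrable lborel \<dots> \<longleftrightarrow> integrable lborel (\<lambda>y. f (a + radius2 DIM('a) \<beta> *\<^sub>R y) * ball_weight g y)"
    using M by (simp only: integrable_mult_left_iff) simp
  finally show "integrable (minimizer \<beta> a) f \<longleftrightarrow> integrable lborel (\<lambda>y. f (a + radius2 DIM('a) \<beta> *\<^sub>R y) * ball_weight g y)" .
  have "(\<integral>x. f x \<partial>minimizer \<beta> a) = (\<integral>y. (ball_weight g y / norm_const DIM('a) \<beta>) *\<^sub>R f (a + radius2 DIM('a) \<beta> *\<^sub>R y) \<partial>lborel)"
    unfolding minimizer_def ball_measure_def g_def[symmetric] using M
    by (subst integral_distr, simp, simp, subst integral_density) auto
  also have "\<dots> = (\<integral>y. f (a + radius2 DIM('a) \<beta> *\<^sub>R y) * ball_weight g y / norm_const DIM('a) \<beta> \<partial>lborel)"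
    by (simp add: mult.commute)
  finally show "(\<integral>x. f x \<partial>minimizer \<beta> a) = (\<integral>y. f (a + radius2 DIM('a) \<beta> *\<^sub>R y) * ball_weight g y \<partial>lborel) / norm_const DIM('a) \<beta>"
    by simp
qed

lemma prob_space_minimizer:
  fixes a :: "'a::euclidean_space"
  assumes \<beta>: "\<beta> < 4 - real DIM('a)"
  shows "prob_space (minimizer \<beta> a)"
proof -
  let ?g = "(2 - \<beta> - real DIM('a)) / 2"
  have M: "norm_const DIM('a) \<beta> > 0" using \<beta> by (intro norm_const_pos) auto
  have g: "?g > -1" using \<beta> by (simp add: field_simps)
  have "emeasure (ball_measure \<beta>) (UNIV :: 'a set) = (\<integral>\<^sup>+y. ennreal (1 / norm_const DIM('a) \<beta>) * ennreal (ball_weight ?g y) \<partial>(lborel :: 'a measure))"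
    unfolding ball_measure_def using M by (subst emeasure_density) (auto simp: ennreal_mult[symmetric])
  also have "\<dots> = ennreal (1 / norm_const DIM('a) \<beta>) * ennreal (norm_const DIM('a) \<beta>)"
    using \<beta> by (subst nn_integral_cmult, measurable, subst nn_integral_ball_weight[OF g], subst norm_const_eq) auto
  also have "\<dots> = 1" using M by (simp add: ennreal_mult[symmetric])
  finally have "prob_space (ball_measure \<beta> :: 'a measure)"
    by (intro prob_spaceI) (simp add: ball_measure_def)
  then show ?thesis unfolding minimizer_def
    by (rule prob_space.prob_space_distr) (simp add: ball_measure_def)
qed

lemma AE_minimizer:
  fixes a :: "'a::euclidean_space"
  assumes \<beta>: "- real DIM('a) < \<beta>" "\<beta> < 2" "\<beta> < 4 - real DIM('a)"
  shows "AE x in minimizer \<beta> a. norm (x - a) < radius2 DIM('a) \<beta>"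
    and "AE x in minimizer \<beta> a. x \<noteq> z"
proof -
  let ?R = "radius2 DIM('a) \<beta>"
  have R: "?R > 0" using \<beta> by (intro radius2_powr) auto
  have [measurable]: "ball a ?R \<in> sets borel" by simp
  show "AE x in minimizer \<beta> a. norm (x - a) < ?R"
    unfolding minimizer_eq_density[OF \<beta>]
  proof (subst AE_density, measurable, rule AE_I2, rule impI)
    fix x :: 'a
    assume *: "0 < ennreal (inverse (norm_const DIM('a) \<beta>) * ?R powr (\<beta> - 2) * (?R\<^sup>2 - (norm (x - a))\<^sup>2) powr ((2 - \<beta> - real DIM('a)) / 2) * indicator (ball a ?R) x)"
    have "x \<in> ball a ?R"
    proof (rule ccontr)
      assume "x \<notin> ball a ?R"
      then have "(indicator (ball a ?R) x :: real) = 0" by (rule indicator_simps(2))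
      with * show False by (simp only: mult_zero_right ennreal_0 less_irrefl)
    qed
    then show "norm (x - a) < ?R" by (simp add: dist_norm norm_minus_commute)
  qed
  show "AE x in minimizer \<beta> a. x \<noteq> z"
    unfolding minimizer_eq_density[OF \<beta>]
    by (subst AE_density, measurable) (rule AE_mp[OF AE_lborel_singleton[of z]], rule AE_I2, intro impI, assumption)
qed

lemma minimizer_second_moment:
  fixes a :: "'a::euclidean_space"
  assumes \<beta>: "- real DIM('a) < \<beta>" "\<beta> < 2" "\<beta> < 4 - real DIM('a)"
  shows "integrable (minimizer \<beta> a) (\<lambda>x. (norm (x - a))\<^sup>2)"
    and "(\<integral>x. (norm (x - a))\<^sup>2 \<partial>minimizer \<beta> a) = real DIM('a) * (radius2 DIM('a) \<beta>)\<^sup>2 / (4 - \<beta>)"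
proof -
  let ?R = "radius2 DIM('a) \<beta>" and ?M = "norm_const DIM('a) \<beta>" and ?g = "(2 - \<beta> - real DIM('a)) / 2" and ?d = "real DIM('a)"
  have R: "?R > 0" using \<beta> by (intro radius2_powr) auto
  have M: "?M > 0" using \<beta> by (intro norm_const_pos) auto
  have g: "?g > -1" using \<beta> by (simp add: field_simps)
  have "?g + 1 > 0" using g by linarith
  then have B: "Beta (?d / 2 + 1) (?g + 1) \<ge> 0" by (intro Beta_real_nonneg) auto
  have s: "half_sphere_area DIM('a) > 0" by (intro half_sphere_area_pos) auto
  have "has_bochner_integral lborel (\<lambda>y :: 'a. (norm y)\<^sup>2 powr 1 * ball_weight ?g y) (half_sphere_area DIM('a) * Beta (?d / 2 + 1) (?g + 1))"
    by (rule has_bochner_integral_nn_integral)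
      (use nn_integral_ball_weight_moment[of 1 ?g, where 'a='a] g B s in auto)
  then have "has_bochner_integral lborel (\<lambda>y :: 'a. ?R\<^sup>2 * ((norm y)\<^sup>2 * ball_weight ?g y)) (?R\<^sup>2 * (half_sphere_area DIM('a) * Beta (?d / 2 + 1) (?g + 1)))"
    by (intro has_bochner_integral_mult_right) simp
  moreover have "?R\<^sup>2 * ((norm y)\<^sup>2 * ball_weight ?g y) = (norm (a + ?R *\<^sub>R y - a))\<^sup>2 * ball_weight ?g y" for y :: 'a
    using R by (simp add: power_mult_distrib)
  ultimately have hb: "has_bochner_integral lborel (\<lambda>y :: 'a. (norm (a + ?R *\<^sub>R y - a))\<^sup>2 * ball_weight ?g y) (?R\<^sup>2 * (half_sphere_area DIM('a) * Beta (?d / 2 + 1) (?g + 1)))"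
    by (simp only:)
  show "integrable (minimizer \<beta> a) (\<lambda>x. (norm (x - a))\<^sup>2)"
    using hb \<beta> by (subst integrable_minimizer_iff) (auto simp: has_bochner_integral_iff)
  have "(\<integral>x. (norm (x - a))\<^sup>2 \<partial>minimizer \<beta> a) = ?R\<^sup>2 * (half_sphere_area DIM('a) * Beta (?d / 2 + 1) (?g + 1)) / ?M"
    using hb \<beta> by (subst integrable_minimizer_iff) (auto simp: has_bochner_integral_iff)
  also have "Beta (?d / 2 + 1) (?g + 1) = ?d / (4 - \<beta>) * Beta (?d / 2) (?g + 1)"
  proof -
    have nn: "?d / 2 \<notin> \<int>\<^sub>\<le>\<^sub>0" "?d / 2 + (?g + 1) \<notin> \<int>\<^sub>\<le>\<^sub>0" using g \<beta> by (auto dest!: nonpos_Ints_nonpos simp: field_simps)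
    have "(?d / 2 + (?g + 1)) * Beta (?d / 2 + 1) (?g + 1) = ?d / 2 * Beta (?d / 2) (?g + 1)"
      by (rule Beta_plus1_left[OF nn(1)])
    moreover have "?d / 2 + (?g + 1) = (4 - \<beta>) / 2" by (simp add: field_simps)
    ultimately show ?thesis using \<beta> by (simp add: field_simps)
  qed
  also have "?R\<^sup>2 * (half_sphere_area DIM('a) * (?d / (4 - \<beta>) * Beta (?d / 2) (?g + 1))) / ?M = ?R\<^sup>2 * (?d / (4 - \<beta>) * ?M) / ?M"
    using norm_const_eq[of \<beta> "DIM('a)"] \<beta> by simp
  also have "\<dots> = ?d * ?R\<^sup>2 / (4 - \<beta>)" using M by simp
  finally show "(\<integral>x. (norm (x - a))\<^sup>2 \<partial>minimizer \<beta> a) = ?d * ?R\<^sup>2 / (4 - \<beta>)" .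
qed

text \<open>
  The value of the potential of \<open>minimizer \<beta> a\<close> at its centre \<open>a\<close>.
\<close>

definition minimizer_constant :: "nat \<Rightarrow> real \<Rightarrow> real" where
  "minimizer_constant d \<beta> = (if \<beta> = 0 then ln (radius2 d \<beta>) else 0) + (radius2 d \<beta>)\<^sup>2 * real d / 2 * potential_offset (real d) \<beta>"

lemma pow_potential_scale:
  assumes "R > 0" "r > 0"
  shows "pow_potential \<beta> (R * r) = R powr \<beta> * pow_potential \<beta> r + (if \<beta> = 0 then ln R else 0)"
  using assms by (simp add: pow_potential_def powr_mult ln_mult)

text \<open>
  The Euler-Lagrange condition: inside the support, the potential equals the quadratic confinement up
  to a constant, and outside it does not exceed it.  The lower bound serves to control the absolute
  value of the kernel.
\<close>

lemma minimizer_potential: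
  fixes a x :: "'a::euclidean_space"
  assumes \<beta>: "- real DIM('a) < \<beta>" "\<beta> < 2" "\<beta> < 4 - real DIM('a)"
  defines "V \<equiv> \<integral>y. pow_potential \<beta> (norm (x - y)) \<partial>minimizer \<beta> a"
  shows "integrable (minimizer \<beta> a) (\<lambda>y. pow_potential \<beta> (norm (x - y)))"
    and "norm (x - a) \<le> radius2 DIM('a) \<beta> \<Longrightarrow> V = minimizer_constant DIM('a) \<beta> + (norm (x - a))\<^sup>2 / 2"
    and "V \<le> minimizer_constant DIM('a) \<beta> + (norm (x - a))\<^sup>2 / 2"
    and "V \<ge> minimizer_constant DIM('a) \<beta>"
proof -
  let ?R = "radius2 DIM('a) \<beta>" and ?M = "norm_const DIM('a) \<beta>" and ?g = "(2 - \<beta> - real DIM('a)) / 2" and ?d = "real DIM('a)"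
  let ?\<kappa> = "potential_offset ?d \<beta>"
  define L where "L = (if \<beta> = 0 then ln ?R else 0)"
  define z where "z = (1 / ?R) *\<^sub>R (x - a)"
  define C where "C = half_sphere_area DIM('a) * (Gamma (2 - (\<beta> + ?d) / 2) * Gamma ((\<beta> + ?d) / 2))"
  have R: "?R > 0" using \<beta> by (intro radius2_powr) auto
  have M: "?M > 0" using \<beta> by (intro norm_const_pos) auto
  have g: "?g > -1" using \<beta> by (simp add: field_simps)
  have Rb: "?R powr \<beta> * (C / ?M) = ?R\<^sup>2 * (?d / 2)"
  proof -
    have "?R powr \<beta> * (C / ?M) = ?R powr \<beta> * ?R powr (2 - \<beta>) * (?d / 2)"
    proof -
      have "C / ?M = ?R powr (2 - \<beta>) * (?d / 2)"
        unfolding C_def using \<beta> by (intro radius2_coefficient) auto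
      then show ?thesis by (simp only: mult.assoc)
    qed
    also have "?R powr \<beta> * ?R powr (2 - \<beta>) = ?R\<^sup>2" using R by (simp add: powr_add[symmetric])
    finally show ?thesis .
  qed
  define u where "u y = pow_potential \<beta> (norm (z - y)) * ball_weight ?g y" for y
  define v where "v y = pow_potential \<beta> (norm (x - (a + ?R *\<^sub>R y))) * ball_weight ?g y" for y
  have [measurable]: "u \<in> borel_measurable borel" "v \<in> borel_measurable borel" unfolding u_def v_def by measurable
  have w: "has_bochner_integral lborel (ball_weight ?g :: 'a \<Rightarrow> real) ?M"
    using has_bochner_integral_ball_weight[OF g, where 'a='a] norm_const_eq[of \<beta> "DIM('a)"] \<beta> by simp
  have uint: "integrable lborel u" unfolding u_def
    using has_bochner_integral_pow_potential_ball[of \<beta> z] pow_potential_outside_ball(1)[of \<beta> z] \<beta>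
    by (cases "norm z \<le> 1") (auto simp: has_bochner_integral_iff)
  have vu: "AE y in lborel. v y = ?R powr \<beta> * u y + L * ball_weight ?g y"
  proof (rule AE_mp[OF AE_lborel_singleton[of z]], rule AE_I2, rule impI)
    fix y assume "y \<noteq> z"
    have "x - (a + ?R *\<^sub>R y) = ?R *\<^sub>R (z - y)"
      using R by (simp add: z_def scaleR_diff_right)
    then have "norm (x - (a + ?R *\<^sub>R y)) = ?R * norm (z - y)" using R by simp
    moreover have "norm (z - y) > 0" using \<open>y \<noteq> z\<close> by simp
    ultimately show "v y = ?R powr \<beta> * u y + L * ball_weight ?g y"
      using R by (simp add: v_def u_def L_def pow_potential_scale distrib_right)
  qed
  have "integrable lborel (\<lambda>y. ?R powr \<beta> * u y + L * ball_weight ?g y)"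
    using uint w by (auto simp: has_bochner_integral_iff)
  then have vint: "integrable lborel v"
    using vu by (subst integrable_cong_AE) auto
  show "integrable (minimizer \<beta> a) (\<lambda>y. pow_potential \<beta> (norm (x - y)))"
    using vint \<beta> by (subst integrable_minimizer_iff) (auto simp: v_def[abs_def])
  have "V = (\<integral>y. v y \<partial>lborel) / ?M"
    unfolding V_def using \<beta> by (subst integrable_minimizer_iff) (auto simp: v_def[abs_def])
  also have "(\<integral>y. v y \<partial>lborel) = (\<integral>y. ?R powr \<beta> * u y + L * ball_weight ?g y \<partial>lborel)"
    using vu by (intro integral_cong_AE) auto
  also have "\<dots> = ?R powr \<beta> * (\<integral>y. u y \<partial>lborel) + L * ?M"
    using uint w by (simp add: has_bochner_integral_iff)
  finally have V: "V = ?R powr \<beta> * (\<integral>y. u y \<partial>lborel) / ?M + L" using M by (simp add: add_divide_distrib)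
  have val: "?R powr \<beta> * (C * s) / ?M + L = ?R\<^sup>2 * ?d / 2 * s + L" for s
  proof -
    have "?R powr \<beta> * (C * s) / ?M = (?R powr \<beta> * (C / ?M)) * s" by simp
    then show ?thesis unfolding Rb by simp
  qed
  have quad: "?R\<^sup>2 * ?d / 2 * (?\<kappa> + (norm z)\<^sup>2 / ?d) + L = minimizer_constant DIM('a) \<beta> + (norm (x - a))\<^sup>2 / 2"
  proof -
    have "(norm z)\<^sup>2 = (norm (x - a))\<^sup>2 / ?R\<^sup>2" using R by (simp add: z_def power_divide)
    then show ?thesis using R by (simp add: minimizer_constant_def L_def distrib_left)
  qed
  have mono: "?R powr \<beta> * s / ?M + L \<le> ?R powr \<beta> * t / ?M + L" if "s \<le> t" for s t
    using that M by (intro add_right_mono divide_right_mono mult_left_mono) auto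
  have nz: "norm (x - a) \<le> ?R \<longleftrightarrow> norm z \<le> 1"
    using R by (simp add: z_def)
  have eqV: "V = minimizer_constant DIM('a) \<beta> + (norm (x - a))\<^sup>2 / 2" if "norm z \<le> 1"
  proof -
    have "(\<integral>y. u y \<partial>lborel) = C * (?\<kappa> + (norm z)\<^sup>2 / ?d)"
      using has_bochner_integral_pow_potential_ball[OF \<beta>(1,3) that] by (simp add: has_bochner_integral_iff u_def C_def)
    then show ?thesis unfolding V by (simp only: val quad)
  qed
  then show "norm (x - a) \<le> ?R \<Longrightarrow> V = minimizer_constant DIM('a) \<beta> + (norm (x - a))\<^sup>2 / 2"
    using nz by simp
  have out: "(\<integral>y. u y \<partial>lborel) \<le> C * (?\<kappa> + (norm z)\<^sup>2 / ?d)" "(\<integral>y. u y \<partial>lborel) \<ge> C * ?\<kappa>" if "norm z > 1"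
    using pow_potential_outside_ball(2,3)[OF \<beta> that] by (simp_all add: u_def C_def)
  show "V \<le> minimizer_constant DIM('a) \<beta> + (norm (x - a))\<^sup>2 / 2"
  proof (cases "norm z \<le> 1")
    case False
    then have "V \<le> ?R powr \<beta> * (C * (?\<kappa> + (norm z)\<^sup>2 / ?d)) / ?M + L" unfolding V by (intro mono out) simp
    then show ?thesis unfolding val quad .
  qed (simp add: eqV)
  show "V \<ge> minimizer_constant DIM('a) \<beta>"
  proof (cases "norm z \<le> 1")
    case False
    then have "V \<ge> ?R powr \<beta> * (C * ?\<kappa>) / ?M + L" unfolding V by (intro mono out) simp
    then show ?thesis unfolding val by (simp add: minimizer_constant_def L_def)
  qed (simp add: eqV)
qed

section \<open>Conditional negative definiteness of the power kernel\<close>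

text \<open>
  Differentiate \<open>exp (- (t * v\<^sup>2))\<close> in \<open>v\<close> and integrate over \<open>t\<close> first: the Gamma integral is a multiple of
  \<open>v powr (\<beta> - 1)\<close>, the derivative of the power potential, and it converges at \<open>t = 0\<close> since \<open>\<beta> < 2\<close>.
\<close>

lemma nn_integral_kernel_difference:
  fixes \<beta> r s :: real
  assumes \<beta>: "\<beta> < 2" and r: "0 \<le> r" "r \<le> s"
  shows "(\<integral>\<^sup>+t\<in>{0<..}. ennreal ((exp (- (t * r\<^sup>2)) - exp (- (t * s\<^sup>2))) * t powr (- \<beta> / 2 - 1)) \<partial>lborel)
    = ennreal (2 * Gamma (1 - \<beta> / 2)) * (\<integral>\<^sup>+v\<in>{r..s}. ennreal (v powr (\<beta> - 1)) \<partial>lborel)"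
proof -
  have G: "Gamma (1 - \<beta> / 2) > 0" using \<beta> by simp
  have "(\<integral>\<^sup>+t\<in>{0<..}. ennreal ((exp (- (t * r\<^sup>2)) - exp (- (t * s\<^sup>2))) * t powr (- \<beta> / 2 - 1)) \<partial>lborel)
    = (\<integral>\<^sup>+t. \<integral>\<^sup>+v. ennreal (2 * v * t powr ((1 - \<beta> / 2) - 1) * exp (- (t * v\<^sup>2))) * indicator {r..s} v * indicator {0<..} t \<partial>lborel \<partial>lborel)"
    (is "integral\<^sup>N _ ?F = integral\<^sup>N _ ?G")
  proof (intro nn_integral_cong)
    fix t :: real
    show "?F t = ?G t"
    proof (cases "t > 0")
      case True
      have "(\<integral>\<^sup>+v. ennreal (2 * v * t powr ((1 - \<beta> / 2) - 1) * exp (- (t * v\<^sup>2))) * indicator {r..s} v \<partial>lborel)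
        = ennreal (- (t powr (- \<beta> / 2 - 1) * exp (- (t * s\<^sup>2))) - - (t powr (- \<beta> / 2 - 1) * exp (- (t * r\<^sup>2))))"
      proof (rule nn_integral_FTC_Icc)
        fix v assume v: "v \<in> {r..s}"
        have "t powr ((1 - \<beta> / 2) - 1) = t powr (- \<beta> / 2 - 1) * t"
          using True powr_add[of t "- \<beta> / 2 - 1" 1] by simp
        then show "((\<lambda>v. - (t powr (- \<beta> / 2 - 1) * exp (- (t * v\<^sup>2)))) has_real_derivative 2 * v * t powr ((1 - \<beta> / 2) - 1) * exp (- (t * v\<^sup>2))) (at v)"
          by (auto intro!: derivative_eq_intros)
        show "0 \<le> 2 * v * t powr ((1 - \<beta> / 2) - 1) * exp (- (t * v\<^sup>2))" using v r by simp
      qed (use r in auto)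
      then show ?thesis using True by (simp add: algebra_simps)
    qed auto
  qed
  also have "\<dots> = (\<integral>\<^sup>+v. \<integral>\<^sup>+t. ennreal (2 * v * t powr ((1 - \<beta> / 2) - 1) * exp (- (t * v\<^sup>2))) * indicator {r..s} v * indicator {0<..} t \<partial>lborel \<partial>lborel)"
    by (rule lborel_pair.Fubini') measurable
  also have "\<dots> = (\<integral>\<^sup>+v. ennreal (2 * Gamma (1 - \<beta> / 2)) * (ennreal (v powr (\<beta> - 1)) * indicator {r..s} v) \<partial>lborel)"
    (is "integral\<^sup>N _ ?F = integral\<^sup>N _ ?G")
  proof (rule nn_integral_cong_nonzero)
    fix v :: real assume v0: "v \<noteq> 0"
    show "?F v = ?G v"
    proof (cases "v \<in> {r..s}")
      case True
      then have v: "v > 0" using r v0 by auto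
      have "(\<integral>\<^sup>+t. ennreal (2 * v * t powr ((1 - \<beta> / 2) - 1) * exp (- (t * v\<^sup>2))) * indicator {r..s} v * indicator {0<..} t \<partial>lborel)
        = (\<integral>\<^sup>+t. ennreal (2 * v) * (ennreal (t powr ((1 - \<beta> / 2) - 1) * exp (- (t * v\<^sup>2))) * indicator {0<..} t) \<partial>lborel)"
        using True v by (intro nn_integral_cong) (auto simp: ennreal_mult[symmetric] mult_ac)
      also have "\<dots> = ennreal (2 * v) * ennreal (Gamma (1 - \<beta> / 2) * (v\<^sup>2) powr (- (1 - \<beta> / 2)))"
        using v \<beta> by (subst nn_integral_cmult, measurable, subst nn_integral_Gamma) auto
      also have "\<dots> = ennreal (2 * Gamma (1 - \<beta> / 2) * v powr (\<beta> - 1))"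
      proof -
        have "(v\<^sup>2) powr (- (1 - \<beta> / 2)) = v powr (2 * (- (1 - \<beta> / 2)))"
          using v by (simp add: powr_powr powr_numeral[symmetric] del: powr_numeral)
        also have "2 * (- (1 - \<beta> / 2)) = (\<beta> - 1) + (- 1)" by simp
        finally have "(v\<^sup>2) powr (- (1 - \<beta> / 2)) = v powr (\<beta> - 1) * v powr (- 1)"
          by (simp only: powr_add)
        moreover have "v powr (- 1) = 1 / v" using v by (simp add: powr_minus_divide)
        ultimately have "(v\<^sup>2) powr (- (1 - \<beta> / 2)) = v powr (\<beta> - 1) / v" by simp
        then show ?thesis using v G by (simp add: ennreal_mult[symmetric])
      qed
      finally show ?thesis using True G by (simp add: ennreal_mult)
    qed simp
  qed
  also have "\<dots> = ennreal (2 * Gamma (1 - \<beta> / 2)) * (\<integral>\<^sup>+v\<in>{r..s}. ennreal (v powr (\<beta> - 1)) \<partial>lborel)"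
    by (rule nn_integral_cmult) measurable
  finally show ?thesis .
qed

lemma pow_potential_increment:
  fixes \<beta> r s :: real
  assumes r: "0 < r \<or> r = 0 \<and> \<beta> > 0" "r \<le> s"
  shows "(\<integral>\<^sup>+v\<in>{r..s}. ennreal (v powr (\<beta> - 1)) \<partial>lborel) = ennreal (pow_potential \<beta> s - pow_potential \<beta> r)"
proof (cases "r > 0")
  case True
  show ?thesis
  proof (rule nn_integral_FTC_Icc)
    fix v assume "v \<in> {r..s}"
    then show "(pow_potential \<beta> has_real_derivative v powr (\<beta> - 1)) (at v)"
      using True by (intro pow_potential_deriv) auto
  qed (use r in auto)
next
  case False
  then have r0: "r = 0" and \<beta>: "\<beta> > 0" using r by auto
  have "((\<lambda>v. v powr (\<beta> - 1)) has_integral s powr ((\<beta> - 1) + 1) / ((\<beta> - 1) + 1)) {0..s}"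
    using \<beta> r r0 by (intro has_integral_powr_from_0) auto
  then have "(\<integral>\<^sup>+v\<in>{0..s}. ennreal (v powr (\<beta> - 1)) \<partial>lborel) = ennreal (s powr ((\<beta> - 1) + 1) / ((\<beta> - 1) + 1))"
    by (intro nn_integral_has_integral_lebesgue') auto
  then show ?thesis using r0 \<beta> by (simp add: pow_potential_def)
qed

definition gauss_kernel :: "real \<Rightarrow> real \<Rightarrow> real \<Rightarrow> real" where
  "gauss_kernel \<beta> r t = (exp (- (t * r\<^sup>2)) - exp (- t)) * t powr (- \<beta> / 2 - 1) * indicator {0<..} t"

lemma gauss_kernel_measurable [measurable]:
  "(\<lambda>(r, t). gauss_kernel \<beta> r t) \<in> borel_measurable (borel \<Otimes>\<^sub>M borel)"
  unfolding gauss_kernel_def by measurable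

text \<open>
  As a function of \<open>t\<close>, the kernel is nonnegative if \<open>r \<le> 1\<close> and nonpositive if \<open>r \<ge> 1\<close>, so that its
  integral and the integral of its absolute value agree up to sign.  Subtracting \<open>exp (- t)\<close> makes the
  integral converge at \<open>t = 0\<close> for every \<open>\<beta> < 2\<close>, while \<open>exp (- (t * r\<^sup>2))\<close> alone is integrable against the weight
  there only if \<open>\<beta> < 0\<close>.
\<close>

lemma has_bochner_integral_gauss_kernel:
  assumes \<beta>: "\<beta> < 2" and r: "0 < r \<or> r = 0 \<and> \<beta> > 0"
  shows "has_bochner_integral lborel (gauss_kernel \<beta> r) (2 * Gamma (1 - \<beta> / 2) * (pow_potential \<beta> 1 - pow_potential \<beta> r))"
    and "(\<integral>\<^sup>+t. ennreal \<bar>gauss_kernel \<beta> r t\<bar> \<partial>lborel) = ennreal (2 * Gamma (1 - \<beta> / 2) * \<bar>pow_potential \<beta> 1 - pow_potential \<beta> r\<bar>)"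
proof -
  have G: "Gamma (1 - \<beta> / 2) > 0" using \<beta> by simp
  have [measurable]: "gauss_kernel \<beta> r \<in> borel_measurable borel" unfolding gauss_kernel_def by measurable
  have "has_bochner_integral lborel (gauss_kernel \<beta> r) (2 * Gamma (1 - \<beta> / 2) * (pow_potential \<beta> 1 - pow_potential \<beta> r)) \<and>
    (\<integral>\<^sup>+t. ennreal \<bar>gauss_kernel \<beta> r t\<bar> \<partial>lborel) = ennreal (2 * Gamma (1 - \<beta> / 2) * \<bar>pow_potential \<beta> 1 - pow_potential \<beta> r\<bar>)"
  proof (cases "r \<le> 1")
    case True
    have "r\<^sup>2 \<le> 1" using r True by (intro power_le_one) auto
    then have nn: "gauss_kernel \<beta> r t \<ge> 0" for t
      by (cases "t > 0") (auto simp: gauss_kernel_def mult_left_le)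
    have "(\<integral>\<^sup>+t. ennreal (gauss_kernel \<beta> r t) \<partial>lborel) = (\<integral>\<^sup>+t\<in>{0<..}. ennreal ((exp (- (t * r\<^sup>2)) - exp (- (t * 1\<^sup>2))) * t powr (- \<beta> / 2 - 1)) \<partial>lborel)"
      by (intro nn_integral_cong) (auto simp: gauss_kernel_def indicator_def)
    also have "\<dots> = ennreal (2 * Gamma (1 - \<beta> / 2)) * (\<integral>\<^sup>+v\<in>{r..1}. ennreal (v powr (\<beta> - 1)) \<partial>lborel)"
      using r True by (intro nn_integral_kernel_difference \<beta>) auto
    also have "\<dots> = ennreal (2 * Gamma (1 - \<beta> / 2)) * ennreal (pow_potential \<beta> 1 - pow_potential \<beta> r)"
      using pow_potential_increment[OF r True] by simp
    finally have I: "(\<integral>\<^sup>+t. ennreal (gauss_kernel \<beta> r t) \<partial>lborel) = ennreal (2 * Gamma (1 - \<beta> / 2) * (pow_potential \<beta> 1 - pow_potential \<beta> r))"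
      using G by (simp add: ennreal_mult')
    have mono: "pow_potential \<beta> 1 - pow_potential \<beta> r \<ge> 0"
      using pow_potential_mono'[OF r True] by simp
    show ?thesis using I nn G mono by (auto intro!: has_bochner_integral_nn_integral)
  next
    case False
    then have r1: "1 \<le> r" by simp
    have "1 \<le> r\<^sup>2" using r1 by simp
    then have nn: "gauss_kernel \<beta> r t \<le> 0" for t
      by (cases "t > 0") (auto simp: gauss_kernel_def mult_le_0_iff)
    have "(\<integral>\<^sup>+t. ennreal (- gauss_kernel \<beta> r t) \<partial>lborel) = (\<integral>\<^sup>+t\<in>{0<..}. ennreal ((exp (- (t * 1\<^sup>2)) - exp (- (t * r\<^sup>2))) * t powr (- \<beta> / 2 - 1)) \<partial>lborel)"
      by (intro nn_integral_cong) (auto simp: gauss_kernel_def indicator_def algebra_simps)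
    also have "\<dots> = ennreal (2 * Gamma (1 - \<beta> / 2)) * (\<integral>\<^sup>+v\<in>{1..r}. ennreal (v powr (\<beta> - 1)) \<partial>lborel)"
      using r1 by (intro nn_integral_kernel_difference \<beta>) auto
    also have "\<dots> = ennreal (2 * Gamma (1 - \<beta> / 2)) * ennreal (pow_potential \<beta> r - pow_potential \<beta> 1)"
      using pow_potential_increment[of 1 \<beta> r] r1 by simp
    finally have I: "(\<integral>\<^sup>+t. ennreal (- gauss_kernel \<beta> r t) \<partial>lborel) = ennreal (2 * Gamma (1 - \<beta> / 2) * (pow_potential \<beta> r - pow_potential \<beta> 1))"
      using G by (simp add: ennreal_mult')
    have mono: "pow_potential \<beta> r - pow_potential \<beta> 1 \<ge> 0"
      using pow_potential_mono'[of 1 \<beta> r] r1 by simp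
    have "has_bochner_integral lborel (\<lambda>t. - gauss_kernel \<beta> r t) (2 * Gamma (1 - \<beta> / 2) * (pow_potential \<beta> r - pow_potential \<beta> 1))"
      using I nn G mono by (intro has_bochner_integral_nn_integral) auto
    from has_bochner_integral_minus[OF this] show ?thesis
      using I nn mono by (simp add: algebra_simps)
  qed
  then show "has_bochner_integral lborel (gauss_kernel \<beta> r) (2 * Gamma (1 - \<beta> / 2) * (pow_potential \<beta> 1 - pow_potential \<beta> r))"
    "(\<integral>\<^sup>+t. ennreal \<bar>gauss_kernel \<beta> r t\<bar> \<partial>lborel) = ennreal (2 * Gamma (1 - \<beta> / 2) * \<bar>pow_potential \<beta> 1 - pow_potential \<beta> r\<bar>)"
    by auto
qed

text \<open>
  Fubini for the Gaussian mixture.  It applies because for each pair of points the integral of the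
  absolute value over \<open>t\<close> is a multiple of \<open>\<bar>pow_potential \<beta> 1 - pow_potential \<beta> r\<bar>\<close>, which is integrable.
\<close>

lemma kernel_energy_gaussian_mixture:
  fixes P :: "('a::euclidean_space \<times> 'a) measure"
  assumes "prob_space P" and [measurable_cong]: "sets P = sets (borel \<Otimes>\<^sub>M borel)" and \<beta>: "\<beta> < 2"
    and int: "integrable P (\<lambda>(x, y). pow_potential \<beta> (norm (x - y)))"
    and diag: "\<beta> \<le> 0 \<Longrightarrow> AE (x, y) in P. x \<noteq> y"
  shows "has_bochner_integral lborel (\<lambda>t. ((\<integral>z. exp (- (t * (norm (fst z - snd z))\<^sup>2)) \<partial>P) - exp (- t)) * t powr (- \<beta> / 2 - 1) * indicator {0<..} t)
    (2 * Gamma (1 - \<beta> / 2) * (pow_potential \<beta> 1 - (\<integral>(x, y). pow_potential \<beta> (norm (x - y)) \<partial>P)))"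
proof -
  interpret P: prob_space P by fact
  interpret pair_sigma_finite P lborel by standard
  define k where "k z t = gauss_kernel \<beta> (norm (fst z - snd z)) t" for z :: "'a \<times> 'a" and t
  have G: "Gamma (1 - \<beta> / 2) > 0" using \<beta> by simp
  have ms: "sets (P \<Otimes>\<^sub>M lborel) = sets ((borel \<Otimes>\<^sub>M borel) \<Otimes>\<^sub>M borel)"
    by (intro sets_pair_measure_cong) (auto simp: assms(2))
  have [measurable]: "(\<lambda>(z, t). k z t) \<in> borel_measurable ((borel \<Otimes>\<^sub>M borel) \<Otimes>\<^sub>M borel)"
    unfolding k_def gauss_kernel_def by measurable
  have km: "(\<lambda>(z, t). k z t) \<in> borel_measurable (P \<Otimes>\<^sub>M lborel)"
    by (subst measurable_cong_sets[OF ms refl]) measurable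
  have int': "integrable P (\<lambda>z. pow_potential \<beta> (norm (fst z - snd z)))"
    using int by (simp add: case_prod_beta')
  have good: "AE z in P. 0 < norm (fst z - snd z) \<or> norm (fst z - snd z) = 0 \<and> \<beta> > 0"
  proof (cases "\<beta> > 0")
    case True
    then show ?thesis by simp
  next
    case False
    then show ?thesis using diag by (auto simp: case_prod_beta')
  qed
  have [measurable]: "k z \<in> borel_measurable borel" for z unfolding k_def gauss_kernel_def by measurable
  have kint: "integrable (P \<Otimes>\<^sub>M lborel) (\<lambda>(z, t). k z t)"
  proof (rule Fubini_integrable[OF km])
    have "integrable P (\<lambda>z. 2 * Gamma (1 - \<beta> / 2) * \<bar>pow_potential \<beta> 1 - pow_potential \<beta> (norm (fst z - snd z))\<bar>)"
      using int' by (intro integrable_mult_right integrable_abs Bochner_Integration.integrable_diff P.integrable_const)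
    moreover have "AE z in P. 2 * Gamma (1 - \<beta> / 2) * \<bar>pow_potential \<beta> 1 - pow_potential \<beta> (norm (fst z - snd z))\<bar> = (\<integral>t. norm (case (z, t) of (z, t) \<Rightarrow> k z t) \<partial>lborel)"
      using good
    proof eventually_elim
      case (elim z)
      have "(\<integral>t. \<bar>k z t\<bar> \<partial>lborel) = enn2real (\<integral>\<^sup>+t. ennreal \<bar>k z t\<bar> \<partial>lborel)"
        by (rule integral_eq_nn_integral) auto
      then show ?case
        using has_bochner_integral_gauss_kernel(2)[OF \<beta> elim] G by (simp add: k_def)
    qed
    ultimately show "integrable P (\<lambda>z. \<integral>t. norm (case (z, t) of (z, t) \<Rightarrow> k z t) \<partial>lborel)"
      by (subst (asm) integrable_cong_AE) (use km in auto)
    show "AE z in P. integrable lborel (\<lambda>t. case (z, t) of (z, t) \<Rightarrow> k z t)"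
      using good
    proof eventually_elim
      case (elim z)
      then show ?case using has_bochner_integral_gauss_kernel(1)[OF \<beta> elim] by (simp add: k_def has_bochner_integral_iff)
    qed
  qed
  have eq: "(\<integral>z. k z t \<partial>P) = ((\<integral>z. exp (- (t * (norm (fst z - snd z))\<^sup>2)) \<partial>P) - exp (- t)) * t powr (- \<beta> / 2 - 1) * indicator {0<..} t" for t
  proof (cases "t > 0")
    case True
    have "integrable P (\<lambda>z. exp (- (t * (norm (fst z - snd z))\<^sup>2)))"
      using True by (intro P.integrable_const_bound[where B=1]) auto
    then show ?thesis using True
      by (simp add: k_def gauss_kernel_def P.prob_space)
  qed (simp add: k_def gauss_kernel_def)
  have "(\<integral>t. (\<integral>z. k z t \<partial>P) \<partial>lborel) = (\<integral>z. (\<integral>t. k z t \<partial>lborel) \<partial>P)"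
    by (rule Fubini_integral[OF kint])
  also have "\<dots> = (\<integral>z. 2 * Gamma (1 - \<beta> / 2) * (pow_potential \<beta> 1 - pow_potential \<beta> (norm (fst z - snd z))) \<partial>P)"
  proof (rule integral_cong_AE)
    show "AE z in P. (\<integral>t. k z t \<partial>lborel) = 2 * Gamma (1 - \<beta> / 2) * (pow_potential \<beta> 1 - pow_potential \<beta> (norm (fst z - snd z)))"
      using good
    proof eventually_elim
      case (elim z)
      then show ?case using has_bochner_integral_gauss_kernel(1)[OF \<beta> elim] by (simp add: k_def has_bochner_integral_iff)
    qed
    show "(\<lambda>z. \<integral>t. k z t \<partial>lborel) \<in> borel_measurable P"
      using integrable_fst'[OF kint] by auto
  qed (use int' in auto)
  also have "\<dots> = 2 * Gamma (1 - \<beta> / 2) * (pow_potential \<beta> 1 - (\<integral>z. pow_potential \<beta> (norm (fst z - snd z)) \<partial>P))"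
    using int' by (simp add: P.prob_space)
  finally have "(\<integral>t. (\<integral>z. k z t \<partial>P) \<partial>lborel) = 2 * Gamma (1 - \<beta> / 2) * (pow_potential \<beta> 1 - (\<integral>(x, y). pow_potential \<beta> (norm (x - y)) \<partial>P))"
    by (simp add: case_prod_beta')
  moreover have "integrable lborel (\<lambda>t. \<integral>z. k z t \<partial>P)"
    by (rule integrable_snd[OF kint])
  ultimately show ?thesis by (simp add: eq has_bochner_integral_iff)
qed

subsection \<open>Gaussian smoothing\<close>

text \<open>
  The exponent carries \<open>2 * t\<close> so that the correlation of two such Gaussians is a Gaussian with
  parameter \<open>t\<close>.
\<close>

definition gauss_smooth :: "real \<Rightarrow> 'a::euclidean_space measure \<Rightarrow> 'a \<Rightarrow> real" where
  "gauss_smooth t P z = (\<integral>x. exp (- (2 * t * (norm (x - z))\<^sup>2)) \<partial>P)"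

text \<open>
  By the parallelogram identity,
  \<open>2 t |x - z|\<^sup>2 + 2 t |y - z|\<^sup>2 = t |x - y|\<^sup>2 + 4 t |z - m|\<^sup>2\<close> for the midpoint \<open>m\<close> of \<open>x\<close> and \<open>y\<close>.
\<close>

lemma gaussian_product_integral:
  fixes x y :: "'a::euclidean_space"
  assumes t: "t > 0"
  shows "(\<integral>\<^sup>+z. ennreal (exp (- (2 * t * (norm (x - z))\<^sup>2)) * exp (- (2 * t * (norm (y - z))\<^sup>2))) \<partial>lborel)
    = ennreal ((1 / (2 * sqrt t)) ^ DIM('a) * pi powr (real DIM('a) / 2) * exp (- (t * (norm (x - y))\<^sup>2)))"
proof -
  define c where "c = 1 / (2 * sqrt t)"
  define m where "m = (1 / 2) *\<^sub>R (x + y)"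
  have c: "c > 0" using t by (simp add: c_def)
  have c2: "4 * t * c\<^sup>2 = 1" using t by (simp add: c_def power_divide power_mult_distrib)
  have id: "2 * t * (norm (x - (m + c *\<^sub>R w)))\<^sup>2 + 2 * t * (norm (y - (m + c *\<^sub>R w)))\<^sup>2 = t * (norm (x - y))\<^sup>2 + (norm w)\<^sup>2" for w
  proof -
    have "2 * t * (norm (x - (m + c *\<^sub>R w)))\<^sup>2 + 2 * t * (norm (y - (m + c *\<^sub>R w)))\<^sup>2 = t * (norm (x - y))\<^sup>2 + 4 * t * c\<^sup>2 * (norm w)\<^sup>2"
      unfolding m_def power2_norm_eq_inner
      by (simp add: inner_diff inner_add inner_commute power2_eq_square algebra_simps)
    then show ?thesis by (simp only: c2 mult_1)
  qed
  have "(\<integral>\<^sup>+z. ennreal (exp (- (2 * t * (norm (x - z))\<^sup>2)) * exp (- (2 * t * (norm (y - z))\<^sup>2))) \<partial>lborel)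
    = ennreal (\<bar>c\<bar> ^ DIM('a)) * (\<integral>\<^sup>+w. ennreal (exp (- (2 * t * (norm (x - (m + c *\<^sub>R w)))\<^sup>2)) * exp (- (2 * t * (norm (y - (m + c *\<^sub>R w)))\<^sup>2))) \<partial>lborel)"
    using c by (intro nn_integral_lborel_affine) auto
  also have "(\<integral>\<^sup>+w. ennreal (exp (- (2 * t * (norm (x - (m + c *\<^sub>R w)))\<^sup>2)) * exp (- (2 * t * (norm (y - (m + c *\<^sub>R w)))\<^sup>2))) \<partial>lborel)
     = (\<integral>\<^sup>+w. ennreal (exp (- (t * (norm (x - y))\<^sup>2))) * ennreal (exp (- (norm w)\<^sup>2)) \<partial>(lborel :: 'a measure))"
    (is "integral\<^sup>N _ ?F = integral\<^sup>N _ ?G")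
  proof (intro nn_integral_cong)
    fix w :: 'a
    have "exp (- (2 * t * (norm (x - (m + c *\<^sub>R w)))\<^sup>2)) * exp (- (2 * t * (norm (y - (m + c *\<^sub>R w)))\<^sup>2))
      = exp (- (2 * t * (norm (x - (m + c *\<^sub>R w)))\<^sup>2 + 2 * t * (norm (y - (m + c *\<^sub>R w)))\<^sup>2))"
      by (simp add: exp_add[symmetric])
    also have "\<dots> = exp (- (t * (norm (x - y))\<^sup>2)) * exp (- (norm w)\<^sup>2)"
      unfolding id by (simp add: exp_add[symmetric])
    finally show "?F w = ?G w"
      by (simp only: ennreal_mult exp_ge_zero)
  qed
  also have "\<dots> = ennreal (exp (- (t * (norm (x - y))\<^sup>2))) * ennreal (pi powr (real DIM('a) / 2))"
    by (subst nn_integral_cmult) (auto simp: nn_integral_gaussian)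
  also have "ennreal (\<bar>c\<bar> ^ DIM('a)) * (ennreal (exp (- (t * (norm (x - y))\<^sup>2))) * ennreal (pi powr (real DIM('a) / 2))) = ennreal (c ^ DIM('a) * pi powr (real DIM('a) / 2) * exp (- (t * (norm (x - y))\<^sup>2)))"
    using c by (intro ennreal_mult3_eqI) auto
  finally show ?thesis by (simp only: c_def)
qed

lemma gauss_smooth_nonneg: "gauss_smooth t P z \<ge> 0"
  unfolding gauss_smooth_def by (intro integral_nonneg_AE) auto

lemma gauss_smooth_eq_nn_integral:
  fixes P :: "'a::euclidean_space measure"
  assumes "prob_space P" "sets P = sets borel" "t > 0"
  shows "ennreal (gauss_smooth t P z) = (\<integral>\<^sup>+x. ennreal (exp (- (2 * t * (norm (x - z))\<^sup>2))) \<partial>P)"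
proof -
  interpret P: prob_space P by fact
  note assms(2)[measurable_cong]
  have "integrable P (\<lambda>x. exp (- (2 * t * (norm (x - z))\<^sup>2)))"
    using assms(3) by (intro P.integrable_const_bound[where B=1]) auto
  then show ?thesis unfolding gauss_smooth_def by (subst nn_integral_eq_integral) auto
qed

lemma gauss_smooth_measurable:
  fixes P :: "'a::euclidean_space measure"
  assumes "prob_space P" "sets P = sets borel" "t > 0"
  shows "gauss_smooth t P \<in> borel_measurable borel"
proof -
  interpret P: prob_space P by fact
  note assms(2)[measurable_cong]
  have "(\<lambda>z. \<integral>x. exp (- (2 * t * (norm (x - z))\<^sup>2)) \<partial>P) \<in> borel_measurable borel"
    by (rule P.borel_measurable_lebesgue_integral) measurable
  then show ?thesis unfolding gauss_smooth_def[abs_def] .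
qed

lemma has_bochner_integral_gauss_smooth_mult:
  fixes P Q :: "'a::euclidean_space measure"
  assumes P: "prob_space P" "sets P = sets borel" and Q: "prob_space Q" "sets Q = sets borel" and t: "t > 0"
  shows "has_bochner_integral lborel (\<lambda>z. gauss_smooth t P z * gauss_smooth t Q z)
    ((1 / (2 * sqrt t)) ^ DIM('a) * pi powr (real DIM('a) / 2) * (\<integral>z. exp (- (t * (norm (fst z - snd z))\<^sup>2)) \<partial>(P \<Otimes>\<^sub>M Q)))"
proof (rule has_bochner_integral_nn_integral)
  interpret P: prob_space P by fact
  interpret Q: prob_space Q by fact
  interpret PQ: pair_prob_space P Q by standard
  interpret L: pair_sigma_finite "P \<Otimes>\<^sub>M Q" "lborel :: 'a measure" by standard
  note P(2)[measurable_cong] Q(2)[measurable_cong]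
  let ?N = "(1 / (2 * sqrt t)) ^ DIM('a) * pi powr (real DIM('a) / 2)"
  have N: "?N \<ge> 0" using t by (intro mult_nonneg_nonneg zero_le_power) auto
  have [measurable]: "gauss_smooth t P \<in> borel_measurable borel" "gauss_smooth t Q \<in> borel_measurable borel"
    using P Q t by (auto intro: gauss_smooth_measurable)
  show "(\<lambda>z. gauss_smooth t P z * gauss_smooth t Q z) \<in> borel_measurable lborel" by measurable
  show "AE z in lborel. 0 \<le> gauss_smooth t P z * gauss_smooth t Q z" by (simp add: gauss_smooth_nonneg)
  show "0 \<le> ?N * (\<integral>z. exp (- (t * (norm (fst z - snd z))\<^sup>2)) \<partial>(P \<Otimes>\<^sub>M Q))"
    by (rule mult_nonneg_nonneg[OF N], rule integral_nonneg_AE) auto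
  have "(\<integral>\<^sup>+z. ennreal (gauss_smooth t P z * gauss_smooth t Q z) \<partial>lborel)
    = (\<integral>\<^sup>+z. \<integral>\<^sup>+xy. ennreal (exp (- (2 * t * (norm (fst xy - z))\<^sup>2)) * exp (- (2 * t * (norm (snd xy - z))\<^sup>2))) \<partial>(P \<Otimes>\<^sub>M Q) \<partial>lborel)"
    (is "integral\<^sup>N _ ?F = integral\<^sup>N _ ?G")
  proof (intro nn_integral_cong)
    fix z :: 'a
    have "(\<integral>\<^sup>+xy. ennreal (exp (- (2 * t * (norm (fst xy - z))\<^sup>2)) * exp (- (2 * t * (norm (snd xy - z))\<^sup>2))) \<partial>(P \<Otimes>\<^sub>M Q))
      = (\<integral>\<^sup>+x. \<integral>\<^sup>+y. ennreal (exp (- (2 * t * (norm (x - z))\<^sup>2))) * ennreal (exp (- (2 * t * (norm (y - z))\<^sup>2))) \<partial>Q \<partial>P)"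
      by (subst Q.nn_integral_fst[symmetric]) (auto simp: ennreal_mult)
    also have "\<dots> = ennreal (gauss_smooth t P z) * ennreal (gauss_smooth t Q z)"
      by (subst nn_integral_cmult, measurable, subst nn_integral_multc, measurable)
        (simp add: gauss_smooth_eq_nn_integral P Q t)
    finally show "?F z = ?G z"
      by (simp add: ennreal_mult gauss_smooth_nonneg)
  qed
  also have "\<dots> = (\<integral>\<^sup>+xy. \<integral>\<^sup>+z. ennreal (exp (- (2 * t * (norm (fst xy - z))\<^sup>2)) * exp (- (2 * t * (norm (snd xy - z))\<^sup>2))) \<partial>lborel \<partial>(P \<Otimes>\<^sub>M Q))"
    by (rule L.Fubini') measurable
  also have "\<dots> = (\<integral>\<^sup>+xy. ennreal (?N * exp (- (t * (norm (fst xy - snd xy))\<^sup>2))) \<partial>(P \<Otimes>\<^sub>M Q))"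
    by (simp only: gaussian_product_integral[OF t])
  also have "\<dots> = ennreal (\<integral>xy. ?N * exp (- (t * (norm (fst xy - snd xy))\<^sup>2)) \<partial>(P \<Otimes>\<^sub>M Q))"
    using N t by (intro nn_integral_eq_integral integrable_mult_right PQ.integrable_const_bound[where B=1]) auto
  finally show "(\<integral>\<^sup>+z. ennreal (gauss_smooth t P z * gauss_smooth t Q z) \<partial>lborel)
    = ennreal (?N * (\<integral>z. exp (- (t * (norm (fst z - snd z))\<^sup>2)) \<partial>(P \<Otimes>\<^sub>M Q)))"
    by simp
qed

text \<open>
  Indicators of closed sets are decreasing limits of continuous functions of the distance to the set.
\<close>

lemma measure_eqI_continuous:
  fixes P Q :: "'a::metric_space measure"
  assumes P: "prob_space P" "sets P = sets borel" and Q: "prob_space Q" "sets Q = sets borel"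
    and eq: "\<And>f. continuous_on UNIV f \<Longrightarrow> (\<And>x. 0 \<le> f x) \<Longrightarrow> (\<And>x. f x \<le> (1 :: real)) \<Longrightarrow> (\<integral>\<^sup>+x. ennreal (f x) \<partial>P) = (\<integral>\<^sup>+x. ennreal (f x) \<partial>Q)"
  shows "P = Q"
proof (rule measure_eqI_generator_eq[where E="Collect closed" and \<Omega>=UNIV and A="\<lambda>_. UNIV"])
  interpret P: prob_space P by fact
  interpret Q: prob_space Q by fact
  note P(2)[measurable_cong] Q(2)[measurable_cong]
  show "Int_stable (Collect closed)" by (auto simp: Int_stable_def)
  show "sets P = sigma_sets UNIV (Collect closed)" "sets Q = sigma_sets UNIV (Collect closed)"
    using P(2) Q(2) by (simp_all add: borel_eq_closed)
  show "emeasure P UNIV \<noteq> \<infinity>" using P.emeasure_finite by simp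
  fix A :: "'a set" assume "A \<in> Collect closed"
  then have A: "closed A" by simp
  show "emeasure P A = emeasure Q A"
  proof (cases "A = {}")
    case False
    define f where "f k x = max 0 (1 - real k * infdist x A)" for k x
    have cont: "continuous_on UNIV (f k)" for k unfolding f_def by (intro continuous_intros)
    have [measurable]: "f k \<in> borel_measurable borel" for k using cont by (rule borel_measurable_continuous_onI)
    have lim: "(\<lambda>k. ennreal (f k x)) \<longlonglongrightarrow> indicator A x" for x
    proof (cases "x \<in> A")
      case True
      then show ?thesis using False by (simp add: f_def)
    next
      case out: False
      then have pos: "infdist x A > 0" using in_closed_iff_infdist_zero[OF A False] infdist_nonneg[of x A] by (simp add: less_le)
      obtain K where K: "1 / infdist x A < real K" using reals_Archimedean2 by blast
      have "ennreal (f k x) = 0" if "k \<ge> K" for k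
      proof -
        have "1 / infdist x A \<le> real k" using K that by linarith
        then have "1 \<le> real k * infdist x A" using pos by (simp add: field_simps)
        then show ?thesis by (simp add: f_def)
      qed
      then have "eventually (\<lambda>k. ennreal (f k x) = 0) sequentially" by (auto simp: eventually_sequentially)
      then show ?thesis using out by (simp add: tendsto_eventually)
    qed
    have conv: "(\<lambda>k. \<integral>\<^sup>+x. ennreal (f k x) \<partial>M) \<longlonglongrightarrow> emeasure M A" if "prob_space M" "sets M = sets borel" for M
    proof -
      interpret M: prob_space M by fact
      note that(2)[measurable_cong]
      have [measurable]: "A \<in> sets borel" using A by simp
      have "(\<lambda>k. \<integral>\<^sup>+x. ennreal (f k x) \<partial>M) \<longlonglongrightarrow> (\<integral>\<^sup>+x. indicator A x \<partial>M)"
      proof (rule nn_integral_dominated_convergence[where w="\<lambda>_. 1"])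
        show "AE x in M. ennreal (f k x) \<le> 1" for k
          by (auto simp: f_def infdist_nonneg ennreal_le_1)
        show "AE x in M. (\<lambda>k. ennreal (f k x)) \<longlonglongrightarrow> indicator A x" using lim by simp
      qed (auto simp: M.emeasure_space_1)
      then show ?thesis using A that by simp
    qed
    have "(\<integral>\<^sup>+x. ennreal (f k x) \<partial>P) = (\<integral>\<^sup>+x. ennreal (f k x) \<partial>Q)" for k
      by (intro eq cont) (auto simp: f_def infdist_nonneg)
    then have "(\<lambda>k. \<integral>\<^sup>+x. ennreal (f k x) \<partial>P) \<longlonglongrightarrow> emeasure Q A" using conv[OF Q] by simp
    then show ?thesis using conv[OF P] by (rule LIMSEQ_unique[rotated])
  qed simp
qed auto

lemma nn_integral_gauss_smooth:
  fixes P :: "'a::euclidean_space measure"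
  assumes P: "prob_space P" "sets P = sets borel" and t: "t > 0" and [measurable]: "f \<in> borel_measurable borel"
  defines "c \<equiv> 1 / sqrt (2 * t)"
  shows "(\<integral>\<^sup>+z. ennreal (f z) * ennreal (gauss_smooth t P z) \<partial>lborel)
    = ennreal (c ^ DIM('a)) * (\<integral>\<^sup>+x. \<integral>\<^sup>+w. ennreal (f (x + c *\<^sub>R w)) * ennreal (exp (- (norm w)\<^sup>2)) \<partial>lborel \<partial>P)"
proof -
  interpret P: prob_space P by fact
  interpret pair_sigma_finite P "lborel :: 'a measure" by standard
  note P(2)[measurable_cong]
  have c: "c > 0" using t by (simp add: c_def)
  have c2: "2 * t * c\<^sup>2 = 1" using t by (simp add: c_def power_divide)
  have "(\<integral>\<^sup>+z. ennreal (f z) * ennreal (gauss_smooth t P z) \<partial>lborel)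
    = (\<integral>\<^sup>+z. \<integral>\<^sup>+x. ennreal (f z) * ennreal (exp (- (2 * t * (norm (x - z))\<^sup>2))) \<partial>P \<partial>lborel)"
    by (subst nn_integral_cmult) (auto simp: gauss_smooth_eq_nn_integral[OF P t])
  also have "\<dots> = (\<integral>\<^sup>+x. \<integral>\<^sup>+z. ennreal (f z) * ennreal (exp (- (2 * t * (norm (x - z))\<^sup>2))) \<partial>lborel \<partial>P)"
    by (rule Fubini') measurable
  also have "\<dots> = (\<integral>\<^sup>+x. ennreal (c ^ DIM('a)) * (\<integral>\<^sup>+w. ennreal (f (x + c *\<^sub>R w)) * ennreal (exp (- (norm w)\<^sup>2)) \<partial>lborel) \<partial>P)"
    (is "integral\<^sup>N _ ?F = integral\<^sup>N _ ?G")
  proof (intro nn_integral_cong)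
    fix x :: 'a
    have "2 * t * (norm (x - (x + c *\<^sub>R w)))\<^sup>2 = (norm w)\<^sup>2" for w :: 'a
    proof -
      have "2 * t * (norm (x - (x + c *\<^sub>R w)))\<^sup>2 = 2 * t * c\<^sup>2 * (norm w)\<^sup>2" by (simp add: power_mult_distrib)
      then show ?thesis by (simp only: c2 mult_1)
    qed
    moreover have "(\<integral>\<^sup>+z. ennreal (f z) * ennreal (exp (- (2 * t * (norm (x - z))\<^sup>2))) \<partial>lborel) =
      ennreal (\<bar>c\<bar> ^ DIM('a)) * (\<integral>\<^sup>+w. ennreal (f (x + c *\<^sub>R w)) * ennreal (exp (- (2 * t * (norm (x - (x + c *\<^sub>R w)))\<^sup>2))) \<partial>lborel)"
      using c by (intro nn_integral_lborel_affine) auto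
    ultimately show "?F x = ?G x"
      using c by (simp only: abs_of_pos)
  qed
  also have "\<dots> = ennreal (c ^ DIM('a)) * (\<integral>\<^sup>+x. \<integral>\<^sup>+w. ennreal (f (x + c *\<^sub>R w)) * ennreal (exp (- (norm w)\<^sup>2)) \<partial>lborel \<partial>P)"
    by (rule nn_integral_cmult) measurable
  finally show ?thesis .
qed

text \<open>
  Gaussians of shrinking width form an approximate identity.
\<close>

lemma gauss_smooth_limit:
  fixes P :: "'a::euclidean_space measure"
  assumes P: "prob_space P" "sets P = sets borel"
    and f: "continuous_on UNIV f" "\<And>x. 0 \<le> f x" "\<And>x. f x \<le> (1 :: real)" and c: "c \<longlonglongrightarrow> (0 :: real)"
  shows "(\<lambda>n. \<integral>\<^sup>+x. \<integral>\<^sup>+w. ennreal (f (x + c n *\<^sub>R w)) * ennreal (exp (- (norm w)\<^sup>2)) \<partial>lborel \<partial>P)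
    \<longlonglongrightarrow> (\<integral>\<^sup>+x. ennreal (f x) \<partial>P) * ennreal (pi powr (real DIM('a) / 2))"
proof -
  interpret P: prob_space P by fact
  note P(2)[measurable_cong]
  have [measurable]: "f \<in> borel_measurable borel" using f(1) by (rule borel_measurable_continuous_onI)
  have inner: "(\<lambda>n. \<integral>\<^sup>+w. ennreal (f (x + c n *\<^sub>R w)) * ennreal (exp (- (norm w)\<^sup>2)) \<partial>lborel)
    \<longlonglongrightarrow> (\<integral>\<^sup>+w. ennreal (f x) * ennreal (exp (- (norm w)\<^sup>2)) \<partial>(lborel :: 'a measure))" for x :: 'a
  proof (rule nn_integral_dominated_convergence[where w="\<lambda>w :: 'a. ennreal (exp (- (norm w)\<^sup>2))"])
    show "AE w in lborel. ennreal (f (x + c n *\<^sub>R w)) * ennreal (exp (- (norm w)\<^sup>2)) \<le> ennreal (exp (- (norm w)\<^sup>2))" for n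
      using f by (intro always_eventually allI) (auto simp: ennreal_mult[symmetric] mult_left_le_one_le intro!: ennreal_leI)
    show "(\<integral>\<^sup>+w. ennreal (exp (- (norm w)\<^sup>2)) \<partial>(lborel :: 'a measure)) < \<infinity>" by (simp add: nn_integral_gaussian)
    show "AE w in lborel. (\<lambda>n. ennreal (f (x + c n *\<^sub>R w)) * ennreal (exp (- (norm w)\<^sup>2))) \<longlonglongrightarrow> ennreal (f x) * ennreal (exp (- (norm w)\<^sup>2))"
    proof (intro always_eventually allI)
      fix w :: 'a
      have "(\<lambda>n. x + c n *\<^sub>R w) \<longlonglongrightarrow> x + 0 *\<^sub>R w" by (intro tendsto_intros c)
      then have "(\<lambda>n. f (x + c n *\<^sub>R w)) \<longlonglongrightarrow> f x"
        using f(1) by (intro continuous_on_tendsto_compose[OF f(1)]) auto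
      then show "(\<lambda>n. ennreal (f (x + c n *\<^sub>R w)) * ennreal (exp (- (norm w)\<^sup>2))) \<longlonglongrightarrow> ennreal (f x) * ennreal (exp (- (norm w)\<^sup>2))"
        using f(2) by (auto simp: ennreal_mult[symmetric] intro!: tendsto_ennrealI tendsto_mult)
    qed
  qed auto
  have "(\<lambda>n. \<integral>\<^sup>+x. \<integral>\<^sup>+w. ennreal (f (x + c n *\<^sub>R w)) * ennreal (exp (- (norm w)\<^sup>2)) \<partial>lborel \<partial>P)
    \<longlonglongrightarrow> (\<integral>\<^sup>+x. \<integral>\<^sup>+w. ennreal (f x) * ennreal (exp (- (norm w)\<^sup>2)) \<partial>(lborel :: 'a measure) \<partial>P)"
  proof (rule nn_integral_dominated_convergence[where w="\<lambda>_. ennreal (pi powr (real DIM('a) / 2))"])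
    show "AE x in P. (\<integral>\<^sup>+w. ennreal (f (x + c n *\<^sub>R w)) * ennreal (exp (- (norm w)\<^sup>2)) \<partial>lborel) \<le> ennreal (pi powr (real DIM('a) / 2))" for n
      unfolding nn_integral_gaussian[where 'a='a, symmetric] using f
      by (intro always_eventually allI nn_integral_mono) (auto simp: ennreal_mult[symmetric] mult_left_le_one_le intro!: ennreal_leI)
    show "(\<integral>\<^sup>+x. ennreal (pi powr (real DIM('a) / 2)) \<partial>P) < \<infinity>" by (simp add: P.emeasure_space_1)
  qed (use inner in auto)
  also have "(\<integral>\<^sup>+x. \<integral>\<^sup>+w. ennreal (f x) * ennreal (exp (- (norm w)\<^sup>2)) \<partial>(lborel :: 'a measure) \<partial>P) = (\<integral>\<^sup>+x. ennreal (f x) \<partial>P) * ennreal (pi powr (real DIM('a) / 2))"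
    by (subst nn_integral_cmult, measurable, subst nn_integral_multc, measurable, simp only: nn_integral_gaussian)
  finally show ?thesis .
qed

text \<open>
  Integrating \<open>f\<close> against a smoothed measure means integrating the smoothed \<open>f\<close> against the measure.  As \<open>t n\<close> tends to
  infinity the width of the Gaussian tends to zero, and the integrals of \<open>f\<close> itself agree in the limit.
\<close>

lemma gauss_smooth_determines_measure:
  fixes P Q :: "'a::euclidean_space measure"
  assumes P: "prob_space P" "sets P = sets borel" and Q: "prob_space Q" "sets Q = sets borel"
    and t: "\<And>n. t n > real n" and eq: "\<And>n. AE z in lborel. gauss_smooth (t n) P z = gauss_smooth (t n) Q z"
  shows "P = Q"
proof (rule measure_eqI_continuous[OF P Q])
  fix f :: "'a \<Rightarrow> real" assume f: "continuous_on UNIV f" "\<And>x. 0 \<le> f x" "\<And>x. f x \<le> 1"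
  have [measurable]: "f \<in> borel_measurable borel" using f(1) by (rule borel_measurable_continuous_onI)
  define c where "c n = 1 / sqrt (2 * t n)" for n
  have tp: "t n > 0" for n using t[of n] by (meson le_less_trans of_nat_0_le_iff)
  have clim: "c \<longlonglongrightarrow> 0"
  proof -
    have "filterlim t at_top sequentially"
      by (rule filterlim_at_top_mono[OF filterlim_real_sequentially]) (auto intro!: always_eventually less_imp_le t)
    moreover have "((\<lambda>s :: real. 1 / sqrt (2 * s)) \<longlongrightarrow> 0) at_top" by real_asymp
    ultimately show ?thesis unfolding c_def[abs_def] by (rule filterlim_compose[rotated])
  qed
  have "(\<integral>\<^sup>+x. \<integral>\<^sup>+w. ennreal (f (x + c n *\<^sub>R w)) * ennreal (exp (- (norm w)\<^sup>2)) \<partial>lborel \<partial>P)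
    = (\<integral>\<^sup>+x. \<integral>\<^sup>+w. ennreal (f (x + c n *\<^sub>R w)) * ennreal (exp (- (norm w)\<^sup>2)) \<partial>lborel \<partial>Q)" (is "?A = ?B") for n
  proof -
    have cp: "c n > 0" using tp by (simp add: c_def)
    have "ennreal (c n ^ DIM('a)) * ?A = (\<integral>\<^sup>+z. ennreal (f z) * ennreal (gauss_smooth (t n) P z) \<partial>lborel)"
      unfolding c_def by (rule nn_integral_gauss_smooth[OF P tp, symmetric]) measurable
    also have "\<dots> = (\<integral>\<^sup>+z. ennreal (f z) * ennreal (gauss_smooth (t n) Q z) \<partial>lborel)"
      using eq[of n] by (intro nn_integral_cong_AE) auto
    also have "\<dots> = ennreal (c n ^ DIM('a)) * ?B"
      unfolding c_def by (rule nn_integral_gauss_smooth[OF Q tp]) measurable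
    finally show ?thesis using cp by (subst (asm) ennreal_mult_cancel_left) auto
  qed
  then have "(\<lambda>n. \<integral>\<^sup>+x. \<integral>\<^sup>+w. ennreal (f (x + c n *\<^sub>R w)) * ennreal (exp (- (norm w)\<^sup>2)) \<partial>lborel \<partial>P)
     \<longlonglongrightarrow> (\<integral>\<^sup>+x. ennreal (f x) \<partial>Q) * ennreal (pi powr (real DIM('a) / 2))"
    using gauss_smooth_limit[OF Q f clim] by simp
  then have "(\<integral>\<^sup>+x. ennreal (f x) \<partial>P) * ennreal (pi powr (real DIM('a) / 2)) = (\<integral>\<^sup>+x. ennreal (f x) \<partial>Q) * ennreal (pi powr (real DIM('a) / 2))"
    using gauss_smooth_limit[OF P f clim] LIMSEQ_unique by blast
  then show "(\<integral>\<^sup>+x. ennreal (f x) \<partial>P) = (\<integral>\<^sup>+x. ennreal (f x) \<partial>Q)"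
    by (subst (asm) (1 2) mult.commute, subst (asm) ennreal_mult_cancel_left) auto
qed

text \<open>
  In the Gaussian mixture the constants cancel because \<open>P\<close> and \<open>Q\<close> have the same mass, and
  \<open>2 J P Q - J P P - J Q Q\<close> becomes an integral over \<open>t\<close> of positive multiples of the squared
  \<open>L\<^sup>2\<close> distance between the Gaussian smoothings of \<open>P\<close> and \<open>Q\<close>.  If it vanishes, the smoothings agree for
  almost every \<open>t\<close>, in particular for arbitrarily large \<open>t\<close>.
\<close>

theorem pow_potential_negative_definite:
  fixes P Q :: "'a::euclidean_space measure" and \<beta> :: real
  assumes P: "prob_space P" "sets P = sets borel" and Q: "prob_space Q" "sets Q = sets borel" and \<beta>: "\<beta> < 2"
    and int: "integrable (P \<Otimes>\<^sub>M P) (\<lambda>(x, y). pow_potential \<beta> (norm (x - y)))"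
      "integrable (Q \<Otimes>\<^sub>M Q) (\<lambda>(x, y). pow_potential \<beta> (norm (x - y)))"
      "integrable (P \<Otimes>\<^sub>M Q) (\<lambda>(x, y). pow_potential \<beta> (norm (x - y)))"
    and diag: "\<beta> \<le> 0 \<Longrightarrow> AE (x, y) in P \<Otimes>\<^sub>M P. x \<noteq> y" "\<beta> \<le> 0 \<Longrightarrow> AE (x, y) in Q \<Otimes>\<^sub>M Q. x \<noteq> y"
      "\<beta> \<le> 0 \<Longrightarrow> AE (x, y) in P \<Otimes>\<^sub>M Q. x \<noteq> y"
  defines "J \<equiv> \<lambda>P Q :: 'a measure. \<integral>(x, y). pow_potential \<beta> (norm (x - y)) \<partial>(P \<Otimes>\<^sub>M Q)"
  shows "J P P + J Q Q \<le> 2 * J P Q" and "J P P + J Q Q = 2 * J P Q \<Longrightarrow> P = Q"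
proof -
  interpret P: prob_space P by fact
  interpret Q: prob_space Q by fact
  interpret PP: pair_prob_space P P by standard
  interpret QQ: pair_prob_space Q Q by standard
  interpret PQ: pair_prob_space P Q by standard
  have ps: "prob_space (P \<Otimes>\<^sub>M P)" "prob_space (Q \<Otimes>\<^sub>M Q)" "prob_space (P \<Otimes>\<^sub>M Q)" by unfold_locales
  have ss: "sets (P \<Otimes>\<^sub>M P) = sets (borel \<Otimes>\<^sub>M borel)" "sets (Q \<Otimes>\<^sub>M Q) = sets (borel \<Otimes>\<^sub>M borel)" "sets (P \<Otimes>\<^sub>M Q) = sets (borel \<Otimes>\<^sub>M borel)"
    using P(2) Q(2) by (auto intro!: sets_pair_measure_cong)
  have G: "Gamma (1 - \<beta> / 2) > 0" using \<beta> by simp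
  define E where "E t R = (\<integral>z. exp (- (t * (norm (fst z - snd z))\<^sup>2)) \<partial>R)" for t and R :: "('a \<times> 'a) measure"
  define D where "D t = E t (P \<Otimes>\<^sub>M P) + E t (Q \<Otimes>\<^sub>M Q) - 2 * E t (P \<Otimes>\<^sub>M Q)" for t
  define F where "F t = D t * t powr (- \<beta> / 2 - 1) * indicator {0<..} t" for t
  note mix = kernel_energy_gaussian_mixture[OF ps(1) ss(1) \<beta> int(1) diag(1)]
    kernel_energy_gaussian_mixture[OF ps(2) ss(2) \<beta> int(2) diag(2)]
    kernel_energy_gaussian_mixture[OF ps(3) ss(3) \<beta> int(3) diag(3)]
  let ?c = "2 * Gamma (1 - \<beta> / 2)"
  have "has_bochner_integral lborel (\<lambda>t. (E t (P \<Otimes>\<^sub>M P) - exp (- t)) * t powr (- \<beta> / 2 - 1) * indicator {0<..} t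
      + (E t (Q \<Otimes>\<^sub>M Q) - exp (- t)) * t powr (- \<beta> / 2 - 1) * indicator {0<..} t
      - 2 * ((E t (P \<Otimes>\<^sub>M Q) - exp (- t)) * t powr (- \<beta> / 2 - 1) * indicator {0<..} t))
      (?c * (pow_potential \<beta> 1 - J P P) + ?c * (pow_potential \<beta> 1 - J Q Q) - 2 * (?c * (pow_potential \<beta> 1 - J P Q)))"
    unfolding E_def J_def
    by (intro has_bochner_integral_add has_bochner_integral_diff has_bochner_integral_mult_right mix)
  also have "(\<lambda>t. (E t (P \<Otimes>\<^sub>M P) - exp (- t)) * t powr (- \<beta> / 2 - 1) * indicator {0<..} t
      + (E t (Q \<Otimes>\<^sub>M Q) - exp (- t)) * t powr (- \<beta> / 2 - 1) * indicator {0<..} t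
      - 2 * ((E t (P \<Otimes>\<^sub>M Q) - exp (- t)) * t powr (- \<beta> / 2 - 1) * indicator {0<..} t)) = F"
    by (simp add: fun_eq_iff F_def D_def algebra_simps)
  finally have F: "has_bochner_integral lborel F (?c * (2 * J P Q - J P P - J Q Q))"
    by (simp add: algebra_simps)
  have square: "(1 / (2 * sqrt t)) ^ DIM('a) * pi powr (real DIM('a) / 2) * D t = (\<integral>z. (gauss_smooth t P z - gauss_smooth t Q z)\<^sup>2 \<partial>lborel)"
    "integrable lborel (\<lambda>z. (gauss_smooth t P z - gauss_smooth t Q z)\<^sup>2)" if t: "t > 0" for t
  proof -
    let ?N = "(1 / (2 * sqrt t)) ^ DIM('a) * pi powr (real DIM('a) / 2)"
    have "has_bochner_integral lborel (\<lambda>z. gauss_smooth t P z * gauss_smooth t P z + gauss_smooth t Q z * gauss_smooth t Q z - 2 * (gauss_smooth t P z * gauss_smooth t Q z))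
      (?N * E t (P \<Otimes>\<^sub>M P) + ?N * E t (Q \<Otimes>\<^sub>M Q) - 2 * (?N * E t (P \<Otimes>\<^sub>M Q)))"
      unfolding E_def by (intro has_bochner_integral_add has_bochner_integral_diff has_bochner_integral_mult_right has_bochner_integral_gauss_smooth_mult P Q t)
    also have "(\<lambda>z. gauss_smooth t P z * gauss_smooth t P z + gauss_smooth t Q z * gauss_smooth t Q z - 2 * (gauss_smooth t P z * gauss_smooth t Q z)) = (\<lambda>z. (gauss_smooth t P z - gauss_smooth t Q z)\<^sup>2)"
      by (simp add: fun_eq_iff power2_eq_square algebra_simps)
    also have "?N * E t (P \<Otimes>\<^sub>M P) + ?N * E t (Q \<Otimes>\<^sub>M Q) - 2 * (?N * E t (P \<Otimes>\<^sub>M Q)) = ?N * D t"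
      by (simp add: D_def algebra_simps)
    finally show "?N * D t = (\<integral>z. (gauss_smooth t P z - gauss_smooth t Q z)\<^sup>2 \<partial>lborel)"
      "integrable lborel (\<lambda>z. (gauss_smooth t P z - gauss_smooth t Q z)\<^sup>2)"
      by (simp_all add: has_bochner_integral_iff)
  qed
  have N: "(1 / (2 * sqrt t)) ^ DIM('a) * pi powr (real DIM('a) / 2) > 0" if "t > 0" for t
    using that by simp
  have D: "D t \<ge> 0" if "t > 0" for t
  proof -
    have "(1 / (2 * sqrt t)) ^ DIM('a) * pi powr (real DIM('a) / 2) * D t \<ge> 0"
      unfolding square(1)[OF that] by (intro integral_nonneg_AE) auto
    then show ?thesis using N[OF that] by (simp add: zero_le_mult_iff)
  qed
  have Fnn: "F t \<ge> 0" for t by (cases "t > 0") (auto simp: F_def D)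
  have "0 \<le> (\<integral>t. F t \<partial>lborel)" using Fnn by (intro integral_nonneg_AE) auto
  then have "0 \<le> ?c * (2 * J P Q - J P P - J Q Q)" using F by (simp add: has_bochner_integral_iff)
  then show "J P P + J Q Q \<le> 2 * J P Q" using G by (simp add: zero_le_mult_iff)
  assume "J P P + J Q Q = 2 * J P Q"
  then have "has_bochner_integral lborel F 0" using F by (simp add: algebra_simps)
  then have "AE t in lborel. F t = 0"
    using Fnn by (subst integral_nonneg_eq_0_iff_AE[symmetric]) (auto simp: has_bochner_integral_iff)
  then have "AE t in lborel. t > 0 \<longrightarrow> D t = 0"
    by eventually_elim (auto simp: F_def)
  then have ae: "AE t in lborel. t > 0 \<longrightarrow> (AE z in lborel. gauss_smooth t P z = gauss_smooth t Q z)"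
  proof eventually_elim
    case (elim t)
    show ?case
    proof
      assume t: "t > 0"
      then have "(\<integral>z. (gauss_smooth t P z - gauss_smooth t Q z)\<^sup>2 \<partial>lborel) = 0" using square(1)[OF t] elim by simp
      then have "AE z in lborel. (gauss_smooth t P z - gauss_smooth t Q z)\<^sup>2 = 0"
        using square(2)[OF t] by (subst integral_nonneg_eq_0_iff_AE[symmetric]) auto
      then show "AE z in lborel. gauss_smooth t P z = gauss_smooth t Q z" by eventually_elim simp
    qed
  qed
  \<comment> \<open>An interval of length one cannot consist of exceptional values of \<open>t\<close>.\<close>
  have "\<exists>t. t > real n \<and> (AE z in lborel. gauss_smooth t P z = gauss_smooth t Q z)" for n
  proof (rule ccontr)
    assume no: "\<not> ?thesis"
    have "AE t in lborel. t \<notin> {real n<..<real n + 1}"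
      using ae
    proof eventually_elim
      case (elim t)
      show ?case
      proof
        assume "t \<in> {real n<..<real n + 1}"
        then have "t > real n" by simp
        moreover have "t > 0" using \<open>t > real n\<close> by (meson le_less_trans of_nat_0_le_iff)
        ultimately show False using elim no by blast
      qed
    qed
    then have "emeasure lborel {real n<..<real n + 1} = 0"
      by (subst (asm) AE_iff_measurable[where N="{real n<..<real n + 1}"]) auto
    moreover have "emeasure lborel {real n<..<real n + 1} = 1" by simp
    ultimately show False by (simp only: one_neq_zero)
  qed
  then obtain t where "\<And>n. t n > real n \<and> (AE z in lborel. gauss_smooth (t n) P z = gauss_smooth (t n) Q z)" by metis
  then show "P = Q" by (intro gauss_smooth_determines_measure[OF P Q, of t]) auto
qed

section \<open>Energies as integrals\<close>

definition net_potential :: "real \<Rightarrow> real \<Rightarrow> real" where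
  "net_potential \<beta> r = r\<^sup>2 / 2 - pow_potential \<beta> r"

lemma net_potential_measurable [measurable]: "net_potential \<beta> \<in> borel_measurable borel"
  unfolding net_potential_def by measurable

lemma interaction_eq:
  assumes "r \<ge> 0"
  shows "interaction 2 \<beta> r = (if r = 0 \<and> \<beta> \<le> 0 then \<infinity> else ereal (net_potential \<beta> r))"
  using assms by (simp add: interaction_def net_potential_def pow_potential_def)

text \<open>
  Since \<open>\<beta> < 2\<close>, half of the quadratic attraction dominates the repulsive part up to a constant.  The
  interaction is therefore bounded below, and finite energy implies a finite second moment.
\<close>

lemma pow_potential_le_quadratic:
  assumes \<beta>: "\<beta> < 2"
  obtains m where "m \<ge> 0" "\<And>r. r \<ge> 0 \<Longrightarrow> pow_potential \<beta> r \<le> r\<^sup>2 / 4 + m"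
proof -
  consider "\<beta> < 0" | "\<beta> = 0" | "\<beta> > 0" by linarith
  then have "\<exists>m\<ge>0. \<forall>r\<ge>0. pow_potential \<beta> r \<le> r\<^sup>2 / 4 + m"
  proof cases
    case 1
    then show ?thesis by (intro exI[of _ 0]) (auto simp: pow_potential_def intro!: order_trans[OF divide_nonneg_neg])
  next
    case 2
    have "ln r \<le> r\<^sup>2 / 4" if "r > 0" for r :: real
    proof -
      have "ln r \<le> r - 1" using that by (rule ln_le_minus_one)
      also have "\<dots> \<le> r\<^sup>2 / 4" using zero_le_power2[of "r / 2 - 1"] by (simp add: power2_eq_square algebra_simps)
      finally show ?thesis .
    qed
    moreover have "ln (0 :: real) = 0" by simp
    ultimately show ?thesis using 2 by (intro exI[of _ 0]) (auto simp: pow_potential_def le_less)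
  next
    case 3
    \<comment> \<open>Beyond \<open>K\<close> the quotient \<open>r powr \<beta> / r\<^sup>2\<close> is at most \<open>\<beta> / 4\<close>.\<close>
    define K where "K = (\<beta> / 4) powr (1 / (\<beta> - 2))"
    have K: "K > 0" using 3 by (simp add: K_def)
    have K2: "K powr (\<beta> - 2) = \<beta> / 4" using 3 \<beta> by (simp add: K_def powr_powr)
    have "r powr \<beta> / \<beta> \<le> r\<^sup>2 / 4 + K powr \<beta> / \<beta>" if r: "r \<ge> 0" for r
    proof (cases "r \<le> K")
      case True
      then have "r powr \<beta> \<le> K powr \<beta>" using r 3 by (intro powr_mono2) auto
      then have "r powr \<beta> / \<beta> \<le> K powr \<beta> / \<beta>" using 3 by (intro divide_right_mono) auto
      then show ?thesis by (simp add: add_increasing)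
    next
      case False
      then have r0: "r > 0" using K by linarith
      have "r powr (\<beta> - 2) \<le> K powr (\<beta> - 2)" using False K \<beta> by (intro powr_mono2') auto
      then have "r powr (\<beta> - 2) * r\<^sup>2 \<le> \<beta> / 4 * r\<^sup>2" unfolding K2 by (rule mult_right_mono) simp
      moreover have "r powr (\<beta> - 2) * r\<^sup>2 = r powr \<beta>" using r0 by (simp add: powr_diff)
      ultimately have "r powr \<beta> / \<beta> \<le> r\<^sup>2 / 4" using 3 by (simp add: field_simps)
      moreover have "K powr \<beta> / \<beta> \<ge> 0" using 3 by simp
      ultimately show ?thesis by linarith
    qed
    moreover have "K powr \<beta> / \<beta> \<ge> 0" using 3 by simp
    ultimately show ?thesis using 3 by (intro exI[of _ "K powr \<beta> / \<beta>"]) (auto simp: pow_potential_def)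
  qed
  then show ?thesis using that by blast
qed

lemma energy_eq_integral:
  fixes \<nu> :: "'a::euclidean_space measure"
  assumes "prob_space \<nu>" and [measurable_cong]: "sets \<nu> = sets borel"
    and diag: "\<beta> \<le> 0 \<Longrightarrow> AE z in \<nu> \<Otimes>\<^sub>M \<nu>. fst z \<noteq> snd z"
    and int: "integrable (\<nu> \<Otimes>\<^sub>M \<nu>) (\<lambda>z. net_potential \<beta> (norm (fst z - snd z)))"
  shows "energy 2 \<beta> \<nu> = ereal (1 / 2 * (\<integral>z. net_potential \<beta> (norm (fst z - snd z)) \<partial>(\<nu> \<Otimes>\<^sub>M \<nu>)))"
proof -
  let ?M = "\<nu> \<Otimes>\<^sub>M \<nu>" and ?k = "\<lambda>z :: 'a \<times> 'a. net_potential \<beta> (norm (fst z - snd z))"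
  let ?f = "\<lambda>(x, y). interaction 2 \<beta> (norm (x - y :: 'a))"
  have ae: "AE z in ?M. ?f z = ereal (?k z)"
  proof (cases "\<beta> \<le> 0")
    case True
    show ?thesis using diag[OF True] by eventually_elim (auto simp: interaction_eq case_prod_beta')
  next
    case False
    then show ?thesis by (simp add: interaction_eq case_prod_beta')
  qed
  have 1: "(\<integral>\<^sup>+z. e2ennreal (?f z) \<partial>?M) = (\<integral>\<^sup>+z. ennreal (?k z) \<partial>?M)"
    using ae by (intro nn_integral_cong_AE) (auto simp: e2ennreal_ereal)
  have 2: "(\<integral>\<^sup>+z. e2ennreal (- ?f z) \<partial>?M) = (\<integral>\<^sup>+z. ennreal (- ?k z) \<partial>?M)"
    using ae by (intro nn_integral_cong_AE) (auto simp: e2ennreal_ereal)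
  have fin: "(\<integral>\<^sup>+z. ennreal (?k z) \<partial>?M) \<noteq> \<infinity>" "(\<integral>\<^sup>+z. ennreal (- ?k z) \<partial>?M) \<noteq> \<infinity>"
    using int unfolding real_integrable_def by auto
  obtain A where A: "(\<integral>\<^sup>+z. ennreal (?k z) \<partial>?M) = ennreal A" "A \<ge> 0"
    using fin(1) by (cases "\<integral>\<^sup>+z. ennreal (?k z) \<partial>?M") auto
  obtain B where B: "(\<integral>\<^sup>+z. ennreal (- ?k z) \<partial>?M) = ennreal B" "B \<ge> 0"
    using fin(2) by (cases "\<integral>\<^sup>+z. ennreal (- ?k z) \<partial>?M") auto
  note AB = A B
  have "(\<integral>z. ?k z \<partial>?M) = A - B"
    using real_lebesgue_integral_def[OF int] AB by simp
  then show ?thesis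
    unfolding energy_def ereal_integral_def 1 2 AB using AB by simp
qed

text \<open>
  The negative part of the interaction is bounded, hence finite energy bounds the positive part.  For
  \<open>\<beta> \<le> 0\<close> the interaction is infinite on the diagonal, which must then be a null set.
\<close>

lemma finite_energy_integrable:
  fixes \<nu> :: "'a::euclidean_space measure"
  assumes \<nu>: "prob_space \<nu>" and sets[measurable_cong]: "sets \<nu> = sets borel" and \<beta>: "\<beta> < 2"
    and fin: "energy 2 \<beta> \<nu> \<noteq> \<infinity>"
  shows "\<beta> \<le> 0 \<Longrightarrow> AE z in \<nu> \<Otimes>\<^sub>M \<nu>. fst z \<noteq> snd z"
    and "integrable (\<nu> \<Otimes>\<^sub>M \<nu>) (\<lambda>z. net_potential \<beta> (norm (fst z - snd z)))"
proof -
  interpret prob_space \<nu> by fact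
  interpret NN: pair_prob_space \<nu> \<nu> by standard
  let ?M = "\<nu> \<Otimes>\<^sub>M \<nu>" and ?k = "\<lambda>z :: 'a \<times> 'a. net_potential \<beta> (norm (fst z - snd z))"
  let ?f = "\<lambda>(x, y). interaction 2 \<beta> (norm (x - y :: 'a))"
  obtain m where m: "m \<ge> 0" "\<And>r. r \<ge> 0 \<Longrightarrow> pow_potential \<beta> r \<le> r\<^sup>2 / 4 + m"
    using pow_potential_le_quadratic[OF \<beta>] by blast
  have low: "- ?k z \<le> m" for z
    using m(2)[OF norm_ge_zero, of "fst z - snd z"] zero_le_power2[of "norm (fst z - snd z)"]
    unfolding net_potential_def by linarith
  have f: "?f z = (if fst z = snd z \<and> \<beta> \<le> 0 then \<infinity> else ereal (?k z))" for z
    by (simp add: case_prod_beta' interaction_eq)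
  have [measurable]: "?f \<in> borel_measurable ?M" unfolding f by measurable
  have "(\<integral>\<^sup>+z. e2ennreal (- ?f z) \<partial>?M) \<le> (\<integral>\<^sup>+z. ennreal m \<partial>?M)"
    using low by (intro nn_integral_mono) (auto simp: f e2ennreal_ereal e2ennreal_neg intro: ennreal_leI)
  also have "\<dots> < \<infinity>" by (simp add: NN.emeasure_space_1)
  finally have neg: "(\<integral>\<^sup>+z. e2ennreal (- ?f z) \<partial>?M) < \<infinity>" .
  have pos: "(\<integral>\<^sup>+z. e2ennreal (?f z) \<partial>?M) \<noteq> \<infinity>"
  proof
    assume inf: "(\<integral>\<^sup>+z. e2ennreal (?f z) \<partial>?M) = \<infinity>"
    obtain B where "(\<integral>\<^sup>+z. e2ennreal (- ?f z) \<partial>?M) = ennreal B" "B \<ge> 0"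
      using neg by (cases "\<integral>\<^sup>+z. e2ennreal (- ?f z) \<partial>?M") auto
    then have "energy 2 \<beta> \<nu> = \<infinity>" unfolding energy_def ereal_integral_def inf by simp
    then show False using fin by simp
  qed
  show "AE z in ?M. fst z \<noteq> snd z" if "\<beta> \<le> 0"
  proof -
    have "AE z in ?M. e2ennreal (?f z) \<noteq> \<infinity>"
      by (rule nn_integral_PInf_AE) (use pos in auto)
    then show ?thesis by eventually_elim (use that in \<open>auto simp: f\<close>)
  qed
  have "(\<integral>\<^sup>+z. ennreal (?k z) \<partial>?M) \<le> (\<integral>\<^sup>+z. e2ennreal (?f z) \<partial>?M)"
    by (intro nn_integral_mono) (auto simp: f e2ennreal_ereal)
  then have "(\<integral>\<^sup>+z. ennreal (?k z) \<partial>?M) \<noteq> \<infinity>" using pos by (auto simp: top_unique)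
  moreover have "(\<integral>\<^sup>+z. ennreal (- ?k z) \<partial>?M) \<le> (\<integral>\<^sup>+z. ennreal m \<partial>?M)"
    using low by (intro nn_integral_mono ennreal_leI) auto
  then have "(\<integral>\<^sup>+z. ennreal (- ?k z) \<partial>?M) \<noteq> \<infinity>" by (auto simp: NN.emeasure_space_1 top_unique)
  ultimately show "integrable ?M ?k" unfolding real_integrable_def by auto
qed

section \<open>Second moments\<close>

lemma norm_diff_square_le: "(norm (x - y))\<^sup>2 \<le> 2 * (norm (x - a))\<^sup>2 + 2 * (norm (y - a))\<^sup>2"
  for x y a :: "'a::real_inner"
proof -
  have "x - y = (x - a) - (y - a)" by simp
  moreover have "(norm (u - v))\<^sup>2 \<le> 2 * (norm u)\<^sup>2 + 2 * (norm v)\<^sup>2" for u v :: 'a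
  proof -
    have "0 \<le> (norm (u + v))\<^sup>2" by simp
    then show ?thesis unfolding power2_norm_eq_inner by (simp add: inner_diff inner_add inner_commute)
  qed
  ultimately show ?thesis by metis
qed

lemma second_moment_product:
  fixes \<nu> :: "'a::euclidean_space measure"
  assumes \<nu>: "prob_space \<nu>" and sets[measurable_cong]: "sets \<nu> = sets borel"
    and int: "integrable \<nu> (\<lambda>x. (norm (x - a))\<^sup>2)"
  shows "integrable \<nu> (\<lambda>x. x)"
    and "integrable (\<nu> \<Otimes>\<^sub>M \<nu>) (\<lambda>z. (norm (fst z - snd z))\<^sup>2)"
    and "(\<integral>z. (norm (fst z - snd z))\<^sup>2 \<partial>(\<nu> \<Otimes>\<^sub>M \<nu>)) = 2 * (\<integral>x. (norm (x - a))\<^sup>2 \<partial>\<nu>) - 2 * (norm ((\<integral>x. x \<partial>\<nu>) - a))\<^sup>2"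
proof -
  interpret prob_space \<nu> by fact
  interpret NN: pair_prob_space \<nu> \<nu> by standard
  let ?v = "\<integral>x. (norm (x - a))\<^sup>2 \<partial>\<nu>" and ?b = "\<integral>x. x \<partial>\<nu>"
  have "integrable \<nu> (\<lambda>x. x - a)"
  proof (rule Bochner_Integration.integrable_bound)
    show "integrable \<nu> (\<lambda>x. 1 + (norm (x - a))\<^sup>2)" using int by simp
    have "norm u \<le> 1 + (norm u)\<^sup>2" for u :: 'a
      using zero_le_power2[of "norm u - 1 / 2"] by (simp add: power2_eq_square algebra_simps)
    then show "AE x in \<nu>. norm (x - a) \<le> norm (1 + (norm (x - a))\<^sup>2)" by simp
  qed simp
  then have "integrable \<nu> (\<lambda>x. (x - a) + a)" by (rule Bochner_Integration.integrable_add) simp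
  then show id: "integrable \<nu> (\<lambda>x. x)" by simp
  have expand: "(norm (x - y))\<^sup>2 = (norm (x - a))\<^sup>2 + (norm (y - a))\<^sup>2 - 2 * ((x - a) \<bullet> (y - a))" for x y :: 'a
    unfolding power2_norm_eq_inner by (simp add: inner_diff inner_commute)
  have inner: "has_bochner_integral \<nu> (\<lambda>y. (norm (x - y))\<^sup>2) ((norm (x - a))\<^sup>2 + ?v - 2 * ((x - a) \<bullet> (?b - a)))" for x
  proof -
    have "integrable \<nu> (\<lambda>y. (norm (x - a))\<^sup>2 + (norm (y - a))\<^sup>2 - 2 * ((x - a) \<bullet> (y - a)))"
      using int id by auto
    moreover have "(\<integral>y. (norm (x - a))\<^sup>2 + (norm (y - a))\<^sup>2 - 2 * ((x - a) \<bullet> (y - a)) \<partial>\<nu>) = (norm (x - a))\<^sup>2 + ?v - 2 * ((x - a) \<bullet> (?b - a))"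
      using int id by (simp add: prob_space inner_diff_right)
    ultimately have "has_bochner_integral \<nu> (\<lambda>y. (norm (x - a))\<^sup>2 + (norm (y - a))\<^sup>2 - 2 * ((x - a) \<bullet> (y - a))) ((norm (x - a))\<^sup>2 + ?v - 2 * ((x - a) \<bullet> (?b - a)))"
      by (simp add: has_bochner_integral_iff)
    then show ?thesis by (simp only: expand[of x, symmetric])
  qed
  show prod: "integrable (\<nu> \<Otimes>\<^sub>M \<nu>) (\<lambda>z. (norm (fst z - snd z))\<^sup>2)"
  proof (rule NN.Fubini_integrable)
    have "integrable \<nu> (\<lambda>x. (norm (x - a))\<^sup>2 + ?v - 2 * ((x - a) \<bullet> (?b - a)))" using int id by auto
    then show "integrable \<nu> (\<lambda>x. \<integral>y. norm ((norm (fst (x, y) - snd (x, y)))\<^sup>2) \<partial>\<nu>)"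
      using inner by (simp add: has_bochner_integral_iff)
  qed (use inner in \<open>auto simp: has_bochner_integral_iff\<close>)
  have "(\<integral>z. (norm (fst z - snd z))\<^sup>2 \<partial>(\<nu> \<Otimes>\<^sub>M \<nu>)) = (\<integral>x. (\<integral>y. (norm (fst (x, y) - snd (x, y)))\<^sup>2 \<partial>\<nu>) \<partial>\<nu>)"
    by (rule NN.integral_fst'[OF prod, symmetric])
  also have "\<dots> = (\<integral>x. (norm (x - a))\<^sup>2 + ?v - 2 * ((x - a) \<bullet> (?b - a)) \<partial>\<nu>)"
    using inner by (simp add: has_bochner_integral_iff)
  also have "\<dots> = ?v + ?v - 2 * ((?b - a) \<bullet> (?b - a))"
    using int id by (simp add: prob_space inner_diff_left)
  finally show "(\<integral>z. (norm (fst z - snd z))\<^sup>2 \<partial>(\<nu> \<Otimes>\<^sub>M \<nu>)) = 2 * ?v - 2 * (norm (?b - a))\<^sup>2"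
    by (simp add: power2_norm_eq_inner)
qed

text \<open>
  By Fubini, \<open>(norm (x0 - y))\<^sup>2\<close> is integrable in \<open>y\<close> for some point \<open>x0\<close>, and \<open>a\<close> differs from \<open>x0\<close> by a
  fixed vector.
\<close>

lemma second_moment_of_product:
  fixes \<nu> :: "'a::euclidean_space measure"
  assumes \<nu>: "prob_space \<nu>" and sets[measurable_cong]: "sets \<nu> = sets borel"
    and int: "integrable (\<nu> \<Otimes>\<^sub>M \<nu>) (\<lambda>z. (norm (fst z - snd z))\<^sup>2)"
  shows "integrable \<nu> (\<lambda>x. (norm (x - a))\<^sup>2)"
proof -
  interpret prob_space \<nu> by fact
  interpret NN: pair_prob_space \<nu> \<nu> by standard
  have "AE x in \<nu>. integrable \<nu> (\<lambda>y. (norm (fst (x, y) - snd (x, y)))\<^sup>2)"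
    by (rule NN.AE_integrable_fst'[OF int])
  then obtain x0 where x0: "integrable \<nu> (\<lambda>y. (norm (x0 - y))\<^sup>2)"
    using AE_False by (auto dest!: AE_contr simp: eventually_False)
  show ?thesis
  proof (rule Bochner_Integration.integrable_bound)
    show "integrable \<nu> (\<lambda>y. 2 * (norm (x0 - y))\<^sup>2 + 2 * (norm (a - x0))\<^sup>2)" using x0 by simp
    show "AE y in \<nu>. norm ((norm (y - a))\<^sup>2) \<le> norm (2 * (norm (x0 - y))\<^sup>2 + 2 * (norm (a - x0))\<^sup>2)"
      using norm_diff_square_le[of _ a x0] by (simp add: norm_minus_commute)
  qed simp
qed

section \<open>Comparison with the candidate\<close>

text \<open>
  The potential bound integrated against \<open>\<nu>\<close>.  For the integrability of the signed kernel \<open>k\<close>, the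
  estimate \<open>\<bar>k\<bar> \<le> 2 max k 0 - k\<close> together with the quadratic upper bound for \<open>k\<close> and the lower bound
  for the potential controls \<open>\<bar>k\<bar>\<close>.
\<close>

lemma potential_energy_against_minimizer:
  fixes \<nu> :: "'a::euclidean_space measure" and a :: 'a
  assumes \<beta>: "- real DIM('a) < \<beta>" "\<beta> < 2" "\<beta> < 4 - real DIM('a)"
    and \<nu>: "prob_space \<nu>" and sets[measurable_cong]: "sets \<nu> = sets borel"
    and int: "integrable \<nu> (\<lambda>x. (norm (x - a))\<^sup>2)"
  shows "integrable (\<nu> \<Otimes>\<^sub>M minimizer \<beta> a) (\<lambda>(x, y). pow_potential \<beta> (norm (x - y)))"
    and "AE (x, y) in \<nu> \<Otimes>\<^sub>M minimizer \<beta> a. x \<noteq> y"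
    and "(\<integral>(x, y). pow_potential \<beta> (norm (x - y)) \<partial>(\<nu> \<Otimes>\<^sub>M minimizer \<beta> a)) \<le> minimizer_constant DIM('a) \<beta> + (\<integral>x. (norm (x - a))\<^sup>2 \<partial>\<nu>) / 2"
    and "(AE x in \<nu>. norm (x - a) \<le> radius2 DIM('a) \<beta>) \<Longrightarrow>
      (\<integral>(x, y). pow_potential \<beta> (norm (x - y)) \<partial>(\<nu> \<Otimes>\<^sub>M minimizer \<beta> a)) = minimizer_constant DIM('a) \<beta> + (\<integral>x. (norm (x - a))\<^sup>2 \<partial>\<nu>) / 2"
proof -
  let ?\<mu> = "minimizer \<beta> a"
  interpret \<nu>: prob_space \<nu> by fact
  interpret \<mu>: prob_space ?\<mu> using \<beta> by (intro prob_space_minimizer)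
  interpret NM: pair_prob_space \<nu> ?\<mu> by standard
  have [measurable_cong]: "sets ?\<mu> = sets borel" by simp
  let ?C = "minimizer_constant DIM('a) \<beta>"
  define V where "V x = (\<integral>y. pow_potential \<beta> (norm (x - y)) \<partial>?\<mu>)" for x
  have V: "integrable ?\<mu> (\<lambda>y. pow_potential \<beta> (norm (x - y)))" "V x \<le> ?C + (norm (x - a))\<^sup>2 / 2" "?C \<le> V x" for x
    unfolding V_def using minimizer_potential[OF \<beta>, of a x] by auto
  have [measurable]: "V \<in> borel_measurable borel" unfolding V_def by (rule \<mu>.borel_measurable_lebesgue_integral) measurable
  obtain m where m: "m \<ge> 0" "\<And>r. r \<ge> 0 \<Longrightarrow> pow_potential \<beta> r \<le> r\<^sup>2 / 4 + m"
    using pow_potential_le_quadratic[OF \<beta>(2)] by blast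
  let ?v = "\<integral>y. (norm (y - a))\<^sup>2 \<partial>?\<mu>"
  have abs_le: "\<bar>pow_potential \<beta> (norm (x - y))\<bar> \<le> ((norm (x - a))\<^sup>2 + (norm (y - a))\<^sup>2 + 2 * m) - pow_potential \<beta> (norm (x - y))" for x y :: 'a
  proof -
    have "pow_potential \<beta> (norm (x - y)) \<le> (norm (x - y))\<^sup>2 / 4 + m" by (rule m) simp
    moreover have "(norm (x - y))\<^sup>2 \<le> 2 * (norm (x - a))\<^sup>2 + 2 * (norm (y - a))\<^sup>2" by (rule norm_diff_square_le)
    moreover have "(norm (x - a))\<^sup>2 \<ge> 0" "(norm (y - a))\<^sup>2 \<ge> 0" by auto
    ultimately show ?thesis using m(1) by (simp add: abs_if)
  qed
  have dom: "integrable ?\<mu> (\<lambda>y. ((norm (x - a))\<^sup>2 + (norm (y - a))\<^sup>2 + 2 * m) - pow_potential \<beta> (norm (x - y)))" for x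
    using V(1) minimizer_second_moment(1)[OF \<beta>] by (intro Bochner_Integration.integrable_diff Bochner_Integration.integrable_add \<mu>.integrable_const) auto
  have dom_le: "(\<integral>y. \<bar>pow_potential \<beta> (norm (x - y))\<bar> \<partial>?\<mu>) \<le> (norm (x - a))\<^sup>2 + ?v + 2 * m - ?C" for x
  proof -
    have "(\<integral>y. \<bar>pow_potential \<beta> (norm (x - y))\<bar> \<partial>?\<mu>) \<le> (\<integral>y. ((norm (x - a))\<^sup>2 + (norm (y - a))\<^sup>2 + 2 * m) - pow_potential \<beta> (norm (x - y)) \<partial>?\<mu>)"
      using V(1) dom abs_le by (intro integral_mono) auto
    also have "\<dots> = (norm (x - a))\<^sup>2 + ?v + 2 * m - V x"
      using V(1) minimizer_second_moment(1)[OF \<beta>] by (simp add: V_def \<mu>.prob_space)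
    finally show ?thesis using V(3)[of x] by linarith
  qed
  show prod: "integrable (\<nu> \<Otimes>\<^sub>M ?\<mu>) (\<lambda>(x, y). pow_potential \<beta> (norm (x - y)))"
  proof (rule NM.Fubini_integrable)
    show "integrable \<nu> (\<lambda>x. \<integral>y. norm (case (x, y) of (x, y) \<Rightarrow> pow_potential \<beta> (norm (x - y))) \<partial>?\<mu>)"
    proof (rule Bochner_Integration.integrable_bound)
      show "integrable \<nu> (\<lambda>x. (norm (x - a))\<^sup>2 + ?v + 2 * m - ?C)" using int by auto
      have "0 \<le> (\<integral>y. \<bar>pow_potential \<beta> (norm (x - y))\<bar> \<partial>?\<mu>)" for x by (intro integral_nonneg_AE) auto
      then show "AE x in \<nu>. norm (\<integral>y. norm (case (x, y) of (x, y) \<Rightarrow> pow_potential \<beta> (norm (x - y))) \<partial>?\<mu>) \<le> norm ((norm (x - a))\<^sup>2 + ?v + 2 * m - ?C)"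
        using dom_le by (auto intro: order_trans[OF _ abs_ge_self])
      have "(\<lambda>x. \<integral>y. \<bar>pow_potential \<beta> (norm (x - y))\<bar> \<partial>?\<mu>) \<in> borel_measurable \<nu>"
        by (rule \<mu>.borel_measurable_lebesgue_integral) measurable
      then show "(\<lambda>x. \<integral>y. norm (case (x, y) of (x, y) \<Rightarrow> pow_potential \<beta> (norm (x - y))) \<partial>?\<mu>) \<in> borel_measurable \<nu>" by simp
    qed
  qed (use V(1) in auto)
  show "AE (x, y) in \<nu> \<Otimes>\<^sub>M ?\<mu>. x \<noteq> y"
  proof (rule NM.AE_pair_measure)
    show "{x \<in> space (\<nu> \<Otimes>\<^sub>M ?\<mu>). case x of (x, y) \<Rightarrow> x \<noteq> y} \<in> sets (\<nu> \<Otimes>\<^sub>M ?\<mu>)" by measurable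
    show "AE x in \<nu>. AE y in ?\<mu>. case (x, y) of (x, y) \<Rightarrow> x \<noteq> y"
    proof (rule AE_I2)
      fix x
      have "AE y in ?\<mu>. y \<noteq> x" by (rule AE_minimizer(2)[OF \<beta>])
      then show "AE y in ?\<mu>. case (x, y) of (x, y) \<Rightarrow> x \<noteq> y" by eventually_elim auto
    qed
  qed
  have eq: "(\<integral>(x, y). pow_potential \<beta> (norm (x - y)) \<partial>(\<nu> \<Otimes>\<^sub>M ?\<mu>)) = (\<integral>x. V x \<partial>\<nu>)"
    using NM.integral_fst'[OF prod] by (simp add: V_def)
  have Vint: "integrable \<nu> V"
    using NM.integrable_fst'[OF prod] by (simp add: V_def[abs_def])
  have upper_int: "integrable \<nu> (\<lambda>x. ?C + (norm (x - a))\<^sup>2 / 2)" using int by auto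
  have upper: "(\<integral>x. ?C + (norm (x - a))\<^sup>2 / 2 \<partial>\<nu>) = ?C + (\<integral>x. (norm (x - a))\<^sup>2 \<partial>\<nu>) / 2"
    using int by (simp add: \<nu>.prob_space)
  show "(\<integral>(x, y). pow_potential \<beta> (norm (x - y)) \<partial>(\<nu> \<Otimes>\<^sub>M ?\<mu>)) \<le> ?C + (\<integral>x. (norm (x - a))\<^sup>2 \<partial>\<nu>) / 2"
    unfolding eq upper[symmetric] using V(2) by (intro integral_mono Vint upper_int)
  assume "AE x in \<nu>. norm (x - a) \<le> radius2 DIM('a) \<beta>"
  then have "AE x in \<nu>. V x = ?C + (norm (x - a))\<^sup>2 / 2"
    by eventually_elim (simp add: V_def minimizer_potential(2)[OF \<beta>])
  then show "(\<integral>(x, y). pow_potential \<beta> (norm (x - y)) \<partial>(\<nu> \<Otimes>\<^sub>M ?\<mu>)) = ?C + (\<integral>x. (norm (x - a))\<^sup>2 \<partial>\<nu>) / 2"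
    unfolding eq upper[symmetric] by (intro integral_cong_AE) auto
qed

text \<open>
  Half of the difference between half of the second moment of the minimizer and the value of its
  potential at the centre; \<open>optimal_energy_eq\<close> gives the closed form.
\<close>

definition optimal_energy :: "nat \<Rightarrow> real \<Rightarrow> real" where
  "optimal_energy d \<beta> = (real d * (radius2 d \<beta>)\<^sup>2 / (4 - \<beta>) / 2 - minimizer_constant d \<beta>) / 2"

lemma self_energy_minimizer:
  fixes a :: "'a::euclidean_space"
  assumes \<beta>: "- real DIM('a) < \<beta>" "\<beta> < 2" "\<beta> < 4 - real DIM('a)"
  defines "\<mu> \<equiv> minimizer \<beta> a"
  shows "integrable (\<mu> \<Otimes>\<^sub>M \<mu>) (\<lambda>(x, y). pow_potential \<beta> (norm (x - y)))"
    and "AE (x, y) in \<mu> \<Otimes>\<^sub>M \<mu>. x \<noteq> y"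
    and "(\<integral>(x, y). pow_potential \<beta> (norm (x - y)) \<partial>(\<mu> \<Otimes>\<^sub>M \<mu>)) = minimizer_constant DIM('a) \<beta> + real DIM('a) * (radius2 DIM('a) \<beta>)\<^sup>2 / (4 - \<beta>) / 2"
proof -
  have p: "prob_space \<mu>" "sets \<mu> = sets borel" unfolding \<mu>_def using \<beta> by (auto intro: prob_space_minimizer)
  have i: "integrable \<mu> (\<lambda>x. (norm (x - a))\<^sup>2)" unfolding \<mu>_def by (rule minimizer_second_moment(1)[OF \<beta>])
  have ae: "AE x in \<mu>. norm (x - a) \<le> radius2 DIM('a) \<beta>"
    using AE_minimizer(1)[OF \<beta>, of a] unfolding \<mu>_def by eventually_elim simp
  note * = potential_energy_against_minimizer[OF \<beta> p i]
  show "integrable (\<mu> \<Otimes>\<^sub>M \<mu>) (\<lambda>(x, y). pow_potential \<beta> (norm (x - y)))" "AE (x, y) in \<mu> \<Otimes>\<^sub>M \<mu>. x \<noteq> y"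
    using *(1,2) by (simp_all only: \<mu>_def)
  show "(\<integral>(x, y). pow_potential \<beta> (norm (x - y)) \<partial>(\<mu> \<Otimes>\<^sub>M \<mu>)) = minimizer_constant DIM('a) \<beta> + real DIM('a) * (radius2 DIM('a) \<beta>)\<^sup>2 / (4 - \<beta>) / 2"
    using *(4)[OF ae] minimizer_second_moment(2)[OF \<beta>, of a] by (simp only: \<mu>_def)
qed

text \<open>
  The candidate is centred at the mean \<open>b\<close> of \<open>\<nu>\<close>.  Then the variance \<open>v\<close> of \<open>\<nu>\<close> occurs in the energy of
  \<open>\<nu>\<close> and, through the potential bound, in \<open>2 J(\<nu>,\<mu>)\<close>, and cancels.
\<close>

lemma energy_lower_bound:
  fixes \<nu> :: "'a::euclidean_space measure"
  assumes \<beta>: "- real DIM('a) < \<beta>" "\<beta> < 2" "\<beta> < 4 - real DIM('a)"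
    and \<nu>: "prob_space \<nu>" and sets[measurable_cong]: "sets \<nu> = sets borel"
  shows "ereal (optimal_energy DIM('a) \<beta>) \<le> energy 2 \<beta> \<nu>"
    and "energy 2 \<beta> \<nu> = ereal (optimal_energy DIM('a) \<beta>) \<Longrightarrow> \<exists>a. \<nu> = minimizer \<beta> a"
proof -
  have main: "ereal (optimal_energy DIM('a) \<beta>) \<le> energy 2 \<beta> \<nu> \<and> (energy 2 \<beta> \<nu> = ereal (optimal_energy DIM('a) \<beta>) \<longrightarrow> (\<exists>a. \<nu> = minimizer \<beta> a))"
  proof (cases "energy 2 \<beta> \<nu> = \<infinity>")
    case False
    let ?M = "\<nu> \<Otimes>\<^sub>M \<nu>" and ?k = "\<lambda>z :: 'a \<times> 'a. net_potential \<beta> (norm (fst z - snd z))"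
    note fin = finite_energy_integrable[OF \<nu> sets \<beta>(2) False]
    interpret \<nu>: prob_space \<nu> by fact
    interpret NN: pair_prob_space \<nu> \<nu> by standard
    obtain m where m: "m \<ge> 0" "\<And>r. r \<ge> 0 \<Longrightarrow> pow_potential \<beta> r \<le> r\<^sup>2 / 4 + m"
      using pow_potential_le_quadratic[OF \<beta>(2)] by blast
    have sq: "integrable ?M (\<lambda>z. (norm (fst z - snd z))\<^sup>2)"
    proof (rule Bochner_Integration.integrable_bound)
      show "integrable ?M (\<lambda>z. 4 * (?k z + m))" using fin(2) by auto
      show "AE z in ?M. norm ((norm (fst z - snd z))\<^sup>2) \<le> norm (4 * (?k z + m))"
      proof (rule AE_I2)
        fix z :: "'a \<times> 'a"
        have "(norm (fst z - snd z))\<^sup>2 \<le> 4 * (?k z + m)"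
          using m(2)[of "norm (fst z - snd z)"] by (simp add: net_potential_def)
        also have "\<dots> \<le> norm (4 * (?k z + m))" unfolding real_norm_def by (rule abs_ge_self)
        finally show "norm ((norm (fst z - snd z))\<^sup>2) \<le> norm (4 * (?k z + m))" by simp
      qed
    qed measurable
    define b where "b = (\<integral>x. x \<partial>\<nu>)"
    have sb: "integrable \<nu> (\<lambda>x. (norm (x - b))\<^sup>2)" by (rule second_moment_of_product[OF \<nu> sets sq])
    define v where "v = (\<integral>x. (norm (x - b))\<^sup>2 \<partial>\<nu>)"
    have v: "(\<integral>z. (norm (fst z - snd z))\<^sup>2 \<partial>?M) = 2 * v"
      using second_moment_product(3)[OF \<nu> sets sb] by (simp add: b_def[symmetric] v_def)
    let ?\<mu> = "minimizer \<beta> b"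
    have \<mu>: "prob_space ?\<mu>" "sets ?\<mu> = sets borel" using \<beta> by (auto intro: prob_space_minimizer)
    have pk: "pow_potential \<beta> (norm (fst z - snd z)) = (norm (fst z - snd z))\<^sup>2 / 2 - ?k z" for z :: "'a \<times> 'a"
      by (simp add: net_potential_def)
    have pint: "integrable ?M (\<lambda>z. pow_potential \<beta> (norm (fst z - snd z)))"
      unfolding pk using sq fin(2) by auto
    let ?J = "\<lambda>P Q :: 'a measure. \<integral>(x, y). pow_potential \<beta> (norm (x - y)) \<partial>(P \<Otimes>\<^sub>M Q)"
    have J\<nu>: "?J \<nu> \<nu> = v - (\<integral>z. ?k z \<partial>?M)"
    proof -
      have "?J \<nu> \<nu> = (\<integral>z. (norm (fst z - snd z))\<^sup>2 / 2 - ?k z \<partial>?M)" by (simp only: case_prod_beta' pk)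
      also have "\<dots> = v - (\<integral>z. ?k z \<partial>?M)" using sq fin(2) v by simp
      finally show ?thesis .
    qed
    note nd = pow_potential_negative_definite[OF \<nu> sets \<mu> \<beta>(2) _ self_energy_minimizer(1)[OF \<beta>]
        potential_energy_against_minimizer(1)[OF \<beta> \<nu> sets sb] _ self_energy_minimizer(2)[OF \<beta>]
        potential_energy_against_minimizer(2)[OF \<beta> \<nu> sets sb]]
    have le: "?J \<nu> \<nu> + ?J ?\<mu> ?\<mu> \<le> 2 * ?J \<nu> ?\<mu>"
      using pint fin(1) by (intro nd(1)) (simp_all add: case_prod_beta')
    have eq: "\<nu> = ?\<mu>" if "?J \<nu> \<nu> + ?J ?\<mu> ?\<mu> = 2 * ?J \<nu> ?\<mu>"
      using pint fin(1) that by (intro nd(2)) (simp_all add: case_prod_beta')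
    have J\<mu>: "?J ?\<mu> ?\<mu> = minimizer_constant DIM('a) \<beta> + real DIM('a) * (radius2 DIM('a) \<beta>)\<^sup>2 / (4 - \<beta>) / 2"
      by (rule self_energy_minimizer(3)[OF \<beta>])
    have J\<nu>\<mu>: "?J \<nu> ?\<mu> \<le> minimizer_constant DIM('a) \<beta> + v / 2"
      unfolding v_def by (rule potential_energy_against_minimizer(3)[OF \<beta> \<nu> sets sb])
    have E: "energy 2 \<beta> \<nu> = ereal (1 / 2 * (\<integral>z. ?k z \<partial>?M))"
      by (rule energy_eq_integral[OF \<nu> sets fin])
    have opt: "2 * optimal_energy DIM('a) \<beta> = ?J ?\<mu> ?\<mu> - 2 * minimizer_constant DIM('a) \<beta>"
      unfolding J\<mu> optimal_energy_def by simp
    have "optimal_energy DIM('a) \<beta> \<le> 1 / 2 * (\<integral>z. ?k z \<partial>?M)"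
      using le J\<nu>\<mu> J\<nu> opt by linarith
    moreover have "\<nu> = ?\<mu>" if "1 / 2 * (\<integral>z. ?k z \<partial>?M) = optimal_energy DIM('a) \<beta>"
    proof (rule eq)
      show "?J \<nu> \<nu> + ?J ?\<mu> ?\<mu> = 2 * ?J \<nu> ?\<mu>" using that le J\<nu>\<mu> J\<nu> opt by linarith
    qed
    ultimately show ?thesis unfolding E by auto
  qed simp
  then show "ereal (optimal_energy DIM('a) \<beta>) \<le> energy 2 \<beta> \<nu>"
    "energy 2 \<beta> \<nu> = ereal (optimal_energy DIM('a) \<beta>) \<Longrightarrow> \<exists>a. \<nu> = minimizer \<beta> a" by auto
qed

text \<open>
  For the upper bound the mean of the minimizer need not be computed: a mean different from \<open>a\<close> would
  only lower the quadratic part.  The opposite inequality is the general lower bound.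
\<close>

lemma energy_minimizer_eq:
  fixes a :: "'a::euclidean_space"
  assumes \<beta>: "- real DIM('a) < \<beta>" "\<beta> < 2" "\<beta> < 4 - real DIM('a)"
  shows "energy 2 \<beta> (minimizer \<beta> a) = ereal (optimal_energy DIM('a) \<beta>)"
proof (rule antisym)
  let ?\<mu> = "minimizer \<beta> a"
  let ?M = "?\<mu> \<Otimes>\<^sub>M ?\<mu>" and ?k = "\<lambda>z :: 'a \<times> 'a. net_potential \<beta> (norm (fst z - snd z))"
  have \<mu>: "prob_space ?\<mu>" "sets ?\<mu> = sets borel" using \<beta> by (auto intro: prob_space_minimizer)
  note m2 = minimizer_second_moment[OF \<beta>, of a]
  note sq = second_moment_product(2,3)[OF \<mu> m2(1)]
  note se = self_energy_minimizer[OF \<beta>, of a, unfolded case_prod_beta']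
  have kint: "integrable ?M ?k" unfolding net_potential_def using sq(1) se(1) by auto
  have "(\<integral>z. ?k z \<partial>?M) = (\<integral>z. (norm (fst z - snd z))\<^sup>2 \<partial>?M) / 2 - (\<integral>z. pow_potential \<beta> (norm (fst z - snd z)) \<partial>?M)"
    unfolding net_potential_def using sq(1) se(1) by simp
  also have "\<dots> \<le> (\<integral>x. (norm (x - a))\<^sup>2 \<partial>?\<mu>) - (minimizer_constant DIM('a) \<beta> + real DIM('a) * (radius2 DIM('a) \<beta>)\<^sup>2 / (4 - \<beta>) / 2)"
    unfolding sq(2) se(3) by simp
  also have "\<dots> = 2 * optimal_energy DIM('a) \<beta>"
  proof -
    have "v - (C + v / 2) = 2 * ((v / 2 - C) / 2)" for v C :: real by simp
    then show ?thesis unfolding m2(2) optimal_energy_def .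
  qed
  finally have "(\<integral>z. ?k z \<partial>?M) \<le> 2 * optimal_energy DIM('a) \<beta>" .
  moreover have "energy 2 \<beta> ?\<mu> = ereal (1 / 2 * (\<integral>z. ?k z \<partial>?M))"
    using se(2) kint by (intro energy_eq_integral[OF \<mu>]) auto
  ultimately show "energy 2 \<beta> ?\<mu> \<le> ereal (optimal_energy DIM('a) \<beta>)" by simp
  show "ereal (optimal_energy DIM('a) \<beta>) \<le> energy 2 \<beta> ?\<mu>"
    by (rule energy_lower_bound(1)[OF \<beta> \<mu>])
qed

text \<open>
  For \<open>\<beta> = 0\<close> the square of the radius is \<open>2 / d\<close> and its logarithm joins the digamma values; the
  quotients \<open>deriv Gamma / Gamma\<close> are these digamma values.
\<close>

lemma optimal_energy_eq:
  assumes \<beta>: "- real d < \<beta>" "\<beta> < 2" and d: "d > 0"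
  shows "optimal_energy d \<beta> = (if \<beta> \<noteq> 0
        then - (real d * (2 - \<beta>) / (2 * \<beta> * (4 - \<beta>))) * (radius2 d \<beta>)\<^sup>2
        else 1 / 4 * (1 / 2 + ln (real d / 2)
               + deriv Gamma (2 :: real) / Gamma 2
               - deriv Gamma (real d / 2) / Gamma (real d / 2)))"
proof (cases "\<beta> = 0")
  case False
  then show ?thesis using \<beta>
    by (simp add: optimal_energy_def minimizer_constant_def potential_offset_def divide_simps) (simp add: algebra_simps)
next
  case True
  have R: "radius2 d 0 > 0" using radius2_powr(1)[of d 0] d by simp
  have nn: "real d / 2 \<notin> \<int>\<^sub>\<le>\<^sub>0" "(2 :: real) \<notin> \<int>\<^sub>\<le>\<^sub>0" using d by (auto dest!: nonpos_Ints_nonpos)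
  have "radius2 d 0 powr 2 = Gamma (4 / 2) * Gamma (real d / 2) / Gamma (1 + real d / 2)"
    using radius2_powr(2)[of d 0] d by simp
  also have "Gamma (1 + real d / 2) = real d / 2 * Gamma (real d / 2)"
    using Gamma_plus1[OF nn(1)] by (simp add: add.commute)
  finally have "radius2 d 0 powr 2 = Gamma (4 / 2) * Gamma (real d / 2) / (real d / 2 * Gamma (real d / 2))" .
  moreover have "Gamma (real d / 2) \<noteq> 0" using Gamma_real_pos[of "real d / 2"] d by linarith
  ultimately have R2: "(radius2 d 0)\<^sup>2 = 2 / real d"
    using R d by (simp add: Gamma_2_real)
  have "ln ((radius2 d 0)\<^sup>2) = 2 * ln (radius2 d 0)" using R by (simp add: ln_realpow)
  then have lnR: "ln (radius2 d 0) = - ln (real d / 2) / 2"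
    unfolding R2 using d by (simp add: ln_div)
  have dG: "deriv Gamma z / Gamma z = Digamma z" if "z > 0" for z :: real
  proof -
    have "z \<notin> \<int>\<^sub>\<le>\<^sub>0" using that by (auto dest: nonpos_Ints_nonpos)
    then have "deriv Gamma z = Gamma z * Digamma z" by (intro DERIV_imp_deriv has_field_derivative_Gamma)
    moreover have "Gamma z \<noteq> 0" using Gamma_real_pos[OF that] by linarith
    ultimately show ?thesis by simp
  qed
  have "optimal_energy d 0 = (1 / 4 - (- ln (real d / 2) / 2 + (Digamma (real d / 2) - Digamma 2) / 2)) / 2"
    unfolding optimal_energy_def minimizer_constant_def potential_offset_def lnR R2 using d by simp
  then have "optimal_energy d 0 = 1 / 4 * (1 / 2 + ln (real d / 2) + Digamma 2 - Digamma (real d / 2))"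
    by (simp add: field_simps)
  then show ?thesis using True d by (simp add: dG)
qed

theorem theorem2:
  fixes d :: nat and \<beta> :: real
  assumes "d = CARD('n::finite)"
    and "- real d < \<beta>" and "\<beta> < min 2 (- real d + 4)"
  shows "minimal_energy TYPE(real ^ 'n) 2 \<beta> =
      ereal (if \<beta> \<noteq> 0
        then - (real d * (2 - \<beta>) / (2 * \<beta> * (4 - \<beta>))) * (radius2 d \<beta>)\<^sup>2
        else 1 / 4 * (1 / 2 + ln (real d / 2)
               + deriv Gamma (2 :: real) / Gamma 2
               - deriv Gamma (real d / 2) / Gamma (real d / 2)))
    \<and> (\<forall>\<mu> :: (real ^ 'n) measure. energy_minimizer 2 \<beta> \<mu> \<longleftrightarrow>
        (\<exists>a :: real ^ 'n. \<mu> = density lborel (\<lambda>x. ennreal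
          (inverse (norm_const d \<beta>) * radius2 d \<beta> powr (\<beta> - 2)
            * ((radius2 d \<beta>)\<^sup>2 - (norm (x - a))\<^sup>2) powr ((2 - \<beta> - real d) / 2)
            * indicator (ball a (radius2 d \<beta>)) x))))"
proof -
  have d: "d = DIM(real ^ 'n)" using assms(1) by simp
  have \<beta>: "- real DIM(real ^ 'n) < \<beta>" "\<beta> < 2" "\<beta> < 4 - real DIM(real ^ 'n)"
    using assms(2,3) unfolding d by auto
  have d0: "d > 0" using assms(1) by simp
  have min: "minimal_energy TYPE(real ^ 'n) 2 \<beta> = ereal (optimal_energy d \<beta>)"
    unfolding minimal_energy_def
  proof (rule antisym)
    have "minimizer \<beta> (0 :: real ^ 'n) \<in> borel_prob_measures"
      using \<beta> by (simp add: borel_prob_measures_def prob_space_minimizer)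
    then show "(INF \<mu> \<in> (borel_prob_measures :: (real ^ 'n) measure set). energy 2 \<beta> \<mu>) \<le> ereal (optimal_energy d \<beta>)"
      unfolding d energy_minimizer_eq[OF \<beta>, of 0, symmetric] by (rule INF_lower)
    show "ereal (optimal_energy d \<beta>) \<le> (INF \<mu> \<in> (borel_prob_measures :: (real ^ 'n) measure set). energy 2 \<beta> \<mu>)"
      unfolding d by (intro INF_greatest energy_lower_bound(1)[OF \<beta>]) (auto simp: borel_prob_measures_def)
  qed
  have iff: "energy_minimizer 2 \<beta> \<mu> \<longleftrightarrow> (\<exists>a. \<mu> = minimizer \<beta> a)" for \<mu> :: "(real ^ 'n) measure"
    unfolding energy_minimizer_def min
  proof
    assume "\<mu> \<in> borel_prob_measures \<and> energy 2 \<beta> \<mu> = ereal (optimal_energy d \<beta>)"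
    then show "\<exists>a. \<mu> = minimizer \<beta> a"
      unfolding d by (intro energy_lower_bound(2)[OF \<beta>]) (auto simp: borel_prob_measures_def)
  next
    assume "\<exists>a. \<mu> = minimizer \<beta> a"
    then show "\<mu> \<in> borel_prob_measures \<and> energy 2 \<beta> \<mu> = ereal (optimal_energy d \<beta>)"
      unfolding d using \<beta> by (auto simp: borel_prob_measures_def prob_space_minimizer energy_minimizer_eq)
  qed
  show ?thesis
    unfolding min iff minimizer_eq_density[OF \<beta>] d[symmetric] optimal_energy_eq[OF assms(2) \<beta>(2) d0] by simp
qed

end
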